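(* Let $k$ be a field and let $A,B$ be $k$-algebras. Then $$P(A,[B^\circ,k])\cong P(A\triangleleft B^\circ,k)\cong(A\triangleleft B^\circ)^\circ .$$ In the case where $B$ is finite dimensional, $P(A,B)\cong P(A\triangleleft B^\circ,k)$. (All isomorphisms are isomorphisms of coalgebras.)
   Context: Everything is over a field $k$; algebras are associative unital, coalgebras coassociative counital. Sweedler notation: $\triangle h=\sum_{(h)}h_{(2)}\otimes h_{(1)}$, counit $\epsilon$. For an algebra $S$, the dual coalgebra $S^\circ$ is the subspace of $S^*$ of elements vanishing on some ideal of $S$ of finite codimension, with comultiplication dual to the multiplication of $S$. For a coalgebra $H$ and algebra $B$, $[H,B]=\mathrm{Hom}_k(H,B)$ with convolution product $(\alpha*\beta)(h)=\sum_{(h)}\alpha(h_{(2)})\beta(h_{(1)})$. The Sweedler product of an algebra $A$ and a coalgebra $H$ is $A\triangleleft H=T(A\otimes H)/J$, with $T$ the tensor algebra and $J$ the two-sided ideal generated by $aa'\otimes h-\sum_{(h)}(a\otimes h_{(2)})\cdot(a'\otimes h_{(1)})$ and $1_A\otimes h-\epsilon(h)1$ for $a,a'\in A$, $h\in H$. A linear map $\rho:H\to\mathrm{Hom}_k(A,B)$ from a coalgebra measures if $\rho(h)(aa')=\sum_{(h)}\rho(h_{(2)})(a)\rho(h_{(1)})(a')$ and $\rho(h)(1_A)=\epsilon(h)1_B$. The universal measuring coalgebra $\pi:P(A,B)\to\mathrm{Hom}_k(A,B)$ is the (existing) measuring coalgebra through which every measuring $\rho:H\to\mathrm{Hom}_k(A,B)$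 factors by a unique coalgebra map $H\to P(A,B)$. *)

theory Defs
  imports "HOL-Algebra.QuotRing" "Jordan_Normal_Form.Missing_VectorSpace"
begin

text \<open>
  Vector spaces, linear maps, spans and finite dimension are those of the \<open>VectorSpace\<close> entry, over
  a field given as a ring record. Where a structure is only used as a vector space, the
  fields \<open>mult\<close> and \<open>one\<close> of its module record carry no meaning. Functions that are elements of a
  structure are made unique by requiring them to be extensional on the carrier of their domain.
\<close>

text \<open>The library locale \<^locale>\<open>algebra\<close> is restricted to commutative algebras.\<close>

locale assoc_algebra = vectorspace K A + A?: ring A for K and A +
  assumes smult_mult_left:
      "\<lbrakk>a \<in> carrier K; x \<in> carrier A; y \<in> carrier A\<rbrakk> \<Longrightarrow>
        (a \<odot>\<^bsub>A\<^esub> x) \<otimes>\<^bsub>A\<^esub> y = a \<odot>\<^bsub>A\<^esub> (x \<otimes>\<^bsub>A\<^esub> y)"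
    and smult_mult_right:
      "\<lbrakk>a \<in> carrier K; x \<in> carrier A; y \<in> carrier A\<rbrakk> \<Longrightarrow>
        x \<otimes>\<^bsub>A\<^esub> (a \<odot>\<^bsub>A\<^esub> y) = a \<odot>\<^bsub>A\<^esub> (x \<otimes>\<^bsub>A\<^esub> y)"

definition base_algebra :: "('k, 'm) ring_scheme \<Rightarrow> ('k, 'k) module" where
  "base_algebra K =
    \<lparr>carrier = carrier K, monoid.mult = monoid.mult K, one = \<one>\<^bsub>K\<^esub>,
     ring.zero = \<zero>\<^bsub>K\<^esub>, ring.add = ring.add K, module.smult = monoid.mult K\<rparr>"

text \<open>
  The library's ring \<open>M Quot N\<close> of additive cosets together with the induced scalar multiplication.
  It serves both for algebras modulo an ideal and for vector spaces modulo a subspace.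
\<close>

definition quotient_module :: "('k, 'v, 'm) module_scheme \<Rightarrow> 'v set \<Rightarrow> ('k, 'v set) module" where
  "quotient_module M N =
    \<lparr>carrier = carrier (M Quot N), monoid.mult = monoid.mult (M Quot N), one = \<one>\<^bsub>M Quot N\<^esub>,
     ring.zero = \<zero>\<^bsub>M Quot N\<^esub>, ring.add = ring.add (M Quot N),
     module.smult = (\<lambda>a X. \<Union>x\<in>X. N +>\<^bsub>M\<^esub> (a \<odot>\<^bsub>M\<^esub> x))\<rparr>"

definition hom_space ::
  "('k, 'm) ring_scheme \<Rightarrow> ('k, 'v, 'mv) module_scheme \<Rightarrow> ('k, 'w, 'mw) module_scheme
    \<Rightarrow> ('k, 'v \<Rightarrow> 'w) module" where
  "hom_space K V W =
    \<lparr>carrier = module_hom K V W \<inter> extensional (carrier V), monoid.mult = undefined, one = undefined,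
     ring.zero = (\<lambda>v\<in>carrier V. \<zero>\<^bsub>W\<^esub>),
     ring.add = (\<lambda>f g. \<lambda>v\<in>carrier V. f v \<oplus>\<^bsub>W\<^esub> g v),
     module.smult = (\<lambda>a f. \<lambda>v\<in>carrier V. a \<odot>\<^bsub>W\<^esub> f v)\<rparr>"

definition free_module :: "('k, 'm) ring_scheme \<Rightarrow> 'x set \<Rightarrow> ('k, 'x \<Rightarrow> 'k) module" where
  "free_module K X =
    \<lparr>carrier = {f. (\<forall>x. f x \<in> carrier K) \<and> (\<forall>x. x \<notin> X \<longrightarrow> f x = \<zero>\<^bsub>K\<^esub>) \<and> finite {x. f x \<noteq> \<zero>\<^bsub>K\<^esub>}},
     monoid.mult = undefined, one = undefined,
     ring.zero = (\<lambda>x. \<zero>\<^bsub>K\<^esub>),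
     ring.add = (\<lambda>f g x. f x \<oplus>\<^bsub>K\<^esub> g x),
     module.smult = (\<lambda>a f x. a \<otimes>\<^bsub>K\<^esub> f x)\<rparr>"

definition free_gen :: "('k, 'm) ring_scheme \<Rightarrow> 'x \<Rightarrow> 'x \<Rightarrow> 'k" where
  "free_gen K x = (\<lambda>y. if y = x then \<one>\<^bsub>K\<^esub> else \<zero>\<^bsub>K\<^esub>)"

definition tensor_relations ::
  "('k, 'm) ring_scheme \<Rightarrow> ('k, 'v, 'mv) module_scheme \<Rightarrow> ('k, 'w, 'mw) module_scheme
    \<Rightarrow> ('v \<times> 'w \<Rightarrow> 'k) set" where
  "tensor_relations K V W = (let F = free_module K (carrier V \<times> carrier W); \<delta> = free_gen K in
    {\<delta> (v \<oplus>\<^bsub>V\<^esub> v', w) \<ominus>\<^bsub>F\<^esub> \<delta> (v, w) \<ominus>\<^bsub>F\<^esub> \<delta> (v', w) | v v' w.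
      v \<in> carrier V \<and> v' \<in> carrier V \<and> w \<in> carrier W} \<union>
    {\<delta> (v, w \<oplus>\<^bsub>W\<^esub> w') \<ominus>\<^bsub>F\<^esub> \<delta> (v, w) \<ominus>\<^bsub>F\<^esub> \<delta> (v, w') | v w w'.
      v \<in> carrier V \<and> w \<in> carrier W \<and> w' \<in> carrier W} \<union>
    {\<delta> (a \<odot>\<^bsub>V\<^esub> v, w) \<ominus>\<^bsub>F\<^esub> a \<odot>\<^bsub>F\<^esub> \<delta> (v, w) | a v w.
      a \<in> carrier K \<and> v \<in> carrier V \<and> w \<in> carrier W} \<union>
    {\<delta> (v, a \<odot>\<^bsub>W\<^esub> w) \<ominus>\<^bsub>F\<^esub> a \<odot>\<^bsub>F\<^esub> \<delta> (v, w) | a v w.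
      a \<in> carrier K \<and> v \<in> carrier V \<and> w \<in> carrier W})"

definition tensor_null ::
  "('k, 'm) ring_scheme \<Rightarrow> ('k, 'v, 'mv) module_scheme \<Rightarrow> ('k, 'w, 'mw) module_scheme
    \<Rightarrow> ('v \<times> 'w \<Rightarrow> 'k) set" where
  "tensor_null K V W =
    module.span K (free_module K (carrier V \<times> carrier W)) (tensor_relations K V W)"

type_synonym ('k, 'v, 'w) tensor = "('v \<times> 'w \<Rightarrow> 'k) set"

definition tensor ::
  "('k, 'm) ring_scheme \<Rightarrow> ('k, 'v, 'mv) module_scheme \<Rightarrow> ('k, 'w, 'mw) module_scheme
    \<Rightarrow> ('k, ('k, 'v, 'w) tensor) module" where
  "tensor K V W = quotient_module (free_module K (carrier V \<times> carrier W)) (tensor_null K V W)"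

definition pure_tensor ::
  "('k, 'm) ring_scheme \<Rightarrow> ('k, 'v, 'mv) module_scheme \<Rightarrow> ('k, 'w, 'mw) module_scheme
    \<Rightarrow> 'v \<Rightarrow> 'w \<Rightarrow> ('k, 'v, 'w) tensor" where
  "pure_tensor K V W v w =
    tensor_null K V W +>\<^bsub>free_module K (carrier V \<times> carrier W)\<^esub> free_gen K (v, w)"

text \<open>
  The value at the tensor \<open>t\<close> of the linear map to \<open>U\<close> induced by \<open>\<beta>\<close>: if \<open>t\<close> is the sum of
  \<open>v\<^sub>i \<otimes> w\<^sub>i\<close>, it is the sum of \<open>\<beta> v\<^sub>i w\<^sub>i\<close>. For bilinear \<open>\<beta>\<close> (the only use made of it) the choice of
  the representative is immaterial. Applied to a comultiplication \<open>\<Delta> h\<close> this renders the Sweedler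
  sum of \<open>\<beta> h\<^sub>(\<^sub>2\<^sub>) h\<^sub>(\<^sub>1\<^sub>)\<close>; note that the \<^emph>\<open>first\<close> tensor factor of \<open>\<Delta> h\<close> is written \<open>h\<^sub>(\<^sub>2\<^sub>)\<close> and the
  second one \<open>h\<^sub>(\<^sub>1\<^sub>)\<close>.
\<close>

definition tensor_lift ::
  "('k, 'm) ring_scheme \<Rightarrow> ('k, 'u, 'mu) module_scheme \<Rightarrow> ('v \<Rightarrow> 'w \<Rightarrow> 'u)
    \<Rightarrow> ('k, 'v, 'w) tensor \<Rightarrow> 'u" where
  "tensor_lift K U \<beta> t = (let f = (SOME f. f \<in> t) in
    \<Oplus>\<^bsub>U\<^esub>p\<in>{p. f p \<noteq> \<zero>\<^bsub>K\<^esub>}. f p \<odot>\<^bsub>U\<^esub> \<beta> (fst p) (snd p))"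

record ('k, 'c) coalgebra = "('k, 'c) module" +
  comult :: "'c \<Rightarrow> ('k, 'c, 'c) tensor"
  counit :: "'c \<Rightarrow> 'k"

text \<open>
  Coassociativity is stated in \<open>C \<otimes> (C \<otimes> C)\<close>, composing the map \<open>(\<Delta> \<otimes> id) \<circ> \<Delta>\<close>
  with the associator.
\<close>

locale coalgebra = vectorspace K C
  for K :: "('k, 'm) ring_scheme" and C :: "('k, 'c, 'mc) coalgebra_scheme" +
  assumes comult_linear: "comult C \<in> module_hom K C (tensor K C C)"
    and counit_linear: "counit C \<in> module_hom K C (base_algebra K)"
    and coassoc: "c \<in> carrier C \<Longrightarrow>
      tensor_lift K (tensor K C (tensor K C C))
        (\<lambda>x y. tensor_lift K (tensor K C (tensor K C C))
          (\<lambda>u v. pure_tensor K C (tensor K C C) u (pure_tensor K C C v y)) (comult C x))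
        (comult C c) =
      tensor_lift K (tensor K C (tensor K C C))
        (\<lambda>x y. pure_tensor K C (tensor K C C) x (comult C y)) (comult C c)"
    and counit_left: "c \<in> carrier C \<Longrightarrow>
      tensor_lift K C (\<lambda>x y. counit C x \<odot>\<^bsub>C\<^esub> y) (comult C c) = c"
    and counit_right: "c \<in> carrier C \<Longrightarrow>
      tensor_lift K C (\<lambda>x y. counit C y \<odot>\<^bsub>C\<^esub> x) (comult C c) = c"

definition coalgebra_hom ::
  "('k, 'm) ring_scheme \<Rightarrow> ('k, 'c, 'mc) coalgebra_scheme \<Rightarrow> ('k, 'd, 'md) coalgebra_scheme
    \<Rightarrow> ('c \<Rightarrow> 'd) set" where
  "coalgebra_hom K C D = {f \<in> module_hom K C D. \<forall>c\<in>carrier C.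
    comult D (f c) =
      tensor_lift K (tensor K D D) (\<lambda>x y. pure_tensor K D D (f x) (f y)) (comult C c) \<and>
    counit D (f c) = counit C c}"

definition coalgebra_isomorphic ::
  "('k, 'm) ring_scheme \<Rightarrow> ('k, 'c, 'mc) coalgebra_scheme \<Rightarrow> ('k, 'd, 'md) coalgebra_scheme
    \<Rightarrow> bool" where
  "coalgebra_isomorphic K C D \<longleftrightarrow>
    (\<exists>f \<in> coalgebra_hom K C D. bij_betw f (carrier C) (carrier D))"

definition finite_dual_space ::
  "('k, 'm) ring_scheme \<Rightarrow> ('k, 's, 'ms) module_scheme \<Rightarrow> ('k, 's \<Rightarrow> 'k) module" where
  "finite_dual_space K S = (hom_space K S (base_algebra K))
    \<lparr>carrier := {f \<in> carrier (hom_space K S (base_algebra K)).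
      \<exists>I. ideal I S \<and> vectorspace.fin_dim K (quotient_module S I) \<and> (\<forall>x\<in>I. f x = \<zero>\<^bsub>K\<^esub>)}\<rparr>"

text \<open>
  The comultiplication is dual to the multiplication: \<open>\<Delta> f\<close> is the unique element of
  the tensor square of the dual coalgebra with \<open>f (x y) = \<Sum> f\<^sub>(\<^sub>2\<^sub>) x \<cdot> f\<^sub>(\<^sub>1\<^sub>) y\<close>.
\<close>

definition dual_coalgebra ::
  "('k, 'm) ring_scheme \<Rightarrow> ('k, 's, 'ms) module_scheme \<Rightarrow> ('k, 's \<Rightarrow> 'k) coalgebra" where
  "dual_coalgebra K S = (let V = finite_dual_space K S in
    \<lparr>carrier = carrier V, monoid.mult = undefined, one = undefined,
     ring.zero = \<zero>\<^bsub>V\<^esub>, ring.add = ring.add V, module.smult = module.smult V,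
     comult = (\<lambda>f. THE t. t \<in> carrier (tensor K V V) \<and>
       (\<forall>x\<in>carrier S. \<forall>y\<in>carrier S.
         f (x \<otimes>\<^bsub>S\<^esub> y) = tensor_lift K (base_algebra K) (\<lambda>g h. g x \<otimes>\<^bsub>K\<^esub> h y) t)),
     counit = (\<lambda>f. f \<one>\<^bsub>S\<^esub>)\<rparr>)"

definition convolution_algebra ::
  "('k, 'm) ring_scheme \<Rightarrow> ('k, 'h, 'mh) coalgebra_scheme \<Rightarrow> ('k, 'b, 'mb) module_scheme
    \<Rightarrow> ('k, 'h \<Rightarrow> 'b) module" where
  "convolution_algebra K H B = (hom_space K H B)
    \<lparr>monoid.mult := (\<lambda>\<alpha> \<beta>. \<lambda>h\<in>carrier H. tensor_lift K B (\<lambda>x y. \<alpha> x \<otimes>\<^bsub>B\<^esub> \<beta> y) (comult H h)),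
     one := (\<lambda>h\<in>carrier H. counit H h \<odot>\<^bsub>B\<^esub> \<one>\<^bsub>B\<^esub>)\<rparr>"

definition word_algebra :: "('k, 'm) ring_scheme \<Rightarrow> 'x set \<Rightarrow> ('k, 'x list \<Rightarrow> 'k) module" where
  "word_algebra K X = (free_module K (lists X))
    \<lparr>monoid.mult := (\<lambda>f g w. \<Oplus>\<^bsub>K\<^esub>i\<in>{..length w}. f (take i w) \<otimes>\<^bsub>K\<^esub> g (drop i w)),
     one := free_gen K []\<rparr>"

text \<open>
  The powers of \<open>V\<close> of varying degree have no common type, so the tensor algebra is given as the free
  algebra of words over the carrier of \<open>V\<close> modulo the linear relations of \<open>V\<close>. The ideal generated
  by these is homogeneous for the length of words, and in length \<open>n\<close> it is spanned by the multilinear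
  relations in \<open>n\<close> letters, whence the component of degree \<open>n\<close> is the \<open>n\<close>-th tensor power of \<open>V\<close>.
\<close>

definition tensor_algebra_ideal ::
  "('k, 'm) ring_scheme \<Rightarrow> ('k, 'v, 'mv) module_scheme \<Rightarrow> ('v list \<Rightarrow> 'k) set" where
  "tensor_algebra_ideal K V = (let W = word_algebra K (carrier V); \<delta> = free_gen K in
    Idl\<^bsub>W\<^esub> ({\<delta> [v \<oplus>\<^bsub>V\<^esub> v'] \<ominus>\<^bsub>W\<^esub> \<delta> [v] \<ominus>\<^bsub>W\<^esub> \<delta> [v'] | v v'. v \<in> carrier V \<and> v' \<in> carrier V} \<union>
      {\<delta> [a \<odot>\<^bsub>V\<^esub> v] \<ominus>\<^bsub>W\<^esub> a \<odot>\<^bsub>W\<^esub> \<delta> [v] | a v. a \<in> carrier K \<and> v \<in> carrier V}))"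

definition tensor_algebra ::
  "('k, 'm) ring_scheme \<Rightarrow> ('k, 'v, 'mv) module_scheme \<Rightarrow> ('k, ('v list \<Rightarrow> 'k) set) module" where
  "tensor_algebra K V = quotient_module (word_algebra K (carrier V)) (tensor_algebra_ideal K V)"

definition tensor_algebra_incl ::
  "('k, 'm) ring_scheme \<Rightarrow> ('k, 'v, 'mv) module_scheme \<Rightarrow> 'v \<Rightarrow> ('v list \<Rightarrow> 'k) set" where
  "tensor_algebra_incl K V v =
    tensor_algebra_ideal K V +>\<^bsub>word_algebra K (carrier V)\<^esub> free_gen K [v]"

definition sweedler_ideal ::
  "('k, 'm) ring_scheme \<Rightarrow> ('k, 'a, 'ma) module_scheme \<Rightarrow> ('k, 'h, 'mh) coalgebra_scheme
    \<Rightarrow> (('k, 'a, 'h) tensor list \<Rightarrow> 'k) set set" where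
  "sweedler_ideal K A H =
    (let T = tensor_algebra K (tensor K A H);
         \<tau> = (\<lambda>a h. tensor_algebra_incl K (tensor K A H) (pure_tensor K A H a h)) in
      Idl\<^bsub>T\<^esub> (
        {\<tau> (a \<otimes>\<^bsub>A\<^esub> a') h \<ominus>\<^bsub>T\<^esub> tensor_lift K T (\<lambda>x y. \<tau> a x \<otimes>\<^bsub>T\<^esub> \<tau> a' y) (comult H h) | a a' h.
          a \<in> carrier A \<and> a' \<in> carrier A \<and> h \<in> carrier H} \<union>
        {\<tau> \<one>\<^bsub>A\<^esub> h \<ominus>\<^bsub>T\<^esub> counit H h \<odot>\<^bsub>T\<^esub> \<one>\<^bsub>T\<^esub> | h. h \<in> carrier H}))"

type_synonym ('k, 'a, 'h) sweedler = "(('k, 'a, 'h) tensor list \<Rightarrow> 'k) set set"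

definition sweedler_product ::
  "('k, 'm) ring_scheme \<Rightarrow> ('k, 'a, 'ma) module_scheme \<Rightarrow> ('k, 'h, 'mh) coalgebra_scheme
    \<Rightarrow> ('k, ('k, 'a, 'h) sweedler) module" where
  "sweedler_product K A H =
    quotient_module (tensor_algebra K (tensor K A H)) (sweedler_ideal K A H)"

definition measuring ::
  "('k, 'm) ring_scheme \<Rightarrow> ('k, 'h, 'mh) coalgebra_scheme
    \<Rightarrow> ('k, 'a, 'ma) module_scheme \<Rightarrow> ('k, 'b, 'mb) module_scheme \<Rightarrow> ('h \<Rightarrow> 'a \<Rightarrow> 'b) \<Rightarrow> bool" where
  "measuring K H A B \<rho> \<longleftrightarrow>
    \<rho> \<in> module_hom K H (hom_space K A B) \<and>
    (\<forall>h\<in>carrier H. \<forall>a\<in>carrier A. \<forall>a'\<in>carrier A.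
      \<rho> h (a \<otimes>\<^bsub>A\<^esub> a') = tensor_lift K B (\<lambda>x y. \<rho> x a \<otimes>\<^bsub>B\<^esub> \<rho> y a') (comult H h)) \<and>
    (\<forall>h\<in>carrier H. \<rho> h \<one>\<^bsub>A\<^esub> = counit H h \<odot>\<^bsub>B\<^esub> \<one>\<^bsub>B\<^esub>)"

text \<open>
  A formula cannot quantify over types, so the universal property refers to the measuring coalgebras
  \<open>H\<close> whose carrier lies in a given type \<open>'h\<close>. Every element of a coalgebra lies in a
  finite-dimensional subcoalgebra, so as soon as \<open>'h\<close> is large enough to accommodate the
  finite-dimensional coalgebras over \<open>K\<close> (e.g. if \<open>nat \<Rightarrow> 'k\<close> embeds into it), this is the universal
  property with respect to all coalgebras.
\<close>

definition universal_measuring_coalgebra ::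
  "'h itself \<Rightarrow> ('k, 'm) ring_scheme \<Rightarrow> ('k, 'a, 'ma) module_scheme \<Rightarrow> ('k, 'b, 'mb) module_scheme
    \<Rightarrow> ('k, 'p, 'mp) coalgebra_scheme \<Rightarrow> ('p \<Rightarrow> 'a \<Rightarrow> 'b) \<Rightarrow> bool" where
  "universal_measuring_coalgebra TYPE('h) K A B P \<pi> \<longleftrightarrow>
    coalgebra K P \<and> measuring K P A B \<pi> \<and>
    (\<forall>(H :: ('k, 'h) coalgebra) \<rho>. coalgebra K H \<and> measuring K H A B \<rho> \<longrightarrow>
      (\<exists>!\<phi>. \<phi> \<in> coalgebra_hom K H P \<inter> extensional (carrier H) \<and>
        (\<forall>h\<in>carrier H. \<pi> (\<phi> h) = \<rho> h)))"

end

theory Submission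
  imports Defs
begin

text \<open>
  A measuring of \<open>H\<close> from \<open>A\<close> to \<open>[C, k]\<close> is a family of functionals on \<open>H \<otimes> A \<otimes> C\<close>. The conditions on
  it say that \<open>a \<otimes> c\<close> acts on \<open>H\<close> through an algebra homomorphism from the Sweedler product \<open>S\<close> of
  \<open>A\<close> and \<open>C\<close> to the convolution algebra \<open>[H, k]\<close>, that is, that the family extends to a measuring
  of \<open>H\<close> from \<open>S\<close> to \<open>k\<close>. By the coassociativity of \<open>H\<close>, such a measuring takes values in the dual
  coalgebra of \<open>S\<close>, and it is then the same as a coalgebra homomorphism to that coalgebra. With \<open>C\<close>
  the dual coalgebra of \<open>B\<close>, the dual coalgebra of \<open>S\<close> thus has the universal property of both \<open>P\<close>
  and \<open>Q\<close>, for measuring coalgebras in any type. If \<open>B\<close> is finite-dimensional, evaluation is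
  an isomorphism of algebras from \<open>B\<close> to \<open>[C, k]\<close>.
\<close>

section \<open>Linear maps\<close>

text \<open>A Sweedler sum is a value of \<open>tensor_lift\<close>, which is independent of the
  chosen representative only for bilinear forms; identities between such sums are obtained by moving
  linear maps under the sum and comparing on pure tensors. The passage between [C,k] and the
  Sweedler product rests on a Fubini rule: unfolding the product of [C,k] turns the measuring
  identity into a double sum over the comultiplications of H and C, and after exchanging the two
  sums it is an identity in [H,k]. The comultiplication of the dual coalgebra is a definite
  description. Its existence needs a dual basis modulo an ideal of finite codimension; its
  uniqueness needs that evaluations at pairs of elements separate the tensor square. Since ideals
  are awkward to combine when functionals are added, membership in the dual is recast in terms of
  finite sets of functionals. A universal property speaks about test coalgebras of one type, so
  comparing two universal objects needs both carrier types. P and Q are each assumed universal for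
  their own type and that of the dual coalgebra, through which they are compared.\<close>

lemma module_homI:
  assumes "\<And>x. x \<in> carrier V \<Longrightarrow> f x \<in> carrier W"
    and "\<And>x y. \<lbrakk>x \<in> carrier V; y \<in> carrier V\<rbrakk> \<Longrightarrow> f (x \<oplus>\<^bsub>V\<^esub> y) = f x \<oplus>\<^bsub>W\<^esub> f y"
    and "\<And>a x. \<lbrakk>a \<in> carrier K; x \<in> carrier V\<rbrakk> \<Longrightarrow> f (a \<odot>\<^bsub>V\<^esub> x) = a \<odot>\<^bsub>W\<^esub> f x"
  shows "f \<in> module_hom K V W"
  using assms by (auto simp: module_hom_def)

lemma module_hom_mem: "\<lbrakk>f \<in> module_hom K V W; x \<in> carrier V\<rbrakk> \<Longrightarrow> f x \<in> carrier W"
  by (auto simp: module_hom_def)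

lemma mod_hom_intro:
  "\<lbrakk>vectorspace K V; vectorspace K W; f \<in> module_hom K V W\<rbrakk> \<Longrightarrow> mod_hom K V W f"
  by (auto simp: mod_hom_def mod_hom_axioms_def vectorspace_def)

lemma module_hom_zero:
  "\<lbrakk>vectorspace K V; vectorspace K W; f \<in> module_hom K V W\<rbrakk> \<Longrightarrow> f \<zero>\<^bsub>V\<^esub> = \<zero>\<^bsub>W\<^esub>"
  using mod_hom.f0_is_0 mod_hom_intro by metis

lemma module_hom_minus:
  "\<lbrakk>vectorspace K V; vectorspace K W; f \<in> module_hom K V W; x \<in> carrier V; y \<in> carrier V\<rbrakk>
    \<Longrightarrow> f (x \<ominus>\<^bsub>V\<^esub> y) = f x \<ominus>\<^bsub>W\<^esub> f y"
  using mod_hom.f_minus mod_hom_intro by metis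

lemma module_hom_finsum:
  assumes V: "vectorspace K V" and W: "vectorspace K W" and f: "f \<in> module_hom K V W"
    and g: "g \<in> A \<rightarrow> carrier V"
  shows "f (\<Oplus>\<^bsub>V\<^esub>i\<in>A. g i) = (\<Oplus>\<^bsub>W\<^esub>i\<in>A. f (g i))"
proof -
  interpret V: vectorspace K V by fact
  interpret W: vectorspace K W by fact
  from g show ?thesis
  proof (induct A rule: infinite_finite_induct)
    case (insert a A)
    then have "g \<in> A \<rightarrow> carrier V" "g a \<in> carrier V" by auto
    moreover from this have "(\<lambda>i. f (g i)) \<in> A \<rightarrow> carrier W"
      using module_hom_mem[OF f] by auto
    ultimately show ?case
      using insert module_hom_mem[OF f] by (simp add: module_hom_add[OF f])
  qed (simp_all add: module_hom_zero[OF V W f])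
qed

lemma module_hom_cong:
  assumes "f \<in> module_hom K V W" "\<And>x. x \<in> carrier V \<Longrightarrow> f x = g x" "vectorspace K V"
  shows "g \<in> module_hom K V W"
proof -
  interpret V: vectorspace K V by fact
  show ?thesis
    using assms(1,2) by (auto simp: module_hom_def Pi_def)
qed

lemma module_hom_restrict:
  "\<lbrakk>f \<in> module_hom K V W; vectorspace K V\<rbrakk> \<Longrightarrow> restrict f (carrier V) \<in> module_hom K V W"
  by (rule module_hom_cong) auto

lemma module_hom_id: "(\<lambda>x. x) \<in> module_hom K V V"
  by (auto simp: module_hom_def)

lemma module_hom_comp:
  "\<lbrakk>g \<in> module_hom K V W; f \<in> module_hom K U V\<rbrakk> \<Longrightarrow> (\<lambda>x. g (f x)) \<in> module_hom K U W"
  by (auto simp: module_hom_def Pi_def)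

lemma module_hom_plus:
  assumes "vectorspace K W" "f \<in> module_hom K V W" "g \<in> module_hom K V W"
  shows "(\<lambda>x. f x \<oplus>\<^bsub>W\<^esub> g x) \<in> module_hom K V W"
proof -
  interpret W: vectorspace K W by fact
  show ?thesis
    using assms(2,3) by (auto simp: module_hom_def Pi_def W.smult_r_distr W.a_ac)
qed

lemma module_hom_smult_left:
  assumes "vectorspace K W" "f \<in> module_hom K V W" "a \<in> carrier K"
  shows "(\<lambda>x. a \<odot>\<^bsub>W\<^esub> f x) \<in> module_hom K V W"
proof -
  interpret W: vectorspace K W by fact
  have "a \<odot>\<^bsub>W\<^esub> (b \<odot>\<^bsub>W\<^esub> y) = b \<odot>\<^bsub>W\<^esub> (a \<odot>\<^bsub>W\<^esub> y)" if "b \<in> carrier K" "y \<in> carrier W" for b y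
    using that assms(3) by (metis W.smult_assoc1 W.m_comm)
  then show ?thesis
    using assms(2,3) by (auto simp: module_hom_def Pi_def W.smult_r_distr)
qed

section \<open>The ground field as an algebra\<close>

lemma base_algebra_simps [simp]:
  "carrier (base_algebra K) = carrier K"
  "monoid.mult (base_algebra K) = monoid.mult K"
  "\<one>\<^bsub>base_algebra K\<^esub> = \<one>\<^bsub>K\<^esub>"
  "\<zero>\<^bsub>base_algebra K\<^esub> = \<zero>\<^bsub>K\<^esub>"
  "ring.add (base_algebra K) = ring.add K"
  "module.smult (base_algebra K) = monoid.mult K"
  by (simp_all add: base_algebra_def)

lemma vectorspace_base_algebra: "field K \<Longrightarrow> vectorspace K (base_algebra K)"
proof -
  assume "field K"
  then interpret field K .
  show ?thesis
    by (rule vs_criteria)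
      (auto simp: a_ac l_distr r_distr m_assoc \<open>field K\<close> intro: add.r_inv_ex)
qed

text \<open>Distributivity and both scalar laws enter as linearity of the one-sided multiplications,
  which is the form in which they arise for convolution algebras, quotients and word
  algebras.\<close>

lemma assoc_algebraI:
  assumes V: "vectorspace K A"
    and closed: "\<And>x y. \<lbrakk>x \<in> carrier A; y \<in> carrier A\<rbrakk> \<Longrightarrow> x \<otimes>\<^bsub>A\<^esub> y \<in> carrier A"
    and one: "\<one>\<^bsub>A\<^esub> \<in> carrier A"
    and assoc: "\<And>x y z. \<lbrakk>x \<in> carrier A; y \<in> carrier A; z \<in> carrier A\<rbrakk>
      \<Longrightarrow> (x \<otimes>\<^bsub>A\<^esub> y) \<otimes>\<^bsub>A\<^esub> z = x \<otimes>\<^bsub>A\<^esub> (y \<otimes>\<^bsub>A\<^esub> z)"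
    and unit: "\<And>x. x \<in> carrier A \<Longrightarrow> \<one>\<^bsub>A\<^esub> \<otimes>\<^bsub>A\<^esub> x = x" "\<And>x. x \<in> carrier A \<Longrightarrow> x \<otimes>\<^bsub>A\<^esub> \<one>\<^bsub>A\<^esub> = x"
    and left: "\<And>y. y \<in> carrier A \<Longrightarrow> (\<lambda>x. x \<otimes>\<^bsub>A\<^esub> y) \<in> module_hom K A A"
    and right: "\<And>x. x \<in> carrier A \<Longrightarrow> (\<lambda>y. x \<otimes>\<^bsub>A\<^esub> y) \<in> module_hom K A A"
  shows "assoc_algebra K A"
proof -
  interpret vectorspace K A by fact
  have "ring A"
    using M.abelian_group_axioms
    by (intro ringI monoidI)
      (auto intro: closed one assoc unit module_hom_add[OF left] module_hom_add[OF right])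
  then show ?thesis
    unfolding assoc_algebra_def assoc_algebra_axioms_def
    using V module_hom_smult[OF left] module_hom_smult[OF right] by blast
qed

lemma assoc_algebra_vectorspace: "assoc_algebra K A \<Longrightarrow> vectorspace K A"
  by (simp add: assoc_algebra_def)

lemma assoc_algebra_mult_left:
  assumes "assoc_algebra K A" "y \<in> carrier A"
  shows "(\<lambda>x. x \<otimes>\<^bsub>A\<^esub> y) \<in> module_hom K A A"
proof -
  interpret assoc_algebra K A by fact
  show ?thesis using assms(2) by (auto intro!: module_homI simp: l_distr smult_mult_left)
qed

lemma assoc_algebra_mult_right:
  assumes "assoc_algebra K A" "x \<in> carrier A"
  shows "(\<lambda>y. x \<otimes>\<^bsub>A\<^esub> y) \<in> module_hom K A A"
proof -
  interpret assoc_algebra K A by fact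
  show ?thesis using assms(2) by (auto intro!: module_homI simp: r_distr smult_mult_right)
qed

lemma assoc_algebra_base_algebra:
  assumes "field K" shows "assoc_algebra K (base_algebra K)"
proof -
  interpret field K by fact
  show ?thesis
    by (rule assoc_algebraI[OF vectorspace_base_algebra[OF assms]])
      (auto simp: m_assoc l_distr r_distr m_lcomm intro!: module_homI)
qed

section \<open>Spaces of linear maps\<close>

lemma hom_space_simps [simp]:
  "carrier (hom_space K V W) = module_hom K V W \<inter> extensional (carrier V)"
  "\<zero>\<^bsub>hom_space K V W\<^esub> = (\<lambda>v\<in>carrier V. \<zero>\<^bsub>W\<^esub>)"
  "f \<oplus>\<^bsub>hom_space K V W\<^esub> g = (\<lambda>v\<in>carrier V. f v \<oplus>\<^bsub>W\<^esub> g v)"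
  "a \<odot>\<^bsub>hom_space K V W\<^esub> f = (\<lambda>v\<in>carrier V. a \<odot>\<^bsub>W\<^esub> f v)"
  by (simp_all add: hom_space_def)

lemma module_hom_const_zero:
  assumes "vectorspace K W" shows "(\<lambda>v. \<zero>\<^bsub>W\<^esub>) \<in> module_hom K V W"
proof -
  interpret W: vectorspace K W by fact
  show ?thesis by (auto simp: module_hom_def)
qed

lemma vectorspace_hom_space:
  assumes V: "vectorspace K V" and W: "vectorspace K W"
  shows "vectorspace K (hom_space K V W)"
proof -
  interpret V: vectorspace K V by fact
  interpret W: vectorspace K W by fact
  let ?H = "hom_space K V W"
  have mem: "f v \<in> carrier W" if "f \<in> carrier ?H" "v \<in> carrier V" for f v
    using that by (auto intro: module_hom_mem)
  have eqI: "f = g" if "f \<in> carrier ?H" "g \<in> carrier ?H" "\<And>v. v \<in> carrier V \<Longrightarrow> f v = g v" for f g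
    using that by (auto intro: extensionalityI)
  have zero: "\<zero>\<^bsub>?H\<^esub> \<in> carrier ?H"
    by (auto intro!: module_hom_restrict module_hom_const_zero V W)
  have add: "f \<oplus>\<^bsub>?H\<^esub> g \<in> carrier ?H" if "f \<in> carrier ?H" "g \<in> carrier ?H" for f g
    using that by (auto intro!: module_hom_restrict module_hom_plus V W)
  have smult: "a \<odot>\<^bsub>?H\<^esub> f \<in> carrier ?H" if "a \<in> carrier K" "f \<in> carrier ?H" for a f
    using that by (auto intro!: module_hom_restrict module_hom_smult_left V W)
  have neg: "\<exists>g\<in>carrier ?H. f \<oplus>\<^bsub>?H\<^esub> g = \<zero>\<^bsub>?H\<^esub>" if f: "f \<in> carrier ?H" for f
  proof (rule bexI)
    let ?g = "\<ominus>\<^bsub>K\<^esub> \<one>\<^bsub>K\<^esub> \<odot>\<^bsub>?H\<^esub> f"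
    show g: "?g \<in> carrier ?H" using f by (intro smult) auto
    show "f \<oplus>\<^bsub>?H\<^esub> ?g = \<zero>\<^bsub>?H\<^esub>"
      using mem[OF f] by (intro eqI add f g zero) (auto simp: W.smult_minus_1 W.r_neg)
  qed
  show ?thesis
  proof (rule vs_criteria, goal_cases)
    case 1 show ?case by (rule V.field_axioms)
  next
    case 2 show ?case by (rule zero)
  next
    case 3 then show ?case using add by blast
  next
    case 4 then show ?case using neg by blast
  next
    case 5 then show ?case using smult by blast
  next
    case 6 then show ?case using mem by (auto simp: W.a_comm restrict_def)
  next
    case 7 then show ?case
      using mem by (auto simp: W.a_assoc restrict_def fun_eq_iff)
  next
    case 8 show ?case
    proof
      fix f assume f: "f \<in> carrier ?H"
      show "f \<oplus>\<^bsub>?H\<^esub> \<zero>\<^bsub>?H\<^esub> = f"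
        by (rule eqI[OF add[OF f zero] f]) (use mem[OF f] in auto)
    qed
  next
    case 9 then show ?case using mem by (auto simp: W.smult_assoc1 restrict_def fun_eq_iff)
  next
    case 10 show ?case
    proof
      fix f assume f: "f \<in> carrier ?H"
      show "\<one>\<^bsub>K\<^esub> \<odot>\<^bsub>?H\<^esub> f = f"
        by (rule eqI[OF smult[OF _ f] f]) (use mem[OF f] in auto)
    qed
  next
    case 11 then show ?case using mem by (auto simp: W.smult_l_distr restrict_def fun_eq_iff)
  next
    case 12 then show ?case using mem by (auto simp: W.smult_r_distr restrict_def fun_eq_iff)
  qed
qed

lemma eval_linear:
  "v \<in> carrier V \<Longrightarrow> (\<lambda>f. f v) \<in> module_hom K (hom_space K V W) W"
  by (auto simp: module_hom_def)

text \<open>Linearity in each argument separately suffices because the operations of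
  \<open>hom_space\<close> are pointwise; \<open>restrict\<close> supplies the extensionality
  demanded of elements of the carrier.\<close>

lemma curry_linear:
  assumes "vectorspace K V" "vectorspace K W"
    and "\<And>v. v \<in> carrier V \<Longrightarrow> (\<lambda>x. f x v) \<in> module_hom K X W"
    and "\<And>x. x \<in> carrier X \<Longrightarrow> f x \<in> module_hom K V W"
  shows "(\<lambda>x. restrict (f x) (carrier V)) \<in> module_hom K X (hom_space K V W)"
proof (rule module_homI)
  fix x y assume xy: "x \<in> carrier X" "y \<in> carrier X"
  then show "restrict (f (x \<oplus>\<^bsub>X\<^esub> y)) (carrier V) =
      restrict (f x) (carrier V) \<oplus>\<^bsub>hom_space K V W\<^esub> restrict (f y) (carrier V)"
    using module_hom_add[OF assms(3)] by (auto simp: restrict_def fun_eq_iff)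
next
  fix a x assume ax: "a \<in> carrier K" "x \<in> carrier X"
  then show "restrict (f (a \<odot>\<^bsub>X\<^esub> x)) (carrier V) =
      a \<odot>\<^bsub>hom_space K V W\<^esub> restrict (f x) (carrier V)"
    using module_hom_smult[OF assms(3)] by (auto simp: restrict_def fun_eq_iff)
qed (use assms in \<open>auto intro: module_hom_restrict\<close>)

section \<open>Quotients\<close>

lemma submoduleI':
  assumes V: "vectorspace K V" and "N \<subseteq> carrier V" "\<zero>\<^bsub>V\<^esub> \<in> N"
    and "\<And>x y. \<lbrakk>x \<in> N; y \<in> N\<rbrakk> \<Longrightarrow> x \<oplus>\<^bsub>V\<^esub> y \<in> N"
    and "\<And>a x. \<lbrakk>a \<in> carrier K; x \<in> N\<rbrakk> \<Longrightarrow> a \<odot>\<^bsub>V\<^esub> x \<in> N"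
  shows "submodule K N V"
  using assms by (auto simp: submodule_def vectorspace_def)

lemma submodule_abelian_subgroup:
  assumes V: "vectorspace K V" and N: "submodule K N V"
  shows "abelian_subgroup N V"
proof -
  interpret V: vectorspace K V by fact
  interpret N: submodule K N V by fact
  have "subgroup N (add_monoid V)"
  proof (rule V.add.subgroupI)
    fix a assume a: "a \<in> N"
    with N.subset have "a \<in> carrier V" by auto
    then have "\<ominus>\<^bsub>V\<^esub> a = (\<ominus>\<^bsub>K\<^esub> \<one>\<^bsub>K\<^esub>) \<odot>\<^bsub>V\<^esub> a"
      by (simp add: V.smult_minus_1)
    then show "\<ominus>\<^bsub>V\<^esub> a \<in> N" using a N.smult_closed by simp
  next
    show "N \<noteq> {}" using N.zero_closed by blast
  qed (use N.subset in auto)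
  then show ?thesis
    by (intro abelian_subgroupI3 additive_subgroupI V.M.abelian_group_axioms)
qed

context
  fixes K :: "('k, 'm) ring_scheme" and V :: "('k, 'v, 'mv) module_scheme" and N :: "'v set"
  assumes V: "vectorspace K V" and N: "submodule K N V"
begin

interpretation V: vectorspace K V by (rule V)
interpretation N: abelian_subgroup N V by (rule submodule_abelian_subgroup[OF V N])

lemma carrier_quotient_module: "carrier (quotient_module V N) = (\<lambda>x. N +>\<^bsub>V\<^esub> x) ` carrier V"
  by (auto simp: quotient_module_def FactRing_simps)

lemma quotient_module_mem: "x \<in> carrier V \<Longrightarrow> N +>\<^bsub>V\<^esub> x \<in> carrier (quotient_module V N)"
  by (simp add: carrier_quotient_module)

lemma quotient_module_eq_iff:
  assumes "x \<in> carrier V" "y \<in> carrier V"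
  shows "N +>\<^bsub>V\<^esub> x = N +>\<^bsub>V\<^esub> y \<longleftrightarrow> x \<ominus>\<^bsub>V\<^esub> y \<in> N"
  using N.a_rcos_module[of y x] N.a_repr_independence'[of x y] N.a_rcos_self[of x] assms
  by (auto simp: a_minus_def)

lemma quotient_module_eq_iff':
  assumes "x \<in> carrier V" "y \<in> carrier V"
  shows "y \<in> N +>\<^bsub>V\<^esub> x \<longleftrightarrow> N +>\<^bsub>V\<^esub> y = N +>\<^bsub>V\<^esub> x"
  using N.a_repr_independence'[of y x] N.a_rcos_self[of y] assms by auto

lemma quotient_module_add:
  "\<lbrakk>x \<in> carrier V; y \<in> carrier V\<rbrakk>
    \<Longrightarrow> (N +>\<^bsub>V\<^esub> x) \<oplus>\<^bsub>quotient_module V N\<^esub> (N +>\<^bsub>V\<^esub> y) = N +>\<^bsub>V\<^esub> (x \<oplus>\<^bsub>V\<^esub> y)"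
  by (simp add: quotient_module_def FactRing_def N.a_rcos_sum)

lemma quotient_module_zero: "\<zero>\<^bsub>quotient_module V N\<^esub> = N +>\<^bsub>V\<^esub> \<zero>\<^bsub>V\<^esub>"
  by (simp add: quotient_module_def FactRing_def N.a_subset)

lemma quotient_module_smult:
  assumes "a \<in> carrier K" "x \<in> carrier V"
  shows "a \<odot>\<^bsub>quotient_module V N\<^esub> (N +>\<^bsub>V\<^esub> x) = N +>\<^bsub>V\<^esub> (a \<odot>\<^bsub>V\<^esub> x)"
proof -
  have "N +>\<^bsub>V\<^esub> (a \<odot>\<^bsub>V\<^esub> y) = N +>\<^bsub>V\<^esub> (a \<odot>\<^bsub>V\<^esub> x)" if "y \<in> N +>\<^bsub>V\<^esub> x" for y
  proof -
    have y: "y \<in> carrier V" using that assms N.a_elemrcos_carrier by blast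
    with that assms have "y \<ominus>\<^bsub>V\<^esub> x \<in> N"
      by (simp add: quotient_module_eq_iff' quotient_module_eq_iff)
    then have "a \<odot>\<^bsub>V\<^esub> (y \<ominus>\<^bsub>V\<^esub> x) \<in> N"
      using N assms(1) by (simp add: submodule_def)
    moreover have "a \<odot>\<^bsub>V\<^esub> (y \<ominus>\<^bsub>V\<^esub> x) = a \<odot>\<^bsub>V\<^esub> y \<ominus>\<^bsub>V\<^esub> a \<odot>\<^bsub>V\<^esub> x"
      using assms y by (simp add: a_minus_def V.smult_r_distr V.smult_r_minus)
    ultimately show ?thesis
      using assms y by (simp add: quotient_module_eq_iff)
  qed
  moreover have "x \<in> N +>\<^bsub>V\<^esub> x" using assms by (simp add: N.a_rcos_self)
  ultimately have "(\<Union>y\<in>N +>\<^bsub>V\<^esub> x. N +>\<^bsub>V\<^esub> (a \<odot>\<^bsub>V\<^esub> y)) = N +>\<^bsub>V\<^esub> (a \<odot>\<^bsub>V\<^esub> x)"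
    by (intro UN_constant_eq) blast+
  then show ?thesis by (simp add: quotient_module_def)
qed

lemma vectorspace_quotient_module: "vectorspace K (quotient_module V N)"
proof (rule vs_criteria, goal_cases)
  case 4
  show ?case
  proof
    fix v assume "v \<in> carrier (quotient_module V N)"
    then obtain x where x: "x \<in> carrier V" "v = N +>\<^bsub>V\<^esub> x" by (auto simp: carrier_quotient_module)
    then show "\<exists>w\<in>carrier (quotient_module V N). v \<oplus>\<^bsub>quotient_module V N\<^esub> w = \<zero>\<^bsub>quotient_module V N\<^esub>"
      by (intro bexI[of _ "N +>\<^bsub>V\<^esub> (\<ominus>\<^bsub>V\<^esub> x)"])
        (auto simp: quotient_module_add quotient_module_zero V.r_neg quotient_module_mem)
  qed
qed (auto simp: carrier_quotient_module quotient_module_add quotient_module_zero quotient_module_smult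
    V.a_ac V.smult_assoc1 V.smult_l_distr V.smult_r_distr V.field_axioms)

lemma quotient_module_proj: "(\<lambda>x. N +>\<^bsub>V\<^esub> x) \<in> module_hom K V (quotient_module V N)"
  by (rule module_homI) (simp_all add: quotient_module_mem quotient_module_add quotient_module_smult)

text \<open>Since \<open>tensor_lift\<close> evaluates at a representative picked by
  \<open>SOME\<close>, the pick has to be tied back to its class; cosets are nonempty, so it lies in
  the coset and generates it.\<close>

lemma quotient_module_some:
  assumes "T \<in> carrier (quotient_module V N)"
  shows "(SOME f. f \<in> T) \<in> carrier V" "N +>\<^bsub>V\<^esub> (SOME f. f \<in> T) = T"
proof -
  from assms obtain x where x: "x \<in> carrier V" "T = N +>\<^bsub>V\<^esub> x"
    by (auto simp: carrier_quotient_module)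
  then have *: "(SOME f. f \<in> T) \<in> T" by (metis N.a_rcos_self someI)
  then show 1: "(SOME f. f \<in> T) \<in> carrier V" using x N.a_elemrcos_carrier by blast
  show "N +>\<^bsub>V\<^esub> (SOME f. f \<in> T) = T" using * 1 x by (simp add: quotient_module_eq_iff')
qed

text \<open>Two representatives of a coset differ by an element of \<open>N\<close>, which
  \<open>f\<close> kills, so the chosen one may be replaced by any other. The induced map is written
  with \<open>SOME\<close> to match the shape of \<open>tensor_lift\<close>.\<close>

lemma quotient_module_lift:
  assumes W: "vectorspace K W" and f: "f \<in> module_hom K V W"
    and null: "\<And>x. x \<in> N \<Longrightarrow> f x = \<zero>\<^bsub>W\<^esub>"
  shows quotient_module_lift_eq:
      "x \<in> carrier V \<Longrightarrow> f (SOME y. y \<in> N +>\<^bsub>V\<^esub> x) = f x" (is "_ \<Longrightarrow> ?eq x")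
    and quotient_module_lift_linear:
      "(\<lambda>T. f (SOME y. y \<in> T)) \<in> module_hom K (quotient_module V N) W"
proof -
  interpret W: vectorspace K W by fact
  show *: "?eq x" if x: "x \<in> carrier V" for x
  proof -
    let ?y = "SOME y. y \<in> N +>\<^bsub>V\<^esub> x"
    note y = quotient_module_some[OF quotient_module_mem[OF x]]
    then have "?y \<ominus>\<^bsub>V\<^esub> x \<in> N" using x by (simp flip: quotient_module_eq_iff)
    from null[OF this] have "f ?y \<ominus>\<^bsub>W\<^esub> f x = \<zero>\<^bsub>W\<^esub>"
      using x y by (simp add: module_hom_minus[OF V W f])
    then show ?thesis using x y module_hom_mem[OF f] by simp
  qed
  show "(\<lambda>T. f (SOME y. y \<in> T)) \<in> module_hom K (quotient_module V N) W"
  proof (rule module_homI)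
    fix T U assume "T \<in> carrier (quotient_module V N)" "U \<in> carrier (quotient_module V N)"
    then obtain x y where "x \<in> carrier V" "T = N +>\<^bsub>V\<^esub> x" "y \<in> carrier V" "U = N +>\<^bsub>V\<^esub> y"
      by (auto simp: carrier_quotient_module)
    then show "f (SOME y. y \<in> T \<oplus>\<^bsub>quotient_module V N\<^esub> U) =
        f (SOME y. y \<in> T) \<oplus>\<^bsub>W\<^esub> f (SOME y. y \<in> U)"
      by (simp add: quotient_module_add * module_hom_add[OF f])
  next
    fix a T assume "a \<in> carrier K" "T \<in> carrier (quotient_module V N)"
    moreover from this obtain x where "x \<in> carrier V" "T = N +>\<^bsub>V\<^esub> x"
      by (auto simp: carrier_quotient_module)
    ultimately show "f (SOME y. y \<in> a \<odot>\<^bsub>quotient_module V N\<^esub> T) = a \<odot>\<^bsub>W\<^esub> f (SOME y. y \<in> T)"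
      by (simp add: quotient_module_smult * module_hom_smult[OF f])
  qed (rule module_hom_mem[OF f quotient_module_some(1)])
qed

end

lemma submodule_kernel:
  assumes V: "vectorspace K V" and W: "vectorspace K W" and f: "f \<in> module_hom K V W"
  shows "submodule K {x \<in> carrier V. f x = \<zero>\<^bsub>W\<^esub>} V"
proof -
  interpret mod_hom K V W f by (rule mod_hom_intro[OF assms])
  show ?thesis using ker_is_submodule by (simp add: ker_def)
qed

lemma submodule_vimage:
  assumes V: "vectorspace K V" and W: "vectorspace K W" and f: "f \<in> module_hom K V W"
    and N: "submodule K N W"
  shows "submodule K {x \<in> carrier V. f x \<in> N} V"
proof -
  interpret V: vectorspace K V by fact
  show ?thesis
    using N by (intro submoduleI' V)
      (auto simp: module_hom_zero[OF V W f] module_hom_add[OF f] module_hom_smult[OF f] submodule_def)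
qed

lemma span_minimal:
  "\<lbrakk>vectorspace K V; S \<subseteq> N; submodule K N V\<rbrakk> \<Longrightarrow> module.span K V S \<subseteq> N"
  by (auto simp: vectorspace_def dest: module.span_is_subset)

section \<open>Free modules\<close>

lemma free_module_simps [simp]:
  "f \<in> carrier (free_module K X) \<longleftrightarrow>
    (\<forall>x. f x \<in> carrier K) \<and> (\<forall>x. x \<notin> X \<longrightarrow> f x = \<zero>\<^bsub>K\<^esub>) \<and> finite {x. f x \<noteq> \<zero>\<^bsub>K\<^esub>}"
  "\<zero>\<^bsub>free_module K X\<^esub> = (\<lambda>x. \<zero>\<^bsub>K\<^esub>)"
  "f \<oplus>\<^bsub>free_module K X\<^esub> g = (\<lambda>x. f x \<oplus>\<^bsub>K\<^esub> g x)"
  "a \<odot>\<^bsub>free_module K X\<^esub> f = (\<lambda>x. a \<otimes>\<^bsub>K\<^esub> f x)"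
  by (auto simp: free_module_def)

lemma vectorspace_free_module:
  assumes "field K" shows "vectorspace K (free_module K X)"
proof -
  interpret field K by fact
  have add: "finite {x. f x \<oplus>\<^bsub>K\<^esub> g x \<noteq> \<zero>\<^bsub>K\<^esub>}"
    if "finite {x. f x \<noteq> \<zero>\<^bsub>K\<^esub>}" "finite {x. g x \<noteq> \<zero>\<^bsub>K\<^esub>}" for f g :: "_ \<Rightarrow> 'a"
    by (rule finite_subset[OF _ finite_UnI[OF that]]) auto
  have smult: "finite {x. a \<otimes>\<^bsub>K\<^esub> f x \<noteq> \<zero>\<^bsub>K\<^esub>}"
    if "a \<in> carrier K" "finite {x. f x \<noteq> \<zero>\<^bsub>K\<^esub>}" for a and f :: "_ \<Rightarrow> 'a"
    using that by (auto elim!: rev_finite_subset)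
  have neg: "\<exists>g\<in>carrier (free_module K X). f \<oplus>\<^bsub>free_module K X\<^esub> g = \<zero>\<^bsub>free_module K X\<^esub>"
    if "f \<in> carrier (free_module K X)" for f :: "_ \<Rightarrow> 'a"
    using that by (intro bexI[of _ "\<lambda>x. \<ominus>\<^bsub>K\<^esub> f x"]) (auto simp: r_neg elim!: rev_finite_subset)
  show ?thesis
    by (rule vs_criteria, insert neg)
      (auto simp: a_ac m_assoc l_distr r_distr add smult assms)
qed

lemma free_gen_mem:
  assumes "field K" "x \<in> X" shows "free_gen K x \<in> carrier (free_module K X)"
proof -
  interpret field K by fact
  have "finite {y. free_gen K x y \<noteq> \<zero>\<^bsub>K\<^esub>}"
    by (rule finite_subset[of _ "{x}"]) (auto simp: free_gen_def)
  then show ?thesis using assms(2) by (auto simp: free_gen_def)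
qed

text \<open>The induction runs over a finite set containing the support rather than over the support
  itself: setting one value to zero then always leads to the smaller set, and a point where the
  function already vanishes costs nothing.\<close>

lemma free_module_induct [consumes 2, case_names zero add]:
  assumes "field K" and f: "f \<in> carrier (free_module K X)"
    and zero: "P \<zero>\<^bsub>free_module K X\<^esub>"
    and add: "\<And>f a x. \<lbrakk>f \<in> carrier (free_module K X); a \<in> carrier K; x \<in> X; P f\<rbrakk> \<Longrightarrow>
      P (f \<oplus>\<^bsub>free_module K X\<^esub> a \<odot>\<^bsub>free_module K X\<^esub> free_gen K x)"
  shows "P f"
proof -
  interpret field K by fact
  have "P f" if "finite S" "f \<in> carrier (free_module K X)" "{x. f x \<noteq> \<zero>\<^bsub>K\<^esub>} \<subseteq> S" for S f
    using that
  proof (induction S arbitrary: f)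
    case empty
    then have "f = \<zero>\<^bsub>free_module K X\<^esub>" by auto
    with zero show ?case by simp
  next
    case (insert x S)
    show ?case
    proof (cases "f x = \<zero>\<^bsub>K\<^esub>")
      case True
      with insert show ?thesis by auto
    next
      case False
      define g where "g = f(x := \<zero>\<^bsub>K\<^esub>)"
      have x: "x \<in> X" using False insert.prems by auto
      have "finite {y. g y \<noteq> \<zero>\<^bsub>K\<^esub>}"
        by (rule finite_subset[of _ "{y. f y \<noteq> \<zero>\<^bsub>K\<^esub>}"]) (use insert.prems in \<open>auto simp: g_def\<close>)
      then have g: "g \<in> carrier (free_module K X)"
        using insert.prems by (auto simp: g_def)
      moreover have "P g"
        by (rule insert.IH[OF g]) (use insert.prems in \<open>auto simp: g_def\<close>)
      moreover have "f = g \<oplus>\<^bsub>free_module K X\<^esub> f x \<odot>\<^bsub>free_module K X\<^esub> free_gen K x"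
        using insert.prems by (auto simp: g_def free_gen_def fun_eq_iff)
      ultimately show ?thesis using add[of g "f x" x] x insert.prems by simp
    qed
  qed
  from this[OF _ f order_refl] f show ?thesis by simp
qed

text \<open>The linear extension of \<open>g\<close> from the generators; \<open>tensor_lift\<close>
  is this map at a chosen representative, see \<open>tensor_lift_free_lift\<close>.\<close>

definition free_lift ::
  "('k, 'm) ring_scheme \<Rightarrow> ('k, 'u, 'mu) module_scheme \<Rightarrow> ('x \<Rightarrow> 'u) \<Rightarrow> ('x \<Rightarrow> 'k) \<Rightarrow> 'u" where
  "free_lift K U g f = (\<Oplus>\<^bsub>U\<^esub>x\<in>{x. f x \<noteq> \<zero>\<^bsub>K\<^esub>}. f x \<odot>\<^bsub>U\<^esub> g x)"

context
  fixes K :: "('k, 'm) ring_scheme" and U :: "('k, 'u, 'mu) module_scheme"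
    and g :: "'x \<Rightarrow> 'u" and X :: "'x set"
  assumes U: "vectorspace K U" and g: "g \<in> X \<rightarrow> carrier U"
begin

interpretation U: vectorspace K U by (rule U)

text \<open>Cancellation makes the support of a sum hard to control. Allowing any finite index set
  that contains the support puts two functions and their sum over one common set.\<close>

lemma free_lift_superset:
  assumes f: "f \<in> carrier (free_module K X)" and S: "finite S" "{x. f x \<noteq> \<zero>\<^bsub>K\<^esub>} \<subseteq> S" "S \<subseteq> X"
  shows "free_lift K U g f = (\<Oplus>\<^bsub>U\<^esub>x\<in>S. f x \<odot>\<^bsub>U\<^esub> g x)"
  unfolding free_lift_def
proof (rule U.add.finprod_mono_neutral_cong_left[OF S(1,2)])
  show "f i \<odot>\<^bsub>U\<^esub> g i = \<zero>\<^bsub>U\<^esub>" if "i \<in> S - {x. f x \<noteq> \<zero>\<^bsub>K\<^esub>}" for i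
    using that S g by (auto simp: Pi_def)
  show "(\<lambda>x. f x \<odot>\<^bsub>U\<^esub> g x) \<in> S \<rightarrow> carrier U"
    using S f g by (auto simp: Pi_def)
qed auto

lemma free_lift_linear: "free_lift K U g \<in> module_hom K (free_module K X) U"
proof (rule module_homI)
  fix f h assume f: "f \<in> carrier (free_module K X)" and h: "h \<in> carrier (free_module K X)"
  let ?S = "{x. f x \<noteq> \<zero>\<^bsub>K\<^esub>} \<union> {x. h x \<noteq> \<zero>\<^bsub>K\<^esub>}"
  have fin: "finite ?S" and X: "?S \<subseteq> X" using f h by auto
  have fh: "f \<oplus>\<^bsub>free_module K X\<^esub> h \<in> carrier (free_module K X)"
  proof -
    interpret F: vectorspace K "free_module K X" by (rule vectorspace_free_module[OF U.field_axioms])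
    show ?thesis using f h by (rule F.a_closed)
  qed
  have "g x \<in> carrier U" if "x \<in> ?S" for x using g X that by auto
  then have "(\<Oplus>\<^bsub>U\<^esub>x\<in>?S. (f x \<oplus>\<^bsub>K\<^esub> h x) \<odot>\<^bsub>U\<^esub> g x) =
      (\<Oplus>\<^bsub>U\<^esub>x\<in>?S. f x \<odot>\<^bsub>U\<^esub> g x \<oplus>\<^bsub>U\<^esub> h x \<odot>\<^bsub>U\<^esub> g x)"
    using f h by (intro U.M.finsum_cong') (auto simp: U.smult_l_distr Pi_def)
  also have "\<dots> = (\<Oplus>\<^bsub>U\<^esub>x\<in>?S. f x \<odot>\<^bsub>U\<^esub> g x) \<oplus>\<^bsub>U\<^esub> (\<Oplus>\<^bsub>U\<^esub>x\<in>?S. h x \<odot>\<^bsub>U\<^esub> g x)"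
    using \<open>\<And>x. x \<in> ?S \<Longrightarrow> g x \<in> carrier U\<close> f h by (intro U.M.finsum_addf) (auto simp: Pi_def)
  finally show "free_lift K U g (f \<oplus>\<^bsub>free_module K X\<^esub> h) =
      free_lift K U g f \<oplus>\<^bsub>U\<^esub> free_lift K U g h"
    by (subst (1 2 3) free_lift_superset[OF _ fin _ X]) (use f h fh in auto)
next
  fix a f assume a: "a \<in> carrier K" and f: "f \<in> carrier (free_module K X)"
  let ?S = "{x. f x \<noteq> \<zero>\<^bsub>K\<^esub>}"
  have fin: "finite ?S" and X: "?S \<subseteq> X" using f by auto
  have af: "a \<odot>\<^bsub>free_module K X\<^esub> f \<in> carrier (free_module K X)"
  proof -
    interpret F: vectorspace K "free_module K X" by (rule vectorspace_free_module[OF U.field_axioms])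
    show ?thesis using a f by (rule F.smult_closed)
  qed
  have mem: "g x \<in> carrier U" if "x \<in> ?S" for x using g X that by auto
  then have "(\<Oplus>\<^bsub>U\<^esub>x\<in>?S. (a \<otimes>\<^bsub>K\<^esub> f x) \<odot>\<^bsub>U\<^esub> g x) = (\<Oplus>\<^bsub>U\<^esub>x\<in>?S. a \<odot>\<^bsub>U\<^esub> (f x \<odot>\<^bsub>U\<^esub> g x))"
    using f a by (intro U.M.finsum_cong') (auto simp: U.smult_assoc1 Pi_def)
  also have "\<dots> = a \<odot>\<^bsub>U\<^esub> (\<Oplus>\<^bsub>U\<^esub>x\<in>?S. f x \<odot>\<^bsub>U\<^esub> g x)"
    using f a mem by (intro U.finsum_smult_ldistr[symmetric] fin) (auto simp: Pi_def)
  finally show "free_lift K U g (a \<odot>\<^bsub>free_module K X\<^esub> f) = a \<odot>\<^bsub>U\<^esub> free_lift K U g f"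
    by (subst (1 2) free_lift_superset[OF _ fin _ X]) (use f a af in auto)
next
  fix f assume "f \<in> carrier (free_module K X)"
  then show "free_lift K U g f \<in> carrier U"
    unfolding free_lift_def using g by (intro U.M.finsum_closed) (auto simp: Pi_def)
qed

lemma free_lift_gen:
  assumes "x \<in> X" shows "free_lift K U g (free_gen K x) = g x"
proof -
  have "free_lift K U g (free_gen K x) = (\<Oplus>\<^bsub>U\<^esub>y\<in>{x}. free_gen K x y \<odot>\<^bsub>U\<^esub> g y)"
    using assms free_gen_mem[OF U.field_axioms assms]
    by (intro free_lift_superset) (auto simp: free_gen_def)
  also have "\<dots> = g x" using g assms by (auto simp: free_gen_def Pi_def)
  finally show ?thesis .
qed

end

section \<open>Tensor products\<close>

definition bilinear ::
  "('k, 'm) ring_scheme \<Rightarrow> ('k, 'v, 'mv) module_scheme \<Rightarrow> ('k, 'w, 'mw) module_scheme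
    \<Rightarrow> ('k, 'u, 'mu) module_scheme \<Rightarrow> ('v \<Rightarrow> 'w \<Rightarrow> 'u) \<Rightarrow> bool" where
  "bilinear K V W U \<beta> \<longleftrightarrow>
    (\<forall>w\<in>carrier W. (\<lambda>v. \<beta> v w) \<in> module_hom K V U) \<and>
    (\<forall>v\<in>carrier V. (\<lambda>w. \<beta> v w) \<in> module_hom K W U)"

lemma bilinearI [intro?]:
  assumes "\<And>w. w \<in> carrier W \<Longrightarrow> (\<lambda>v. \<beta> v w) \<in> module_hom K V U"
    and "\<And>v. v \<in> carrier V \<Longrightarrow> (\<lambda>w. \<beta> v w) \<in> module_hom K W U"
  shows "bilinear K V W U \<beta>"
  using assms by (simp add: bilinear_def)

lemma bilinear_left: "\<lbrakk>bilinear K V W U \<beta>; w \<in> carrier W\<rbrakk> \<Longrightarrow> (\<lambda>v. \<beta> v w) \<in> module_hom K V U"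
  and bilinear_right: "\<lbrakk>bilinear K V W U \<beta>; v \<in> carrier V\<rbrakk> \<Longrightarrow> (\<lambda>w. \<beta> v w) \<in> module_hom K W U"
  by (auto simp: bilinear_def)

lemma bilinear_mem:
  "\<lbrakk>bilinear K V W U \<beta>; v \<in> carrier V; w \<in> carrier W\<rbrakk> \<Longrightarrow> \<beta> v w \<in> carrier U"
  using module_hom_mem[OF bilinear_right] .

lemma bilinear_comp:
  "\<lbrakk>bilinear K V W U \<beta>; f \<in> module_hom K U U'\<rbrakk> \<Longrightarrow> bilinear K V W U' (\<lambda>v w. f (\<beta> v w))"
  by (auto simp: bilinear_def intro: module_hom_comp)

lemma bilinear_cong:
  assumes "bilinear K V W U \<beta>" "\<And>v w. \<lbrakk>v \<in> carrier V; w \<in> carrier W\<rbrakk> \<Longrightarrow> \<beta> v w = \<gamma> v w"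
    and "vectorspace K V" "vectorspace K W"
  shows "bilinear K V W U \<gamma>"
  by (rule bilinearI)
    (auto intro!: module_hom_cong[OF bilinear_left[OF assms(1)]]
      module_hom_cong[OF bilinear_right[OF assms(1)]] assms)

lemma bilinear_mult: "assoc_algebra K A \<Longrightarrow> bilinear K A A A (\<lambda>x y. x \<otimes>\<^bsub>A\<^esub> y)"
  by (auto intro!: bilinearI assoc_algebra_mult_left assoc_algebra_mult_right)

lemma bilinear_pair:
  assumes "bilinear K V W U \<beta>" "f \<in> module_hom K V' V" "g \<in> module_hom K W' W"
  shows "bilinear K V' W' U (\<lambda>v w. \<beta> (f v) (g w))"
  by (rule bilinearI)
    (auto intro: module_hom_comp[OF bilinear_left[OF assms(1)] assms(2)]
      module_hom_comp[OF bilinear_right[OF assms(1)] assms(3)]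
      module_hom_mem[OF assms(2)] module_hom_mem[OF assms(3)])

lemma bilinear_smult:
  assumes "vectorspace K V" shows "bilinear K (base_algebra K) V V (\<lambda>a v. a \<odot>\<^bsub>V\<^esub> v)"
proof -
  interpret vectorspace K V by fact
  show ?thesis
    by (rule bilinearI; rule module_homI)
      (auto simp: smult_l_distr smult_r_distr smult_assoc1, metis m_comm smult_assoc1)
qed

lemma tensor_lift_free_lift:
  "tensor_lift K U \<beta> t = free_lift K U (\<lambda>p. \<beta> (fst p) (snd p)) (SOME f. f \<in> t)"
  by (simp add: tensor_lift_def free_lift_def Let_def)

section \<open>Universal property of the tensor product\<close>

context
  fixes K :: "('k, 'm) ring_scheme" and V :: "('k, 'v, 'mv) module_scheme"
    and W :: "('k, 'w, 'mw) module_scheme"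
  assumes V: "vectorspace K V" and W: "vectorspace K W"
begin

interpretation V: vectorspace K V by (rule V)
interpretation W: vectorspace K W by (rule W)

private abbreviation (input) "F \<equiv> free_module K (carrier V \<times> carrier W)"

private lemma F: "vectorspace K F" by (rule vectorspace_free_module[OF V.field_axioms])

interpretation F: vectorspace K F by (rule F)

private lemma gen: "\<lbrakk>v \<in> carrier V; w \<in> carrier W\<rbrakk> \<Longrightarrow> free_gen K (v, w) \<in> carrier F"
  by (rule free_gen_mem[OF V.field_axioms]) simp

private lemma minus: "\<lbrakk>f \<in> carrier F; g \<in> carrier F\<rbrakk> \<Longrightarrow> f \<ominus>\<^bsub>F\<^esub> g \<in> carrier F"
  by (rule F.minus_closed)

private lemma smult: "\<lbrakk>a \<in> carrier K; g \<in> carrier F\<rbrakk> \<Longrightarrow> a \<odot>\<^bsub>F\<^esub> g \<in> carrier F"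
  by (rule F.smult_closed)

lemma tensor_relations_subset: "tensor_relations K V W \<subseteq> carrier F"
  unfolding tensor_relations_def Let_def
  by (auto simp del: free_module_simps intro!: minus smult gen)

private lemma null: "submodule K (tensor_null K V W) F"
  unfolding tensor_null_def by (rule F.span_is_submodule[OF tensor_relations_subset])

lemma vectorspace_tensor: "vectorspace K (tensor K V W)"
  unfolding tensor_def by (rule vectorspace_quotient_module[OF F null])

text \<open>The kernel of the linear extension is a submodule, so it contains the span as soon as it
  contains the four families of relations, and each family is one clause of bilinearity.\<close>

lemma tensor_null_kernel:
  assumes U: "vectorspace K U" and \<beta>: "bilinear K V W U \<beta>" and x: "x \<in> tensor_null K V W"
  shows "free_lift K U (\<lambda>p. \<beta> (fst p) (snd p)) x = \<zero>\<^bsub>U\<^esub>"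
proof -
  interpret U: vectorspace K U by fact
  let ?L = "free_lift K U (\<lambda>p. \<beta> (fst p) (snd p))"
  have g: "(\<lambda>p. \<beta> (fst p) (snd p)) \<in> carrier V \<times> carrier W \<rightarrow> carrier U"
    using bilinear_mem[OF \<beta>] by auto
  note L = free_lift_linear[OF U g]
  have L_gen: "?L (free_gen K (v, w)) = \<beta> v w" if "v \<in> carrier V" "w \<in> carrier W" for v w
    using free_lift_gen[OF U g, of "(v, w)"] that by simp
  note rules = module_hom_minus[OF F U L] module_hom_smult[OF L] L_gen minus smult gen
    module_hom_add[OF bilinear_left[OF \<beta>]] module_hom_add[OF bilinear_right[OF \<beta>]]
    module_hom_smult[OF bilinear_left[OF \<beta>]] module_hom_smult[OF bilinear_right[OF \<beta>]]
    bilinear_mem[OF \<beta>]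
  have *: "(x \<oplus>\<^bsub>U\<^esub> y) \<ominus>\<^bsub>U\<^esub> x \<ominus>\<^bsub>U\<^esub> y = \<zero>\<^bsub>U\<^esub>" if "x \<in> carrier U" "y \<in> carrier U" for x y
  proof -
    have "(x \<oplus>\<^bsub>U\<^esub> y) \<ominus>\<^bsub>U\<^esub> x \<ominus>\<^bsub>U\<^esub> y = (x \<oplus>\<^bsub>U\<^esub> y) \<oplus>\<^bsub>U\<^esub> \<ominus>\<^bsub>U\<^esub> (x \<oplus>\<^bsub>U\<^esub> y)"
      using that by (simp add: a_minus_def U.a_assoc U.minus_add)
    then show ?thesis using that by (simp add: U.r_neg)
  qed
  have "tensor_relations K V W \<subseteq> {x \<in> carrier F. ?L x = \<zero>\<^bsub>U\<^esub>}"
    unfolding tensor_relations_def Let_def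
    by (auto simp del: free_module_simps simp: rules *)
  from span_minimal[OF F this submodule_kernel[OF F U L]] x show ?thesis
    by (auto simp: tensor_null_def)
qed

lemma pure_tensor_mem:
  "\<lbrakk>v \<in> carrier V; w \<in> carrier W\<rbrakk> \<Longrightarrow> pure_tensor K V W v w \<in> carrier (tensor K V W)"
  unfolding pure_tensor_def tensor_def by (intro quotient_module_mem[OF F null] gen)

lemma tensor_lift_linear:
  assumes U: "vectorspace K U" and \<beta>: "bilinear K V W U \<beta>"
  shows "tensor_lift K U \<beta> \<in> module_hom K (tensor K V W) U"
proof -
  have g: "(\<lambda>p. \<beta> (fst p) (snd p)) \<in> carrier V \<times> carrier W \<rightarrow> carrier U"
    using bilinear_mem[OF \<beta>] by auto
  show ?thesis
    unfolding tensor_lift_free_lift[abs_def] tensor_def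
    by (rule quotient_module_lift_linear[OF F null U free_lift_linear[OF U g]])
      (rule tensor_null_kernel[OF U \<beta>])
qed

lemma tensor_lift_pure:
  assumes U: "vectorspace K U" and \<beta>: "bilinear K V W U \<beta>" and "v \<in> carrier V" "w \<in> carrier W"
  shows "tensor_lift K U \<beta> (pure_tensor K V W v w) = \<beta> v w"
proof -
  have g: "(\<lambda>p. \<beta> (fst p) (snd p)) \<in> carrier V \<times> carrier W \<rightarrow> carrier U"
    using bilinear_mem[OF \<beta>] by auto
  have "tensor_lift K U \<beta> (pure_tensor K V W v w) =
      free_lift K U (\<lambda>p. \<beta> (fst p) (snd p)) (free_gen K (v, w))"
    unfolding tensor_lift_free_lift pure_tensor_def
    by (rule quotient_module_lift_eq[OF F null U free_lift_linear[OF U g]])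
      (use tensor_null_kernel[OF U \<beta>] gen assms in auto)
  also have "\<dots> = \<beta> v w" using free_lift_gen[OF U g, of "(v, w)"] assms by simp
  finally show ?thesis .
qed

private lemma pure_eq:
  assumes "f \<in> carrier F" "g \<in> carrier F" "f \<ominus>\<^bsub>F\<^esub> g \<in> tensor_relations K V W"
  shows "tensor_null K V W +>\<^bsub>F\<^esub> f = tensor_null K V W +>\<^bsub>F\<^esub> g"
  using assms F.in_own_span[OF tensor_relations_subset]
  by (subst quotient_module_eq_iff[OF F null]) (auto simp: tensor_null_def simp del: free_module_simps)

lemma bilinear_pure_tensor: "bilinear K V W (tensor K V W) (pure_tensor K V W)"
proof -
  let ?N = "tensor_null K V W" and ?\<delta> = "free_gen K"
  have minus2: "f \<ominus>\<^bsub>F\<^esub> g \<ominus>\<^bsub>F\<^esub> h = f \<ominus>\<^bsub>F\<^esub> (g \<oplus>\<^bsub>F\<^esub> h)"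
    if "f \<in> carrier F" "g \<in> carrier F" "h \<in> carrier F" for f g h
    using that by (simp add: a_minus_def F.minus_add F.a_assoc del: free_module_simps)
  have add: "f \<oplus>\<^bsub>F\<^esub> g \<in> carrier F" if "f \<in> carrier F" "g \<in> carrier F" for f g
    using that by (rule F.a_closed)
  have 1: "?N +>\<^bsub>F\<^esub> ?\<delta> (v \<oplus>\<^bsub>V\<^esub> v', w) = ?N +>\<^bsub>F\<^esub> (?\<delta> (v, w) \<oplus>\<^bsub>F\<^esub> ?\<delta> (v', w))"
    if "v \<in> carrier V" "v' \<in> carrier V" "w \<in> carrier W" for v v' w
  proof -
    have "?\<delta> (v \<oplus>\<^bsub>V\<^esub> v', w) \<ominus>\<^bsub>F\<^esub> ?\<delta> (v, w) \<ominus>\<^bsub>F\<^esub> ?\<delta> (v', w) \<in> tensor_relations K V W"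
      unfolding tensor_relations_def Let_def using that by blast
    with that show ?thesis
      by (intro pure_eq) (simp_all del: free_module_simps add: minus2 gen add)
  qed
  have 2: "?N +>\<^bsub>F\<^esub> ?\<delta> (v, w \<oplus>\<^bsub>W\<^esub> w') = ?N +>\<^bsub>F\<^esub> (?\<delta> (v, w) \<oplus>\<^bsub>F\<^esub> ?\<delta> (v, w'))"
    if "v \<in> carrier V" "w' \<in> carrier W" "w \<in> carrier W" for v w w'
  proof -
    have "?\<delta> (v, w \<oplus>\<^bsub>W\<^esub> w') \<ominus>\<^bsub>F\<^esub> ?\<delta> (v, w) \<ominus>\<^bsub>F\<^esub> ?\<delta> (v, w') \<in> tensor_relations K V W"
      unfolding tensor_relations_def Let_def using that by blast
    with that show ?thesis
      by (intro pure_eq) (simp_all del: free_module_simps add: minus2 gen add)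
  qed
  have 3: "?N +>\<^bsub>F\<^esub> ?\<delta> (a \<odot>\<^bsub>V\<^esub> v, w) = ?N +>\<^bsub>F\<^esub> (a \<odot>\<^bsub>F\<^esub> ?\<delta> (v, w))"
    if "a \<in> carrier K" "v \<in> carrier V" "w \<in> carrier W" for a v w
    using that by (intro pure_eq)
      (auto simp del: free_module_simps simp: gen smult tensor_relations_def Let_def)
  have 4: "?N +>\<^bsub>F\<^esub> ?\<delta> (v, a \<odot>\<^bsub>W\<^esub> w) = ?N +>\<^bsub>F\<^esub> (a \<odot>\<^bsub>F\<^esub> ?\<delta> (v, w))"
    if "a \<in> carrier K" "v \<in> carrier V" "w \<in> carrier W" for a v w
    using that by (intro pure_eq)
      (auto simp del: free_module_simps simp: gen smult tensor_relations_def Let_def)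
  show ?thesis
    by (rule bilinearI; rule module_homI)
      (simp_all del: free_module_simps add: pure_tensor_mem,
       simp_all del: free_module_simps add: pure_tensor_def tensor_def 1 2 3 4
        quotient_module_add[OF F null] quotient_module_smult[OF F null] gen)
qed

text \<open>Zero and scalar multiples need no cases of their own: zero is the pure tensor of two
  zeros, and a scalar is absorbed into the left factor.\<close>

lemma tensor_induct [consumes 1, case_names pure add]:
  assumes t: "t \<in> carrier (tensor K V W)"
    and pure: "\<And>v w. \<lbrakk>v \<in> carrier V; w \<in> carrier W\<rbrakk> \<Longrightarrow> P (pure_tensor K V W v w)"
    and add: "\<And>s t. \<lbrakk>s \<in> carrier (tensor K V W); t \<in> carrier (tensor K V W); P s; P t\<rbrakk>
      \<Longrightarrow> P (s \<oplus>\<^bsub>tensor K V W\<^esub> t)"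
  shows "P t"
proof -
  let ?p = "\<lambda>f. tensor_null K V W +>\<^bsub>F\<^esub> f"
  have p: "?p \<in> module_hom K F (tensor K V W)"
    unfolding tensor_def by (rule quotient_module_proj[OF F null])
  obtain f where f: "f \<in> carrier F" "t = ?p f"
    using t unfolding tensor_def carrier_quotient_module[OF F null] by blast
  have "P (?p f)"
    using V.field_axioms f(1)
  proof (induction rule: free_module_induct)
    case zero
    have "?p \<zero>\<^bsub>F\<^esub> = pure_tensor K V W \<zero>\<^bsub>V\<^esub> \<zero>\<^bsub>W\<^esub>"
      using module_hom_zero[OF F vectorspace_tensor p]
        module_hom_zero[OF V vectorspace_tensor bilinear_left[OF bilinear_pure_tensor W.zero_closed]]
      by simp
    then show ?case by (simp add: pure del: free_module_simps)
  next
    case (add f a x)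
    obtain v w where x: "x = (v, w)" "v \<in> carrier V" "w \<in> carrier W" using add by auto
    have "?p (a \<odot>\<^bsub>F\<^esub> free_gen K x) = pure_tensor K V W (a \<odot>\<^bsub>V\<^esub> v) w"
      using x add.hyps gen
        module_hom_smult[OF bilinear_left[OF bilinear_pure_tensor, of w], of a v]
      by (simp add: module_hom_smult[OF p] pure_tensor_def del: free_module_simps)
    then show ?case
      using x add gen \<open>\<And>s t. _ \<Longrightarrow> _ \<Longrightarrow> P s \<Longrightarrow> P t \<Longrightarrow> P (s \<oplus>\<^bsub>tensor K V W\<^esub> t)\<close>
        module_hom_mem[OF p] smult pure
      by (simp add: module_hom_add[OF p] pure_tensor_mem del: free_module_simps)
  qed
  with f show ?thesis by simp
qed

lemma tensor_ext:
  assumes f: "f \<in> module_hom K (tensor K V W) U" and g: "g \<in> module_hom K (tensor K V W) U"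
    and t: "t \<in> carrier (tensor K V W)"
    and eq: "\<And>v w. \<lbrakk>v \<in> carrier V; w \<in> carrier W\<rbrakk>
      \<Longrightarrow> f (pure_tensor K V W v w) = g (pure_tensor K V W v w)"
  shows "f t = g t"
  using t by (induction rule: tensor_induct)
    (simp_all add: eq module_hom_add[OF f] module_hom_add[OF g])

lemma tensor_lift_mem:
  assumes U: "vectorspace K U" and "bilinear K V W U \<beta>" "t \<in> carrier (tensor K V W)"
  shows "tensor_lift K U \<beta> t \<in> carrier U"
  using module_hom_mem[OF tensor_lift_linear[OF assms(1,2)] assms(3)] .

lemma tensor_lift_comp:
  assumes "vectorspace K U" "vectorspace K U'" "bilinear K V W U \<beta>" "f \<in> module_hom K U U'"
    and t: "t \<in> carrier (tensor K V W)"
  shows "f (tensor_lift K U \<beta> t) = tensor_lift K U' (\<lambda>v w. f (\<beta> v w)) t"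
  by (rule tensor_ext[OF module_hom_comp[OF assms(4) tensor_lift_linear[OF assms(1,3)]]
        tensor_lift_linear[OF assms(2) bilinear_comp[OF assms(3,4)]] t])
    (simp add: tensor_lift_pure assms bilinear_comp[OF assms(3,4)])

lemma tensor_lift_cong:
  assumes U: "vectorspace K U" and \<beta>: "bilinear K V W U \<beta>" and t: "t \<in> carrier (tensor K V W)"
    and eq: "\<And>v w. \<lbrakk>v \<in> carrier V; w \<in> carrier W\<rbrakk> \<Longrightarrow> \<beta> v w = \<gamma> v w"
  shows "tensor_lift K U \<beta> t = tensor_lift K U \<gamma> t"
proof -
  have \<gamma>: "bilinear K V W U \<gamma>" by (rule bilinear_cong[OF \<beta> eq V W])
  show ?thesis
    by (rule tensor_ext[OF tensor_lift_linear[OF U \<beta>] tensor_lift_linear[OF U \<gamma>] t])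
      (simp add: tensor_lift_pure U \<beta> \<gamma> eq)
qed

text \<open>The standard move for Sweedler sums: a linear map goes under the sum and the summand is
  rewritten there. The rewriting may use that \<open>v\<close> and \<open>w\<close> lie in the
  carriers.\<close>

lemma tensor_lift_comp_cong:
  assumes U: "vectorspace K U" "vectorspace K U'" and \<beta>: "bilinear K V W U \<beta>"
    and f: "f \<in> module_hom K U U'" and t: "t \<in> carrier (tensor K V W)"
    and eq: "\<And>v w. \<lbrakk>v \<in> carrier V; w \<in> carrier W\<rbrakk> \<Longrightarrow> f (\<beta> v w) = \<gamma> v w"
  shows "f (tensor_lift K U \<beta> t) = tensor_lift K U' \<gamma> t"
  unfolding tensor_lift_comp[OF U \<beta> f t]
  by (rule tensor_lift_cong[OF U(2) bilinear_comp[OF \<beta> f] t eq])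

lemma tensor_lift_pure_tensor:
  "t \<in> carrier (tensor K V W) \<Longrightarrow> tensor_lift K (tensor K V W) (pure_tensor K V W) t = t"
  by (rule tensor_ext[OF tensor_lift_linear[OF vectorspace_tensor bilinear_pure_tensor] module_hom_id])
    (simp_all add: tensor_lift_pure[OF vectorspace_tensor bilinear_pure_tensor])

text \<open>Here the tensor is fixed and the form depends on \<open>y\<close>. Induction on the
  tensor reduces the claim to a pure tensor, where the value is just \<open>\<beta> y v w\<close>;
  sums of linear maps are linear.\<close>

lemma tensor_lift_linear_param:
  assumes Y: "vectorspace K Y" and U: "vectorspace K U" and t: "t \<in> carrier (tensor K V W)"
    and bil: "\<And>y. y \<in> carrier Y \<Longrightarrow> bilinear K V W U (\<beta> y)"
    and lin: "\<And>v w. \<lbrakk>v \<in> carrier V; w \<in> carrier W\<rbrakk> \<Longrightarrow> (\<lambda>y. \<beta> y v w) \<in> module_hom K Y U"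
  shows "(\<lambda>y. tensor_lift K U (\<beta> y) t) \<in> module_hom K Y U"
  using t
proof (induction rule: tensor_induct)
  case (pure v w)
  show ?case
    by (rule module_hom_cong[OF lin[OF pure] _ Y]) (simp add: tensor_lift_pure U bil pure)
next
  case (add s t)
  show ?case
    by (rule module_hom_cong[OF module_hom_plus[OF U add.IH] _ Y])
      (simp add: module_hom_add[OF tensor_lift_linear[OF U bil]] add.hyps)
qed

text \<open>Take for \<open>S\<close> the left factors in one expression of \<open>t\<close> by pure
  tensors. The set is fixed before \<open>\<beta>\<close> is given, so one finite set serves all the
  forms that occur in \<open>measuring_mem_dual\<close>.\<close>

lemma tensor_lift_finite_left:
  assumes t: "t \<in> carrier (tensor K V W)" and U: "vectorspace K U"
  shows "\<exists>S. finite S \<and> S \<subseteq> carrier V \<and> (\<forall>\<beta>. bilinear K V W U \<beta> \<longrightarrow>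
    (\<forall>v\<in>S. \<forall>w\<in>carrier W. \<beta> v w = \<zero>\<^bsub>U\<^esub>) \<longrightarrow> tensor_lift K U \<beta> t = \<zero>\<^bsub>U\<^esub>)"
  using t
proof (induction rule: tensor_induct)
  case (pure v w)
  then show ?case by (intro exI[of _ "{v}"]) (auto simp: tensor_lift_pure[OF U])
next
  case (add s t)
  interpret U: vectorspace K U by fact
  from add.IH obtain S T where "finite S \<and> S \<subseteq> carrier V \<and> (\<forall>\<beta>. bilinear K V W U \<beta> \<longrightarrow>
    (\<forall>v\<in>S. \<forall>w\<in>carrier W. \<beta> v w = \<zero>\<^bsub>U\<^esub>) \<longrightarrow> tensor_lift K U \<beta> s = \<zero>\<^bsub>U\<^esub>)"
    "finite T \<and> T \<subseteq> carrier V \<and> (\<forall>\<beta>. bilinear K V W U \<beta> \<longrightarrow>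
    (\<forall>v\<in>T. \<forall>w\<in>carrier W. \<beta> v w = \<zero>\<^bsub>U\<^esub>) \<longrightarrow> tensor_lift K U \<beta> t = \<zero>\<^bsub>U\<^esub>)"
    by blast
  then show ?case
    by (intro exI[of _ "S \<union> T"])
      (auto simp: module_hom_add[OF tensor_lift_linear[OF U]] add.hyps)
qed

lemma tensor_lift_finite_right:
  assumes t: "t \<in> carrier (tensor K V W)" and U: "vectorspace K U"
  shows "\<exists>S. finite S \<and> S \<subseteq> carrier W \<and> (\<forall>\<beta>. bilinear K V W U \<beta> \<longrightarrow>
    (\<forall>v\<in>carrier V. \<forall>w\<in>S. \<beta> v w = \<zero>\<^bsub>U\<^esub>) \<longrightarrow> tensor_lift K U \<beta> t = \<zero>\<^bsub>U\<^esub>)"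
  using t
proof (induction rule: tensor_induct)
  case (pure v w)
  then show ?case by (intro exI[of _ "{w}"]) (auto simp: tensor_lift_pure[OF U])
next
  case (add s t)
  interpret U: vectorspace K U by fact
  from add.IH obtain S T where "finite S \<and> S \<subseteq> carrier W \<and> (\<forall>\<beta>. bilinear K V W U \<beta> \<longrightarrow>
    (\<forall>v\<in>carrier V. \<forall>w\<in>S. \<beta> v w = \<zero>\<^bsub>U\<^esub>) \<longrightarrow> tensor_lift K U \<beta> s = \<zero>\<^bsub>U\<^esub>)"
    "finite T \<and> T \<subseteq> carrier W \<and> (\<forall>\<beta>. bilinear K V W U \<beta> \<longrightarrow>
    (\<forall>v\<in>carrier V. \<forall>w\<in>T. \<beta> v w = \<zero>\<^bsub>U\<^esub>) \<longrightarrow> tensor_lift K U \<beta> t = \<zero>\<^bsub>U\<^esub>)"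
    by blast
  then show ?case
    by (intro exI[of _ "S \<union> T"])
      (auto simp: module_hom_add[OF tensor_lift_linear[OF U]] add.hyps)
qed

end

lemma module_hom_tensor_lift:
  assumes "vectorspace K V" "vectorspace K W" "vectorspace K U" "bilinear K V W U \<beta>"
    and "f \<in> module_hom K Y (tensor K V W)"
  shows "(\<lambda>y. tensor_lift K U \<beta> (f y)) \<in> module_hom K Y U"
  by (rule module_hom_comp[OF tensor_lift_linear[OF assms(1-4)] assms(5)])

text \<open>Fubini for two independent Sweedler sums. Both sides are linear in \<open>t'\<close>,
  and for a pure \<open>t'\<close> both collapse to the same sum over \<open>t\<close>. It is
  applied with one comultiplication taken from \<open>H\<close> and the other from
  \<open>C\<close>.\<close>

lemma tensor_lift_swap:
  assumes vs: "vectorspace K V" "vectorspace K W" "vectorspace K V'" "vectorspace K W'" "vectorspace K U"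
    and t: "t \<in> carrier (tensor K V W)" and t': "t' \<in> carrier (tensor K V' W')"
    and 1: "\<And>v w. \<lbrakk>v \<in> carrier V; w \<in> carrier W\<rbrakk> \<Longrightarrow> bilinear K V' W' U (\<beta> v w)"
    and 2: "\<And>v' w'. \<lbrakk>v' \<in> carrier V'; w' \<in> carrier W'\<rbrakk> \<Longrightarrow> bilinear K V W U (\<lambda>v w. \<beta> v w v' w')"
  shows "tensor_lift K U (\<lambda>v w. tensor_lift K U (\<beta> v w) t') t =
    tensor_lift K U (\<lambda>v' w'. tensor_lift K U (\<lambda>v w. \<beta> v w v' w') t) t'"
proof -
  have b: "bilinear K V W U (\<lambda>v w. tensor_lift K U (\<beta> v w) t')"
    if t': "t' \<in> carrier (tensor K V' W')" for t'
    by (rule bilinearI; rule tensor_lift_linear_param)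
      (auto intro: vs t' 1 bilinear_left[OF 2] bilinear_right[OF 2])
  have b': "bilinear K V' W' U (\<lambda>v' w'. tensor_lift K U (\<lambda>v w. \<beta> v w v' w') t)"
    by (rule bilinearI; rule tensor_lift_linear_param)
      (auto intro: vs t 2 bilinear_left[OF 1] bilinear_right[OF 1])
  have lin: "(\<lambda>t'. tensor_lift K U (\<lambda>v w. tensor_lift K U (\<beta> v w) t') t)
      \<in> module_hom K (tensor K V' W') U"
    by (rule tensor_lift_linear_param)
      (auto intro: vs t b vectorspace_tensor module_hom_tensor_lift 1 module_hom_id)
  show ?thesis
  proof (rule tensor_ext[OF vs(3,4) lin tensor_lift_linear[OF vs(3,4,5) b'] t'])
    fix v' w' assume *: "v' \<in> carrier V'" "w' \<in> carrier W'"
    then have "tensor_lift K U (\<lambda>v w. \<beta> v w v' w') t =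
        tensor_lift K U (\<lambda>v w. tensor_lift K U (\<beta> v w) (pure_tensor K V' W' v' w')) t"
      by (intro tensor_lift_cong[OF vs(1,2,5) _ t] 2)
        (simp_all add: tensor_lift_pure[OF vs(3,4,5)] 1)
    then show "tensor_lift K U (\<lambda>v w. tensor_lift K U (\<beta> v w) (pure_tensor K V' W' v' w')) t =
        tensor_lift K U (\<lambda>v' w'. tensor_lift K U (\<lambda>v w. \<beta> v w v' w') t) (pure_tensor K V' W' v' w')"
      using * by (simp add: tensor_lift_pure[OF vs(3,4,5) b'])
  qed
qed

section \<open>Separation of tensors by functionals\<close>

text \<open>The index counts the summands of some expression and is only an upper bound for the
  rank, so the induction in \<open>tensor_separating\<close> need not know whether an expression is
  minimal. Index 0 is left to the zero tensor alone, which is the base case there.\<close>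

inductive tensor_rank_le ::
  "('k, 'm) ring_scheme \<Rightarrow> ('k, 'v, 'mv) module_scheme \<Rightarrow> ('k, 'w, 'mw) module_scheme
    \<Rightarrow> nat \<Rightarrow> ('k, 'v, 'w) tensor \<Rightarrow> bool"
  for K V W where
  zero: "tensor_rank_le K V W 0 \<zero>\<^bsub>tensor K V W\<^esub>"
| add_pure: "\<lbrakk>v \<in> carrier V; w \<in> carrier W; tensor_rank_le K V W n t\<rbrakk>
    \<Longrightarrow> tensor_rank_le K V W (Suc n) (pure_tensor K V W v w \<oplus>\<^bsub>tensor K V W\<^esub> t)"

context
  fixes K :: "('k, 'm) ring_scheme" and V :: "('k, 'v, 'mv) module_scheme"
    and W :: "('k, 'w, 'mw) module_scheme"
  assumes V: "vectorspace K V" and W: "vectorspace K W"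
begin

interpretation V: vectorspace K V by (rule V)
interpretation W: vectorspace K W by (rule W)
interpretation T: vectorspace K "tensor K V W" by (rule vectorspace_tensor[OF V W])

lemma tensor_rank_le_mem: "tensor_rank_le K V W n t \<Longrightarrow> t \<in> carrier (tensor K V W)"
  by (induction rule: tensor_rank_le.induct) (auto intro: pure_tensor_mem[OF V W])

lemma tensor_rank_le_add:
  "\<lbrakk>tensor_rank_le K V W m s; tensor_rank_le K V W n t\<rbrakk>
    \<Longrightarrow> tensor_rank_le K V W (m + n) (s \<oplus>\<^bsub>tensor K V W\<^esub> t)"
proof (induction rule: tensor_rank_le.induct)
  case zero
  then show ?case using tensor_rank_le_mem by simp
next
  case (add_pure v w n' s)
  then show ?case
    using tensor_rank_le.add_pure[OF add_pure.hyps(1,2) add_pure.IH]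
      tensor_rank_le_mem[OF add_pure.hyps(3)] tensor_rank_le_mem[OF add_pure.prems]
    by (simp add: T.a_assoc pure_tensor_mem[OF V W])
qed

lemma tensor_rank_le_exists:
  assumes "t \<in> carrier (tensor K V W)" shows "\<exists>n. tensor_rank_le K V W n t"
  using assms
proof (induction t rule: tensor_induct[OF V W, consumes 1, case_names pure add])
  case (pure v w)
  from tensor_rank_le.add_pure[OF this tensor_rank_le.zero[of K V W]] pure show ?case
    by (auto simp: pure_tensor_mem[OF V W] simp del: One_nat_def)
next
  case (add s t)
  then show ?case using tensor_rank_le_add by blast
qed

text \<open>
  Induction on the rank: if a functional \<open>\<phi>\<close> does not vanish on the first left factor of a sum of
  \<open>n + 1\<close> pure tensors that is killed by all \<open>\<phi> \<otimes> \<psi>\<close>, then the first right factor is a linear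
  combination of the other ones, so that \<open>n\<close> pure tensors suffice.
\<close>

lemma tensor_separating:
  assumes \<Phi>: "\<And>\<phi>. \<phi> \<in> \<Phi> \<Longrightarrow> \<phi> \<in> module_hom K V (base_algebra K)"
    and \<Psi>: "\<And>\<psi>. \<psi> \<in> \<Psi> \<Longrightarrow> \<psi> \<in> module_hom K W (base_algebra K)"
    and sepV: "\<And>v. \<lbrakk>v \<in> carrier V; \<And>\<phi>. \<phi> \<in> \<Phi> \<Longrightarrow> \<phi> v = \<zero>\<^bsub>K\<^esub>\<rbrakk> \<Longrightarrow> v = \<zero>\<^bsub>V\<^esub>"
    and sepW: "\<And>w. \<lbrakk>w \<in> carrier W; \<And>\<psi>. \<psi> \<in> \<Psi> \<Longrightarrow> \<psi> w = \<zero>\<^bsub>K\<^esub>\<rbrakk> \<Longrightarrow> w = \<zero>\<^bsub>W\<^esub>"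
    and t: "t \<in> carrier (tensor K V W)"
    and null: "\<And>\<phi> \<psi>. \<lbrakk>\<phi> \<in> \<Phi>; \<psi> \<in> \<Psi>\<rbrakk>
      \<Longrightarrow> tensor_lift K (base_algebra K) (\<lambda>v w. \<phi> v \<otimes>\<^bsub>K\<^esub> \<psi> w) t = \<zero>\<^bsub>K\<^esub>"
  shows "t = \<zero>\<^bsub>tensor K V W\<^esub>"
proof -
  note T = vectorspace_tensor[OF V W] and B = vectorspace_base_algebra[OF V.field_axioms]
  note pure = pure_tensor_mem[OF V W]
  have main: "t = \<zero>\<^bsub>tensor K V W\<^esub>"
    if "tensor_rank_le K V W n t" "\<And>\<phi> \<psi>. \<lbrakk>\<phi> \<in> \<Phi>; \<psi> \<in> \<Psi>\<rbrakk>
      \<Longrightarrow> tensor_lift K (base_algebra K) (\<lambda>v w. \<phi> v \<otimes>\<^bsub>K\<^esub> \<psi> w) t = \<zero>\<^bsub>K\<^esub>" for n t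
    using that
  proof (induction n arbitrary: t)
    case 0
    then show ?case by (auto elim: tensor_rank_le.cases)
  next
    case (Suc n)
    from Suc.prems(1) obtain v w s where v: "v \<in> carrier V" and w: "w \<in> carrier W"
      and s: "tensor_rank_le K V W n s" and t: "t = pure_tensor K V W v w \<oplus>\<^bsub>tensor K V W\<^esub> s"
      by (auto elim: tensor_rank_le.cases)
    note s' = tensor_rank_le_mem[OF s]
    show ?case
    proof (cases "\<forall>\<phi>\<in>\<Phi>. \<phi> v = \<zero>\<^bsub>K\<^esub>")
      case True
      then have "v = \<zero>\<^bsub>V\<^esub>" using sepV v by blast
      then have "t = s"
        using t s' w module_hom_zero[OF V T bilinear_left[OF bilinear_pure_tensor[OF V W] w]] by simp
      then show ?thesis using Suc s by blast
    next
      case False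
      then obtain \<phi> where \<phi>\<Phi>: "\<phi> \<in> \<Phi>" and ne: "\<phi> v \<noteq> \<zero>\<^bsub>K\<^esub>" by blast
      note \<phi> = \<Phi>[OF \<phi>\<Phi>]
      have c: "\<phi> v \<in> carrier K" using module_hom_mem[OF \<phi> v] by simp
      \<comment> \<open>The factor is -1 divided by \<open>\<phi> v\<close>, so that multiplying the
        relation between \<open>\<phi> v \<odot> w\<close> and \<open>F s\<close> by it solves for
        \<open>w\<close>.\<close>
      define d where "d = \<ominus>\<^bsub>K\<^esub> (inv\<^bsub>K\<^esub> (\<phi> v))"
      have d: "d \<in> carrier K" using c ne by (simp add: d_def)
      have dc: "d \<otimes>\<^bsub>K\<^esub> \<phi> v = \<ominus>\<^bsub>K\<^esub> \<one>\<^bsub>K\<^esub>"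
        using c ne by (simp add: d_def V.field_Units V.l_minus)
      define F where "F = tensor_lift K W (\<lambda>v w. \<phi> v \<odot>\<^bsub>W\<^esub> w)"
      have bF: "bilinear K V W W (\<lambda>v w. \<phi> v \<odot>\<^bsub>W\<^esub> w)"
        by (rule bilinear_pair[OF bilinear_smult[OF W] \<phi> module_hom_id])
      have F: "F \<in> module_hom K (tensor K V W) W"
        unfolding F_def by (rule tensor_lift_linear[OF V W W bF])
      \<comment> \<open>\<open>F\<close> is \<open>\<phi> \<otimes> id\<close> followed by scalar
        multiplication. Applying \<open>\<psi>\<close> to \<open>F t\<close> gives the value of
        \<open>\<phi> \<otimes> \<psi>\<close> at \<open>t\<close>, hence zero, and
        \<open>\<Psi>\<close> separates the elements of \<open>W\<close>.\<close>
      have "F t = \<zero>\<^bsub>W\<^esub>"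
      proof (rule sepW)
        show tc: "F t \<in> carrier W"
          using module_hom_mem[OF F] t s' pure[OF v w] by simp
        fix \<psi> assume \<psi>: "\<psi> \<in> \<Psi>"
        have "\<psi> (F t) = tensor_lift K (base_algebra K) (\<lambda>v w. \<psi> (\<phi> v \<odot>\<^bsub>W\<^esub> w)) t"
          unfolding F_def
          by (rule tensor_lift_comp[OF V W W B bF \<Psi>[OF \<psi>]]) (use t s' pure[OF v w] in simp)
        also have "\<dots> = tensor_lift K (base_algebra K) (\<lambda>v w. \<phi> v \<otimes>\<^bsub>K\<^esub> \<psi> w) t"
          by (rule tensor_lift_cong[OF V W B bilinear_comp[OF bF \<Psi>[OF \<psi>]]])
            (use t s' pure[OF v w] module_hom_smult[OF \<Psi>[OF \<psi>]] module_hom_mem[OF \<phi>] in auto)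
        finally show "\<psi> (F t) = \<zero>\<^bsub>K\<^esub>" using Suc.prems(2) \<phi>\<Phi> \<psi> by simp
      qed
      then have "\<phi> v \<odot>\<^bsub>W\<^esub> w \<oplus>\<^bsub>W\<^esub> F s = \<zero>\<^bsub>W\<^esub>"
        using tensor_lift_pure[OF V W W bF v w] pure[OF v w] s'
        by (simp add: t module_hom_add[OF F]) (simp add: F_def)
      then have "d \<odot>\<^bsub>W\<^esub> (\<phi> v \<odot>\<^bsub>W\<^esub> w) \<oplus>\<^bsub>W\<^esub> d \<odot>\<^bsub>W\<^esub> F s = \<zero>\<^bsub>W\<^esub>"
        using c d w module_hom_mem[OF F s'] by (simp flip: W.smult_r_distr)
      then have "\<ominus>\<^bsub>W\<^esub> w \<oplus>\<^bsub>W\<^esub> d \<odot>\<^bsub>W\<^esub> F s = \<zero>\<^bsub>W\<^esub>"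
        using c d w by (simp add: dc W.smult_minus_1 flip: W.smult_assoc1)
      then have w_eq: "w = d \<odot>\<^bsub>W\<^esub> F s"
        using d w module_hom_mem[OF F s'] by (metis W.M.minus_equality W.M.minus_minus W.M.a_inv_closed W.smult_closed W.M.a_comm)
      \<comment> \<open>Substituting \<open>w = d \<odot> F s\<close> into \<open>t\<close> gives
        \<open>G s\<close>. On a pure tensor \<open>G\<close> changes only the left factor, from
        \<open>x\<close> to \<open>x \<oplus> d \<phi>(x) v\<close>, so \<open>G s\<close> has no
        more summands than \<open>s\<close>.\<close>
      define G where "G s = s \<oplus>\<^bsub>tensor K V W\<^esub> pure_tensor K V W v (d \<odot>\<^bsub>W\<^esub> F s)" for s
      have G: "G \<in> module_hom K (tensor K V W) (tensor K V W)"
        unfolding G_def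
        by (intro module_hom_plus T module_hom_id module_hom_smult_left W d F
            module_hom_comp[OF bilinear_right[OF bilinear_pure_tensor[OF V W] v]])
      have G_pure: "G (pure_tensor K V W x y) =
          pure_tensor K V W (x \<oplus>\<^bsub>V\<^esub> (d \<otimes>\<^bsub>K\<^esub> \<phi> x) \<odot>\<^bsub>V\<^esub> v) y"
        if x: "x \<in> carrier V" and y: "y \<in> carrier W" for x y
      proof -
        have cx: "\<phi> x \<in> carrier K" using module_hom_mem[OF \<phi> x] by simp
        have "pure_tensor K V W v (d \<odot>\<^bsub>W\<^esub> F (pure_tensor K V W x y)) =
            pure_tensor K V W v ((d \<otimes>\<^bsub>K\<^esub> \<phi> x) \<odot>\<^bsub>W\<^esub> y)"
          using x y cx d by (simp add: F_def tensor_lift_pure[OF V W W bF] W.smult_assoc1)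
        also have "\<dots> = pure_tensor K V W ((d \<otimes>\<^bsub>K\<^esub> \<phi> x) \<odot>\<^bsub>V\<^esub> v) y"
          using x y cx d v
            module_hom_smult[OF bilinear_right[OF bilinear_pure_tensor[OF V W] v]]
            module_hom_smult[OF bilinear_left[OF bilinear_pure_tensor[OF V W] y]] by simp
        finally show ?thesis
          unfolding G_def using x y cx d v
            module_hom_add[OF bilinear_left[OF bilinear_pure_tensor[OF V W] y]] by simp
      qed
      have "tensor_rank_le K V W n (G s)"
        using s
      proof (induction rule: tensor_rank_le.induct)
        case zero
        then show ?case using module_hom_zero[OF T T G] by (auto intro: tensor_rank_le.zero)
      next
        case (add_pure x y n s)
        then show ?case
          using module_hom_mem[OF \<phi>] d v
          by (auto simp: module_hom_add[OF G] pure tensor_rank_le_mem G_pure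
              intro!: tensor_rank_le.add_pure)
      qed
      moreover have "t = G s"
        using t w_eq s' pure[OF v w] by (simp add: G_def T.a_comm)
      ultimately show ?thesis using Suc by blast
    qed
  qed
  from tensor_rank_le_exists[OF t] main null show ?thesis by blast
qed

end

section \<open>Coalgebras and convolution\<close>

lemma bilinear_tensor_lift_left:
  assumes V: "vectorspace K V" and W: "vectorspace K W" and U: "vectorspace K U"
    and Y: "vectorspace K Y" and f: "f \<in> module_hom K X (tensor K V W)"
    and 1: "\<And>y. y \<in> carrier Y \<Longrightarrow> bilinear K V W U (\<lambda>v w. \<gamma> v w y)"
    and 2: "\<And>v w. \<lbrakk>v \<in> carrier V; w \<in> carrier W\<rbrakk> \<Longrightarrow> (\<lambda>y. \<gamma> v w y) \<in> module_hom K Y U"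
  shows "bilinear K X Y U (\<lambda>x y. tensor_lift K U (\<lambda>v w. \<gamma> v w y) (f x))"
  by (rule bilinearI)
    (auto intro!: module_hom_tensor_lift[OF V W U] tensor_lift_linear_param[OF V W Y U]
      simp: 1 2 f module_hom_mem[OF f])

lemma bilinear_tensor_lift_right:
  assumes V: "vectorspace K V" and W: "vectorspace K W" and U: "vectorspace K U"
    and X: "vectorspace K X" and f: "f \<in> module_hom K Y (tensor K V W)"
    and 1: "\<And>x. x \<in> carrier X \<Longrightarrow> bilinear K V W U (\<gamma> x)"
    and 2: "\<And>v w. \<lbrakk>v \<in> carrier V; w \<in> carrier W\<rbrakk> \<Longrightarrow> (\<lambda>x. \<gamma> x v w) \<in> module_hom K X U"
  shows "bilinear K X Y U (\<lambda>x y. tensor_lift K U (\<gamma> x) (f y))"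
  by (rule bilinearI)
    (auto intro!: module_hom_tensor_lift[OF V W U] tensor_lift_linear_param[OF V W X U]
      simp: 1 2 f module_hom_mem[OF f])

lemma (in coalgebra) comult_mem: "c \<in> carrier C \<Longrightarrow> comult C c \<in> carrier (tensor K C C)"
  by (rule module_hom_mem[OF comult_linear])

text \<open>The coassociativity axiom is an equation in the triple tensor product. Applying the
  linear map \<open>F\<close> induced there by the trilinear \<open>\<gamma>\<close> yields the rule
  for iterated Sweedler sums with arbitrary summand. The two bilinearity hypotheses together express
  trilinearity.\<close>

lemma (in coalgebra) coassoc_lift:
  assumes U: "vectorspace K U" and c: "c \<in> carrier C"
    and 1: "\<And>x. x \<in> carrier C \<Longrightarrow> bilinear K C C U (\<gamma> x)"
    and 2: "\<And>y. y \<in> carrier C \<Longrightarrow> bilinear K C C U (\<lambda>u v. \<gamma> u v y)"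
  shows "tensor_lift K U (\<lambda>x y. tensor_lift K U (\<lambda>u v. \<gamma> u v y) (comult C x)) (comult C c) =
    tensor_lift K U (\<lambda>x y. tensor_lift K U (\<lambda>u v. \<gamma> x u v) (comult C y)) (comult C c)"
    (is "?l = ?r")
proof -
  note C = vectorspace_axioms
  let ?CC = "tensor K C C"
  let ?T = "tensor K C ?CC"
  note CC = vectorspace_tensor[OF C C]
  note T = vectorspace_tensor[OF C CC]
  define F where "F = tensor_lift K U (\<lambda>u s. tensor_lift K U (\<gamma> u) s)"
  have b: "bilinear K C ?CC U (\<lambda>u s. tensor_lift K U (\<gamma> u) s)"
    by (rule bilinear_tensor_lift_right[OF C C U C module_hom_id 1 bilinear_left[OF 2]])
  have F: "F \<in> module_hom K ?T U"
    unfolding F_def by (rule tensor_lift_linear[OF C CC U b])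
  have F_pure: "F (pure_tensor K C ?CC u (pure_tensor K C C v y)) = \<gamma> u v y"
    if "u \<in> carrier C" "v \<in> carrier C" "y \<in> carrier C" for u v y
    using that by (simp add: F_def tensor_lift_pure[OF C CC U b] pure_tensor_mem[OF C C]
        tensor_lift_pure[OF C C U 1])
  have F_pure': "F (pure_tensor K C ?CC u s) = tensor_lift K U (\<gamma> u) s"
    if "u \<in> carrier C" "s \<in> carrier ?CC" for u s
    using that by (simp add: F_def tensor_lift_pure[OF C CC U b])
  have p1: "bilinear K C C ?T (\<lambda>u v. pure_tensor K C ?CC u (pure_tensor K C C v y))"
    if "y \<in> carrier C" for y
    by (rule bilinear_pair[OF bilinear_pure_tensor[OF C CC] module_hom_id
          bilinear_left[OF bilinear_pure_tensor[OF C C] that]])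
  have p2: "(\<lambda>y. pure_tensor K C ?CC u (pure_tensor K C C v y)) \<in> module_hom K C ?T"
    if "u \<in> carrier C" "v \<in> carrier C" for u v
    by (rule module_hom_comp[OF bilinear_right[OF bilinear_pure_tensor[OF C CC] that(1)]
          bilinear_right[OF bilinear_pure_tensor[OF C C] that(2)]])
  have b1: "bilinear K C C ?T (\<lambda>x y. tensor_lift K ?T
      (\<lambda>u v. pure_tensor K C ?CC u (pure_tensor K C C v y)) (comult C x))"
    by (rule bilinear_tensor_lift_left[OF C C T C comult_linear p1 p2])
  have b2: "bilinear K C C ?T (\<lambda>x y. pure_tensor K C ?CC x (comult C y))"
    by (rule bilinear_pair[OF bilinear_pure_tensor[OF C CC] module_hom_id comult_linear])
  have "F (tensor_lift K ?T (\<lambda>x y. tensor_lift K ?T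
      (\<lambda>u v. pure_tensor K C ?CC u (pure_tensor K C C v y)) (comult C x)) (comult C c)) = ?l"
  proof (rule tensor_lift_comp_cong[OF C C T U b1 F comult_mem[OF c]])
    fix x y assume xy: "x \<in> carrier C" "y \<in> carrier C"
    have "F (tensor_lift K ?T (\<lambda>u v. pure_tensor K C ?CC u (pure_tensor K C C v y)) (comult C x)) =
      tensor_lift K U (\<lambda>u v. F (pure_tensor K C ?CC u (pure_tensor K C C v y))) (comult C x)"
      by (rule tensor_lift_comp[OF C C T U p1 F comult_mem]) (use xy in auto)
    also have "\<dots> = tensor_lift K U (\<lambda>u v. \<gamma> u v y) (comult C x)"
      by (rule tensor_lift_cong[OF C C U bilinear_comp[OF p1 F] comult_mem])
        (use xy F_pure in auto)
    finally show "F (tensor_lift K ?T (\<lambda>u v. pure_tensor K C ?CC u (pure_tensor K C C v y))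
        (comult C x)) = tensor_lift K U (\<lambda>u v. \<gamma> u v y) (comult C x)" .
  qed
  then have l: "?l = F (tensor_lift K ?T (\<lambda>x y. pure_tensor K C ?CC x (comult C y)) (comult C c))"
    by (simp add: coassoc[OF c])
  also have "\<dots> = ?r"
    by (rule tensor_lift_comp_cong[OF C C T U b2 F comult_mem[OF c]])
      (simp add: F_pure' comult_mem)
  finally show ?thesis .
qed

section \<open>The convolution algebra\<close>

lemma convolution_algebra_simps [simp]:
  "carrier (convolution_algebra K H B) = module_hom K H B \<inter> extensional (carrier H)"
  "\<zero>\<^bsub>convolution_algebra K H B\<^esub> = (\<lambda>h\<in>carrier H. \<zero>\<^bsub>B\<^esub>)"
  "\<alpha> \<oplus>\<^bsub>convolution_algebra K H B\<^esub> \<beta> = (\<lambda>h\<in>carrier H. \<alpha> h \<oplus>\<^bsub>B\<^esub> \<beta> h)"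
  "a \<odot>\<^bsub>convolution_algebra K H B\<^esub> \<alpha> = (\<lambda>h\<in>carrier H. a \<odot>\<^bsub>B\<^esub> \<alpha> h)"
  "\<alpha> \<otimes>\<^bsub>convolution_algebra K H B\<^esub> \<beta> =
    (\<lambda>h\<in>carrier H. tensor_lift K B (\<lambda>x y. \<alpha> x \<otimes>\<^bsub>B\<^esub> \<beta> y) (comult H h))"
  "\<one>\<^bsub>convolution_algebra K H B\<^esub> = (\<lambda>h\<in>carrier H. counit H h \<odot>\<^bsub>B\<^esub> \<one>\<^bsub>B\<^esub>)"
  by (simp_all add: convolution_algebra_def hom_space_def)

text \<open>Convolution algebras, dual coalgebras and word algebras arise from a vector space by
  changing record fields that do not belong to the linear structure; this carries the vector space
  axioms across.\<close>

lemma vectorspace_cong: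
  assumes "vectorspace K V" "carrier V' = carrier V" "\<zero>\<^bsub>V'\<^esub> = \<zero>\<^bsub>V\<^esub>"
    "ring.add V' = ring.add V" "module.smult V' = module.smult V"
  shows "vectorspace K V'"
proof -
  interpret V: vectorspace K V by fact
  show ?thesis
    by (rule vs_criteria)
      (auto simp: assms V.field_axioms V.a_ac V.smult_assoc1 V.smult_l_distr V.smult_r_distr
        intro: V.M.add.r_inv_ex[simplified])
qed

lemma module_hom_cong_codomain:
  assumes "carrier W' = carrier W" "ring.add W' = ring.add W" "module.smult W' = module.smult W"
  shows "module_hom K V W' = module_hom K V W"
  by (simp add: module_hom_def assms)

lemma module_hom_cong_domain:
  assumes "carrier V' = carrier V" "ring.add V' = ring.add V" "module.smult V' = module.smult V"
  shows "module_hom K V' W = module_hom K V W"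
  by (simp add: module_hom_def assms)

lemma module_hom_hom_space_convolution:
  "module_hom K X (convolution_algebra K H B) = module_hom K X (hom_space K H B)"
  by (rule module_hom_cong_codomain) (simp_all add: convolution_algebra_def)

lemma vectorspace_convolution_algebra:
  assumes "vectorspace K H" "vectorspace K B"
  shows "vectorspace K (convolution_algebra K H B)"
  by (rule vectorspace_cong[OF vectorspace_hom_space[OF assms]])
    (auto simp: convolution_algebra_def)

lemma bilinear_mult_pair:
  assumes "assoc_algebra K B" "f \<in> module_hom K V B" "g \<in> module_hom K W B"
  shows "bilinear K V W B (\<lambda>x y. f x \<otimes>\<^bsub>B\<^esub> g y)"
  by (rule bilinear_pair[OF bilinear_mult[OF assms(1)] assms(2,3)])

text \<open>Associativity is coassociativity of \<open>H\<close> combined with associativity of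
  \<open>B\<close>: both triple products become an iterated sum of
  \<open>(\<alpha> \<otimes> \<beta>) \<otimes> \<gamma>\<close>, differing only in which tensor
  factor is split. The unit laws are the counit laws, read after the scalar has been moved inside
  \<open>\<alpha>\<close>.\<close>

lemma assoc_algebra_convolution_algebra:
  assumes "coalgebra K H" and B: "assoc_algebra K B"
  shows "assoc_algebra K (convolution_algebra K H B)"
proof -
  interpret H: coalgebra K H by fact
  interpret B: assoc_algebra K B by fact
  note H = H.vectorspace_axioms and BV = assoc_algebra_vectorspace[OF B]
  let ?E = "convolution_algebra K H B"
  note bil = bilinear_mult_pair[OF B]
  have E: "vectorspace K ?E" by (rule vectorspace_convolution_algebra[OF H BV])
  have hom: "\<alpha> \<in> module_hom K H B" if "\<alpha> \<in> carrier ?E" for \<alpha> using that by simp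
  have mem: "\<alpha> h \<in> carrier B" if "\<alpha> \<in> carrier ?E" "h \<in> carrier H" for \<alpha> h
    using module_hom_mem[OF hom] that by blast
  have eqI: "\<alpha> = \<beta>" if "\<alpha> \<in> carrier ?E" "\<beta> \<in> carrier ?E" "\<And>h. h \<in> carrier H \<Longrightarrow> \<alpha> h = \<beta> h" for \<alpha> \<beta>
    using that by (auto intro: extensionalityI)
  have mult: "\<alpha> \<otimes>\<^bsub>?E\<^esub> \<beta> \<in> carrier ?E" if "\<alpha> \<in> carrier ?E" "\<beta> \<in> carrier ?E" for \<alpha> \<beta>
    using that
    by (auto intro!: module_hom_restrict module_hom_tensor_lift[OF H H BV] bil H.comult_linear H)
  have one: "\<one>\<^bsub>?E\<^esub> \<in> carrier ?E"
    using H.counit_linear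
      module_hom_comp[OF bilinear_left[OF bilinear_smult[OF BV] B.one_closed] H.counit_linear]
    by (auto intro!: module_hom_restrict H)
  have eval: "(\<lambda>\<alpha>. \<alpha> h) \<in> module_hom K ?E B" if "h \<in> carrier H" for h
    using mem[OF _ that] by (intro module_homI) (simp_all add: that)
  note cm = H.comult_mem
  show ?thesis
  proof (rule assoc_algebraI[OF E mult one])
    fix \<alpha> \<beta> \<gamma> assume a: "\<alpha> \<in> carrier ?E" and b: "\<beta> \<in> carrier ?E" and c: "\<gamma> \<in> carrier ?E"
    note h = hom[OF a] hom[OF b] hom[OF c]
    show "(\<alpha> \<otimes>\<^bsub>?E\<^esub> \<beta>) \<otimes>\<^bsub>?E\<^esub> \<gamma> = \<alpha> \<otimes>\<^bsub>?E\<^esub> (\<beta> \<otimes>\<^bsub>?E\<^esub> \<gamma>)"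
    proof (rule eqI)
      fix d assume d: "d \<in> carrier H"
      have "((\<alpha> \<otimes>\<^bsub>?E\<^esub> \<beta>) \<otimes>\<^bsub>?E\<^esub> \<gamma>) d = tensor_lift K B (\<lambda>x y. (\<alpha> \<otimes>\<^bsub>?E\<^esub> \<beta>) x \<otimes>\<^bsub>B\<^esub> \<gamma> y) (comult H d)"
        using d by simp
      also have "\<dots> = tensor_lift K B (\<lambda>x y. tensor_lift K B
          (\<lambda>u v. (\<alpha> u \<otimes>\<^bsub>B\<^esub> \<beta> v) \<otimes>\<^bsub>B\<^esub> \<gamma> y) (comult H x)) (comult H d)"
      proof (rule tensor_lift_cong[OF H H BV bil cm[OF d]])
        fix x y assume "x \<in> carrier H" "y \<in> carrier H"
        then show "(\<alpha> \<otimes>\<^bsub>?E\<^esub> \<beta>) x \<otimes>\<^bsub>B\<^esub> \<gamma> y =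
            tensor_lift K B (\<lambda>u v. (\<alpha> u \<otimes>\<^bsub>B\<^esub> \<beta> v) \<otimes>\<^bsub>B\<^esub> \<gamma> y) (comult H x)"
          using tensor_lift_comp[OF H H BV BV bil[OF h(1,2)]
              assoc_algebra_mult_left[OF B mem[OF c]] cm] by simp
      qed (intro hom mult a b c)+
      also have "\<dots> = tensor_lift K B (\<lambda>x y. tensor_lift K B
          (\<lambda>u v. (\<alpha> x \<otimes>\<^bsub>B\<^esub> \<beta> u) \<otimes>\<^bsub>B\<^esub> \<gamma> v) (comult H y)) (comult H d)"
      proof (rule H.coassoc_lift[OF BV d])
        fix x assume x: "x \<in> carrier H"
        show "bilinear K H H B (\<lambda>u v. (\<alpha> x \<otimes>\<^bsub>B\<^esub> \<beta> u) \<otimes>\<^bsub>B\<^esub> \<gamma> v)"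
          by (rule bil[OF module_hom_comp[OF assoc_algebra_mult_right[OF B mem[OF a x]] h(2)] h(3)])
        show "bilinear K H H B (\<lambda>u v. (\<alpha> u \<otimes>\<^bsub>B\<^esub> \<beta> v) \<otimes>\<^bsub>B\<^esub> \<gamma> x)"
          by (rule bilinear_comp[OF bil[OF h(1,2)] assoc_algebra_mult_left[OF B mem[OF c x]]])
      qed
      also have "\<dots> = tensor_lift K B (\<lambda>x y. \<alpha> x \<otimes>\<^bsub>B\<^esub> (\<beta> \<otimes>\<^bsub>?E\<^esub> \<gamma>) y) (comult H d)"
      proof (rule tensor_lift_cong[OF H H BV bil[OF h(1) hom[OF mult[OF b c]]] cm[OF d], symmetric])
        fix x y assume xy: "x \<in> carrier H" "y \<in> carrier H"
        then have "\<alpha> x \<otimes>\<^bsub>B\<^esub> (\<beta> \<otimes>\<^bsub>?E\<^esub> \<gamma>) y =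
            tensor_lift K B (\<lambda>u v. \<alpha> x \<otimes>\<^bsub>B\<^esub> (\<beta> u \<otimes>\<^bsub>B\<^esub> \<gamma> v)) (comult H y)"
          using tensor_lift_comp[OF H H BV BV bil[OF h(2,3)]
              assoc_algebra_mult_right[OF B mem[OF a]] cm] by simp
        also have "\<dots> = tensor_lift K B (\<lambda>u v. (\<alpha> x \<otimes>\<^bsub>B\<^esub> \<beta> u) \<otimes>\<^bsub>B\<^esub> \<gamma> v) (comult H y)"
          using xy by (intro tensor_lift_cong[OF H H BV bilinear_comp[OF bil[OF h(2,3)]
                assoc_algebra_mult_right[OF B mem[OF a]]] cm])
            (simp_all add: B.m_assoc mem a b c del: convolution_algebra_simps)
        finally show "\<alpha> x \<otimes>\<^bsub>B\<^esub> (\<beta> \<otimes>\<^bsub>?E\<^esub> \<gamma>) y =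
          tensor_lift K B (\<lambda>u v. (\<alpha> x \<otimes>\<^bsub>B\<^esub> \<beta> u) \<otimes>\<^bsub>B\<^esub> \<gamma> v) (comult H y)" .
      qed
      also have "\<dots> = (\<alpha> \<otimes>\<^bsub>?E\<^esub> (\<beta> \<otimes>\<^bsub>?E\<^esub> \<gamma>)) d"
        using d by simp
      finally show "((\<alpha> \<otimes>\<^bsub>?E\<^esub> \<beta>) \<otimes>\<^bsub>?E\<^esub> \<gamma>) d = (\<alpha> \<otimes>\<^bsub>?E\<^esub> (\<beta> \<otimes>\<^bsub>?E\<^esub> \<gamma>)) d" .
    qed (intro mult a b c)+
  next
    fix \<alpha> assume a: "\<alpha> \<in> carrier ?E"
    note h = hom[OF a]
    have bs: "bilinear K H H H (\<lambda>x y. counit H x \<odot>\<^bsub>H\<^esub> y)"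
      by (rule bilinear_pair[OF bilinear_smult[OF H] H.counit_linear module_hom_id])
    have bs': "bilinear K H H H (\<lambda>x y. counit H y \<odot>\<^bsub>H\<^esub> x)"
      using bs by (simp add: bilinear_def)
    have cu: "counit H x \<in> carrier K" if "x \<in> carrier H" for x
      using module_hom_mem[OF H.counit_linear that] by simp
    show "\<one>\<^bsub>?E\<^esub> \<otimes>\<^bsub>?E\<^esub> \<alpha> = \<alpha>"
    proof (rule eqI[OF mult[OF one a] a])
      fix d assume d: "d \<in> carrier H"
      have "(\<one>\<^bsub>?E\<^esub> \<otimes>\<^bsub>?E\<^esub> \<alpha>) d = tensor_lift K B (\<lambda>x y. \<one>\<^bsub>?E\<^esub> x \<otimes>\<^bsub>B\<^esub> \<alpha> y) (comult H d)"
        using d by simp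
      also have "\<dots> = tensor_lift K B (\<lambda>x y. \<alpha> (counit H x \<odot>\<^bsub>H\<^esub> y)) (comult H d)"
        by (rule tensor_lift_cong[OF H H BV bil[OF hom[OF one] h] cm[OF d]])
          (simp add: module_hom_smult[OF h] cu B.smult_mult_left mem[OF a])
      also have "\<dots> = \<alpha> d"
        using tensor_lift_comp[OF H H H BV bs h cm[OF d]] H.counit_left[OF d] by simp
      finally show "(\<one>\<^bsub>?E\<^esub> \<otimes>\<^bsub>?E\<^esub> \<alpha>) d = \<alpha> d" .
    qed
    show "\<alpha> \<otimes>\<^bsub>?E\<^esub> \<one>\<^bsub>?E\<^esub> = \<alpha>"
    proof (rule eqI[OF mult[OF a one] a])
      fix d assume d: "d \<in> carrier H"
      have "(\<alpha> \<otimes>\<^bsub>?E\<^esub> \<one>\<^bsub>?E\<^esub>) d = tensor_lift K B (\<lambda>x y. \<alpha> x \<otimes>\<^bsub>B\<^esub> \<one>\<^bsub>?E\<^esub> y) (comult H d)"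
        using d by simp
      also have "\<dots> = tensor_lift K B (\<lambda>x y. \<alpha> (counit H y \<odot>\<^bsub>H\<^esub> x)) (comult H d)"
        by (rule tensor_lift_cong[OF H H BV bil[OF h hom[OF one]] cm[OF d]])
          (simp add: module_hom_smult[OF h] cu B.smult_mult_right mem[OF a])
      also have "\<dots> = \<alpha> d"
        using tensor_lift_comp[OF H H H BV bs' h cm[OF d]] H.counit_right[OF d] by simp
      finally show "(\<alpha> \<otimes>\<^bsub>?E\<^esub> \<one>\<^bsub>?E\<^esub>) d = \<alpha> d" .
    qed
  next
    fix \<beta> assume b: "\<beta> \<in> carrier ?E"
    show "(\<lambda>\<alpha>. \<alpha> \<otimes>\<^bsub>?E\<^esub> \<beta>) \<in> module_hom K ?E ?E"
      unfolding module_hom_hom_space_convolution convolution_algebra_simps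
    proof (rule curry_linear[OF H BV])
      fix d assume d: "d \<in> carrier H"
      show "(\<lambda>\<alpha>. tensor_lift K B (\<lambda>x y. \<alpha> x \<otimes>\<^bsub>B\<^esub> \<beta> y) (comult H d)) \<in> module_hom K ?E B"
        by (rule tensor_lift_linear_param[OF H H E BV cm[OF d] bil[OF hom hom[OF b]]])
          (assumption | rule module_hom_comp[OF assoc_algebra_mult_left[OF B mem[OF b]] eval])+
    qed (auto intro!: module_hom_tensor_lift[OF H H BV] bil H.comult_linear H hom[OF b])
    show "(\<lambda>\<alpha>. \<beta> \<otimes>\<^bsub>?E\<^esub> \<alpha>) \<in> module_hom K ?E ?E"
      unfolding module_hom_hom_space_convolution convolution_algebra_simps
    proof (rule curry_linear[OF H BV])
      fix d assume d: "d \<in> carrier H"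
      show "(\<lambda>\<alpha>. tensor_lift K B (\<lambda>x y. \<beta> x \<otimes>\<^bsub>B\<^esub> \<alpha> y) (comult H d)) \<in> module_hom K ?E B"
        by (rule tensor_lift_linear_param[OF H H E BV cm[OF d] bil[OF hom[OF b] hom]])
          (assumption | rule module_hom_comp[OF assoc_algebra_mult_right[OF B mem[OF b]] eval])+
    qed (auto intro!: module_hom_tensor_lift[OF H H BV] bil H.comult_linear H hom[OF b])
  qed
qed

section \<open>Finite codimension\<close>

text \<open>The coefficients \<open>C v\<close> with respect to a finite basis are first picked
  arbitrarily for each \<open>v\<close>. Linear independence makes them unique, and uniqueness
  forces the resulting coordinate functions to be linear.\<close>

lemma fin_dim_coordinates:
  assumes V: "vectorspace K V" and "vectorspace.fin_dim K V"
  shows "\<exists>E c. finite E \<and> E \<subseteq> carrier V \<and> (\<forall>e\<in>E. c e \<in> module_hom K V (base_algebra K)) \<and>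
    (\<forall>v\<in>carrier V. (\<Oplus>\<^bsub>V\<^esub>e\<in>E. c e v \<odot>\<^bsub>V\<^esub> e) = v)"
proof -
  interpret V: vectorspace K V by fact
  obtain E where E: "finite E" "V.basis E" using V.finite_basis_exists assms(2) by blast
  then have sub: "E \<subseteq> carrier V" and gen: "V.span E = carrier V" and li: "\<not> V.lin_dep E"
    by (auto simp: V.basis_def)
  have "\<exists>a. a \<in> E \<rightarrow> carrier K \<and> V.lincomb a E = v" if "v \<in> carrier V" for v
    using V.finite_in_span[OF E(1) sub] that gen by simp
  then obtain C where C: "C v \<in> E \<rightarrow> carrier K" "V.lincomb (C v) E = v" if "v \<in> carrier V" for v
    by metis
  have Cc: "C v e \<in> carrier K" if "v \<in> carrier V" "e \<in> E" for v e using C(1)[OF that(1)] that(2) by auto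
  have uniq: "a e = b e"
    if "a \<in> E \<rightarrow> carrier K" "b \<in> E \<rightarrow> carrier K" "V.lincomb a E = V.lincomb b E" "e \<in> E" for a b e
  proof (rule ccontr)
    assume "a e \<noteq> b e"
    moreover have "a e \<in> carrier K" "b e \<in> carrier K" using that by auto
    ultimately have "a e \<ominus>\<^bsub>K\<^esub> b e \<noteq> \<zero>\<^bsub>K\<^esub>" by simp
    moreover have "V.lincomb (\<lambda>e. a e \<ominus>\<^bsub>K\<^esub> b e) E = \<zero>\<^bsub>V\<^esub>"
      using V.lincomb_diff[OF E(1) sub that(1,2)] that(3) V.lincomb_closed[OF sub that(2)]
      by (simp add: V.M.r_neg a_minus_def)
    moreover have "(\<lambda>e. a e \<ominus>\<^bsub>K\<^esub> b e) \<in> E \<rightarrow> carrier K" using that by (auto simp: Pi_def)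
    ultimately have "V.lin_dep E" using V.lin_dep_crit[OF E(1) order_refl _ that(4)] by blast
    with li show False ..
  qed
  have "(\<lambda>v. C v e) \<in> module_hom K V (base_algebra K)" if e: "e \<in> E" for e
  proof (rule module_homI)
    fix x y assume xy: "x \<in> carrier V" "y \<in> carrier V"
    have "C (x \<oplus>\<^bsub>V\<^esub> y) e = C x e \<oplus>\<^bsub>K\<^esub> C y e"
      by (rule uniq[OF _ _ _ e]) (use xy in \<open>auto simp: C Pi_def Cc V.lincomb_sum[OF E(1) sub]\<close>)
    then show "C (x \<oplus>\<^bsub>V\<^esub> y) e = C x e \<oplus>\<^bsub>base_algebra K\<^esub> C y e" by simp
  next
    fix a x assume ax: "a \<in> carrier K" "x \<in> carrier V"
    have "C (a \<odot>\<^bsub>V\<^esub> x) e = a \<otimes>\<^bsub>K\<^esub> C x e"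
      by (rule uniq[OF _ _ _ e]) (use ax in \<open>auto simp: C Pi_def Cc V.lincomb_smult[OF sub]\<close>)
    then show "C (a \<odot>\<^bsub>V\<^esub> x) e = a \<odot>\<^bsub>base_algebra K\<^esub> C x e" by simp
  qed (simp add: Cc e)
  then show ?thesis
    using E sub C(2) by (intro exI[of _ E] exI[of _ "\<lambda>e v. C v e"]) (auto simp: V.lincomb_def)
qed

text \<open>Coordinates of the quotient are pulled back along the projection, and its basis vectors
  are lifted to representatives. The index set \<open>E\<close> consists of the cosets forming the
  basis. This is the dual basis modulo \<open>N\<close> that the comultiplication of the dual
  coalgebra is built from.\<close>

lemma fin_codim_coordinates:
  fixes V :: "('k, 'v, 'mv) module_scheme"
  assumes V: "vectorspace K V" and N: "submodule K N V"
    and fin: "vectorspace.fin_dim K (quotient_module V N)"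
  shows "\<exists>(E :: 'v set set) c r. finite E \<and>
    (\<forall>e\<in>E. r e \<in> carrier V \<and> c e \<in> module_hom K V (base_algebra K) \<and> (\<forall>x\<in>N. c e x = \<zero>\<^bsub>K\<^esub>)) \<and>
    (\<forall>v\<in>carrier V. v \<ominus>\<^bsub>V\<^esub> (\<Oplus>\<^bsub>V\<^esub>e\<in>E. c e v \<odot>\<^bsub>V\<^esub> r e) \<in> N)"
proof -
  interpret V: vectorspace K V by fact
  let ?Q = "quotient_module V N"
  note Q = vectorspace_quotient_module[OF V N] and B = vectorspace_base_algebra[OF V.field_axioms]
  interpret Q: vectorspace K ?Q by (rule Q)
  interpret N: abelian_subgroup N V by (rule submodule_abelian_subgroup[OF V N])
  obtain E c where E: "finite E" "E \<subseteq> carrier ?Q"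
    and c': "\<forall>e\<in>E. c e \<in> module_hom K ?Q (base_algebra K)"
    and sum': "\<forall>v\<in>carrier ?Q. (\<Oplus>\<^bsub>?Q\<^esub>e\<in>E. c e v \<odot>\<^bsub>?Q\<^esub> e) = v"
    using fin_dim_coordinates[OF Q fin] by (elim exE conjE) (rule that; assumption)
  note c = bspec[OF c'] and sum = bspec[OF sum']
  define p where "p = (\<lambda>x. N +>\<^bsub>V\<^esub> x)"
  have p: "p \<in> module_hom K V ?Q" unfolding p_def by (rule quotient_module_proj[OF V N])
  define r where "r e = (SOME f. f \<in> e)" for e :: "'v set"
  have r: "r e \<in> carrier V" "p (r e) = e" if "e \<in> E" for e
    using quotient_module_some[OF V N] E that by (auto simp: r_def p_def)
  have N_sub: "x \<in> carrier V" if "x \<in> N" for x using N that by (auto simp: submodule_def)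
  have pN: "p x = \<zero>\<^bsub>?Q\<^esub>" if "x \<in> N" for x
    by (simp add: p_def quotient_module_zero[OF V N] N.a_rcos_const that)
  have pc: "p v \<in> carrier ?Q" if "v \<in> carrier V" for v using module_hom_mem[OF p that] .
  have cc: "c e (p v) \<in> carrier K" if "v \<in> carrier V" "e \<in> E" for v e
    using module_hom_mem[OF c[OF that(2)] pc[OF that(1)]] by simp
  show ?thesis
  proof (intro exI[of _ E] exI[of _ "\<lambda>e v. c e (p v)"] exI[of _ r] conjI ballI)
    fix v assume v: "v \<in> carrier V"
    let ?s = "\<Oplus>\<^bsub>V\<^esub>e\<in>E. c e (p v) \<odot>\<^bsub>V\<^esub> r e"
    have s: "?s \<in> carrier V" using v r cc by (intro V.M.finsum_closed) auto
    have "p ?s = (\<Oplus>\<^bsub>?Q\<^esub>e\<in>E. p (c e (p v) \<odot>\<^bsub>V\<^esub> r e))"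
      using v r cc by (intro module_hom_finsum[OF V Q p]) auto
    also have "\<dots> = (\<Oplus>\<^bsub>?Q\<^esub>e\<in>E. c e (p v) \<odot>\<^bsub>?Q\<^esub> e)"
      using v r cc E by (intro Q.M.finsum_cong') (auto simp: module_hom_smult[OF p])
    also have "\<dots> = p v" by (rule sum[OF pc[OF v]])
    finally show "v \<ominus>\<^bsub>V\<^esub> ?s \<in> N"
      using quotient_module_eq_iff[OF V N v s] by (simp add: p_def)
  qed (use E r c in \<open>auto intro: module_hom_comp[OF _ p] simp: pN module_hom_zero[OF Q B]\<close>)
qed

section \<open>Finite sets of functionals and finite codimension\<close>

text \<open>A common kernel of finitely many functionals has a finite-dimensional complement: each
  new functional either vanishes on the common kernel of the previous ones, and then nothing
  changes, or it requires one further spanning vector.\<close>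

lemma functionals_complement:
  assumes V: "vectorspace K V" and "finite \<Phi>" "\<Phi> \<subseteq> module_hom K V (base_algebra K)"
  shows "\<exists>G. finite G \<and> G \<subseteq> carrier V \<and>
    (\<forall>v\<in>carrier V. \<exists>u\<in>module.span K V G. \<forall>\<phi>\<in>\<Phi>. \<phi> (v \<ominus>\<^bsub>V\<^esub> u) = \<zero>\<^bsub>K\<^esub>)"
  using assms(2,3)
proof (induction \<Phi>)
  case empty
  interpret V: vectorspace K V by fact
  have "\<zero>\<^bsub>V\<^esub> \<in> V.span {}" using V.span_is_submodule[of "{}"] by (simp add: submodule_def)
  then show ?case by (intro exI[of _ "{}"]) auto
next
  case (insert \<phi> \<Phi>)
  interpret V: vectorspace K V by fact
  note B = vectorspace_base_algebra[OF V.field_axioms]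
  obtain G where G: "finite G" "G \<subseteq> carrier V"
    and ex: "\<And>v. v \<in> carrier V \<Longrightarrow> \<exists>u\<in>V.span G. \<forall>\<phi>\<in>\<Phi>. \<phi> (v \<ominus>\<^bsub>V\<^esub> u) = \<zero>\<^bsub>K\<^esub>"
    using insert by auto
  have hom: "\<psi> \<in> module_hom K V (base_algebra K)" if "\<psi> \<in> insert \<phi> \<Phi>" for \<psi>
    using that insert by auto
  show ?case
  proof (cases "\<forall>v\<in>carrier V. (\<forall>\<psi>\<in>\<Phi>. \<psi> v = \<zero>\<^bsub>K\<^esub>) \<longrightarrow> \<phi> v = \<zero>\<^bsub>K\<^esub>")
    case True
    have "\<exists>u\<in>V.span G. \<forall>\<phi>\<in>insert \<phi> \<Phi>. \<phi> (v \<ominus>\<^bsub>V\<^esub> u) = \<zero>\<^bsub>K\<^esub>" if v: "v \<in> carrier V" for v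
    proof -
      obtain u where u: "u \<in> V.span G" "\<forall>\<phi>\<in>\<Phi>. \<phi> (v \<ominus>\<^bsub>V\<^esub> u) = \<zero>\<^bsub>K\<^esub>" using ex[OF v] by blast
      then have "v \<ominus>\<^bsub>V\<^esub> u \<in> carrier V" using V.span_is_subset2[OF G(2)] v by blast
      with True u show ?thesis by blast
    qed
    with G show ?thesis by blast
  next
    case False
    \<comment> \<open>The vector lies in the common kernel of the old functionals, so adding
      multiples of it to \<open>u\<close> leaves their values intact while the value of
      \<open>\<phi>\<close> can be corrected.\<close>
    then obtain g where g: "g \<in> carrier V" "\<And>\<psi>. \<psi> \<in> \<Phi> \<Longrightarrow> \<psi> g = \<zero>\<^bsub>K\<^esub>" "\<phi> g \<noteq> \<zero>\<^bsub>K\<^esub>" by blast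
    have G': "insert g G \<subseteq> carrier V" using g G by blast
    note sub = V.span_is_submodule[OF G'] and own = V.in_own_span[OF G']
    have cg: "\<phi> g \<in> carrier K" using module_hom_mem[OF hom g(1)] by simp
    have "\<exists>u\<in>V.span (insert g G). \<forall>\<phi>\<in>insert \<phi> \<Phi>. \<phi> (v \<ominus>\<^bsub>V\<^esub> u) = \<zero>\<^bsub>K\<^esub>" if v: "v \<in> carrier V" for v
    proof -
      obtain u where u: "u \<in> V.span G" "\<And>\<phi>. \<phi> \<in> \<Phi> \<Longrightarrow> \<phi> (v \<ominus>\<^bsub>V\<^esub> u) = \<zero>\<^bsub>K\<^esub>"
        using ex[OF v] by blast
      then have uc: "u \<in> carrier V" and uG: "u \<in> V.span (insert g G)"
        using V.span_is_subset2[OF G(2)] V.span_is_monotone[of G "insert g G"] by blast+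
      define w where "w = v \<ominus>\<^bsub>V\<^esub> u"
      have w: "w \<in> carrier V" using v uc by (simp add: w_def)
      \<comment> \<open>The coefficient for which \<open>\<phi>\<close> takes the same value at
        \<open>a \<odot> g\<close> as at the remainder \<open>w\<close>.\<close>
      define a where "a = \<phi> w \<otimes>\<^bsub>K\<^esub> inv\<^bsub>K\<^esub> (\<phi> g)"
      have cw: "\<phi> w \<in> carrier K" using module_hom_mem[OF hom w] by simp
      have a: "a \<in> carrier K" using cw cg g by (simp add: a_def)
      have "v \<ominus>\<^bsub>V\<^esub> (u \<oplus>\<^bsub>V\<^esub> a \<odot>\<^bsub>V\<^esub> g) = w \<ominus>\<^bsub>V\<^esub> a \<odot>\<^bsub>V\<^esub> g"
        using v uc a g by (simp add: w_def a_minus_def V.minus_add V.a_assoc)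
      moreover have "\<psi> (w \<ominus>\<^bsub>V\<^esub> a \<odot>\<^bsub>V\<^esub> g) = \<zero>\<^bsub>K\<^esub>" if "\<psi> \<in> insert \<phi> \<Phi>" for \<psi>
      proof -
        have "\<psi> (w \<ominus>\<^bsub>V\<^esub> a \<odot>\<^bsub>V\<^esub> g) = \<psi> w \<ominus>\<^bsub>base_algebra K\<^esub> a \<otimes>\<^bsub>K\<^esub> \<psi> g"
          using w a g by (simp add: module_hom_minus[OF V B hom[OF that]] module_hom_smult[OF hom[OF that]])
        \<comment> \<open>Subtraction is formed in two different records,
          \<open>base_algebra K\<close> and \<open>K\<close>, which share carrier, addition and
          zero.\<close>
        also have "\<dots> = \<psi> w \<ominus>\<^bsub>K\<^esub> a \<otimes>\<^bsub>K\<^esub> \<psi> g"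
          by (simp add: a_minus_def a_inv_def m_inv_def)
        also have "\<dots> = \<zero>\<^bsub>K\<^esub>"
        proof (cases "\<psi> = \<phi>")
          case True
          then show ?thesis using cw cg g(3) by (simp add: a_def V.m_assoc V.field_Units)
        next
          case False
          then have "\<psi> \<in> \<Phi>" using that by simp
          then show ?thesis using u(2)[of \<psi>] g(2)[of \<psi>] a by (simp add: w_def)
        qed
        finally show ?thesis .
      qed
      moreover have "u \<oplus>\<^bsub>V\<^esub> a \<odot>\<^bsub>V\<^esub> g \<in> V.span (insert g G)"
        using sub uG own a by (auto simp: submodule_def)
      ultimately show ?thesis by metis
    qed
    with G G' show ?thesis by (intro exI[of _ "insert g G"]) auto
  qed
qed

text \<open>The converse use of functionals: modulo \<open>N\<close> every vector equals one in the
  span of the finite set \<open>G\<close> from \<open>functionals_complement\<close>, because the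
  difference lies in the common kernel and hence in \<open>N\<close>. So the images of
  \<open>G\<close> span the quotient.\<close>

lemma functionals_fin_codim:
  assumes V: "vectorspace K V" and N: "submodule K N V"
    and \<Phi>: "finite \<Phi>" "\<Phi> \<subseteq> module_hom K V (base_algebra K)"
    and ker: "\<And>v. \<lbrakk>v \<in> carrier V; \<forall>\<phi>\<in>\<Phi>. \<phi> v = \<zero>\<^bsub>K\<^esub>\<rbrakk> \<Longrightarrow> v \<in> N"
  shows "vectorspace.fin_dim K (quotient_module V N)"
proof -
  interpret V: vectorspace K V by fact
  let ?Q = "quotient_module V N"
  note Q = vectorspace_quotient_module[OF V N]
  interpret Q: vectorspace K ?Q by (rule Q)
  obtain G where G: "finite G" "G \<subseteq> carrier V"
    and ex: "\<And>v. v \<in> carrier V \<Longrightarrow> \<exists>u\<in>V.span G. \<forall>\<phi>\<in>\<Phi>. \<phi> (v \<ominus>\<^bsub>V\<^esub> u) = \<zero>\<^bsub>K\<^esub>"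
    using functionals_complement[OF V \<Phi>] by auto
  define p where "p = (\<lambda>x. N +>\<^bsub>V\<^esub> x)"
  have p: "p \<in> module_hom K V ?Q" unfolding p_def by (rule quotient_module_proj[OF V N])
  have pG: "p ` G \<subseteq> carrier ?Q" using G module_hom_mem[OF p] by auto
  have 1: "V.span G \<subseteq> {x \<in> carrier V. p x \<in> Q.span (p ` G)}"
    by (rule span_minimal[OF V _ submodule_vimage[OF V Q p Q.span_is_submodule[OF pG]]])
      (use G Q.in_own_span[OF pG] in auto)
  have 2: "p v \<in> p ` V.span G" if v: "v \<in> carrier V" for v
  proof -
    obtain u where u: "u \<in> V.span G" "\<forall>\<phi>\<in>\<Phi>. \<phi> (v \<ominus>\<^bsub>V\<^esub> u) = \<zero>\<^bsub>K\<^esub>" using ex[OF v] by blast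
    then have uc: "u \<in> carrier V" using V.span_is_subset2[OF G(2)] by blast
    with u v have "v \<ominus>\<^bsub>V\<^esub> u \<in> N" by (intro ker) auto
    then have "p v = p u" using quotient_module_eq_iff[OF V N v uc] by (simp add: p_def)
    with u show ?thesis by blast
  qed
  have "carrier ?Q = p ` carrier V"
    by (simp add: carrier_quotient_module[OF V N] p_def)
  moreover have "p ` carrier V \<subseteq> p ` V.span G" using 2 by (rule image_subsetI)
  moreover have "p ` V.span G \<subseteq> Q.span (p ` G)" using 1 by auto
  ultimately have "carrier ?Q \<subseteq> Q.span (p ` G)" by simp
  then have "Q.span (p ` G) = carrier ?Q" using Q.span_is_subset2[OF pG] by blast
  then show ?thesis unfolding Q.fin_dim_def using G pG by blast
qed

section \<open>The dual coalgebra\<close>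

text \<open>The ideals in the definition of the dual are ring ideals. They are closed under scalars
  because \<open>a \<odot> x\<close> is the product of \<open>a \<odot> 1\<close> with
  \<open>x\<close>.\<close>

lemma ideal_submodule:
  assumes "assoc_algebra K A" and "ideal I A" shows "submodule K I A"
proof -
  interpret assoc_algebra K A by fact
  interpret I: ideal I A by fact
  show ?thesis
  proof (rule submoduleI'[OF assoc_algebra_vectorspace[OF assms(1)]])
    fix a x assume ax: "a \<in> carrier K" "x \<in> I"
    then have "a \<odot>\<^bsub>A\<^esub> x = (a \<odot>\<^bsub>A\<^esub> \<one>\<^bsub>A\<^esub>) \<otimes>\<^bsub>A\<^esub> x" by (simp add: smult_mult_left)
    with ax show "a \<odot>\<^bsub>A\<^esub> x \<in> I" by (simp add: I.I_l_closed)
  qed (use I.a_subset in auto)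
qed

lemma dual_coalgebra_simps [simp]:
  "carrier (dual_coalgebra K S) = {f \<in> module_hom K S (base_algebra K) \<inter> extensional (carrier S).
      \<exists>I. ideal I S \<and> vectorspace.fin_dim K (quotient_module S I) \<and> (\<forall>x\<in>I. f x = \<zero>\<^bsub>K\<^esub>)}"
  "\<zero>\<^bsub>dual_coalgebra K S\<^esub> = (\<lambda>x\<in>carrier S. \<zero>\<^bsub>K\<^esub>)"
  "f \<oplus>\<^bsub>dual_coalgebra K S\<^esub> g = (\<lambda>x\<in>carrier S. f x \<oplus>\<^bsub>K\<^esub> g x)"
  "a \<odot>\<^bsub>dual_coalgebra K S\<^esub> f = (\<lambda>x\<in>carrier S. a \<otimes>\<^bsub>K\<^esub> f x)"
  "counit (dual_coalgebra K S) f = f \<one>\<^bsub>S\<^esub>"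
  by (simp_all add: dual_coalgebra_def finite_dual_space_def Let_def hom_space_def)

text \<open>The comultiplication is defined with the tensor square of the bare space, whereas the
  coalgebra axioms speak about that of the dual coalgebra. The two coincide since a tensor product
  depends only on carrier, addition and scalar multiplication.\<close>

lemma tensor_finite_dual_space:
  "tensor K (finite_dual_space K S) (finite_dual_space K S) =
    tensor K (dual_coalgebra K S) (dual_coalgebra K S)"
proof -
  have "carrier (finite_dual_space K S) = carrier (dual_coalgebra K S)"
    "ring.add (finite_dual_space K S) = ring.add (dual_coalgebra K S)"
    "module.smult (finite_dual_space K S) = module.smult (dual_coalgebra K S)"
    by (simp_all add: dual_coalgebra_def Let_def)
  then show ?thesis
    by (simp only: tensor_def tensor_null_def tensor_relations_def)
qed

lemma comult_dual_coalgebra: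
  "comult (dual_coalgebra K S) f =
    (THE t. t \<in> carrier (tensor K (dual_coalgebra K S) (dual_coalgebra K S)) \<and>
      (\<forall>x\<in>carrier S. \<forall>y\<in>carrier S.
        f (x \<otimes>\<^bsub>S\<^esub> y) = tensor_lift K (base_algebra K) (\<lambda>g h. g x \<otimes>\<^bsub>K\<^esub> h y) t))"
  unfolding tensor_finite_dual_space[symmetric] by (simp add: dual_coalgebra_def Let_def)

context
  fixes K :: "('k, 'm) ring_scheme" and S :: "('k, 's, 'ms) module_scheme"
  assumes S: "assoc_algebra K S"
begin

interpretation S: assoc_algebra K S by (rule S)

private abbreviation (input) "k \<equiv> base_algebra K"
private abbreviation (input) "D \<equiv> dual_coalgebra K S"

private lemma SV: "vectorspace K S" by (rule assoc_algebra_vectorspace[OF S])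
private lemma k: "assoc_algebra K k" by (rule assoc_algebra_base_algebra[OF S.field_axioms])
private lemma kV: "vectorspace K k" by (rule assoc_algebra_vectorspace[OF k])

lemma dual_coalgebraI:
  assumes "f \<in> module_hom K S (base_algebra K)" "f \<in> extensional (carrier S)"
    and "ideal I S" "vectorspace.fin_dim K (quotient_module S I)" "\<And>x. x \<in> I \<Longrightarrow> f x = \<zero>\<^bsub>K\<^esub>"
  shows "f \<in> carrier (dual_coalgebra K S)"
  using assms by auto

text \<open>Replaces an ideal of finite codimension by a finite set of functionals, which is easier
  to produce and to combine. From an ideal one takes the coordinates of the quotient; from
  functionals one recovers an ideal as below, which has finite codimension because it contains their
  common kernel.\<close>

lemma dual_coalgebra_criterion:
  assumes f: "f \<in> module_hom K S (base_algebra K)" "f \<in> extensional (carrier S)"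
  shows "f \<in> carrier (dual_coalgebra K S) \<longleftrightarrow>
    (\<exists>\<Phi>. finite \<Phi> \<and> \<Phi> \<subseteq> module_hom K S (base_algebra K) \<and>
      (\<forall>y\<in>carrier S. (\<forall>\<phi>\<in>\<Phi>. \<phi> y = \<zero>\<^bsub>K\<^esub>) \<longrightarrow>
        (\<forall>x\<in>carrier S. \<forall>z\<in>carrier S. f (x \<otimes>\<^bsub>S\<^esub> (y \<otimes>\<^bsub>S\<^esub> z)) = \<zero>\<^bsub>K\<^esub>)))"
    (is "_ \<longleftrightarrow> (\<exists>\<Phi>. ?P \<Phi>)")
proof
  assume "f \<in> carrier D"
  then obtain I where I: "ideal I S" "vectorspace.fin_dim K (quotient_module S I)"
    and null: "\<And>x. x \<in> I \<Longrightarrow> f x = \<zero>\<^bsub>K\<^esub>" by auto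
  interpret I: ideal I S by fact
  obtain E :: "'s set set" and c r where "finite E"
    and c: "\<And>e. e \<in> E \<Longrightarrow> r e \<in> carrier S \<and> c e \<in> module_hom K S k \<and> (\<forall>x\<in>I. c e x = \<zero>\<^bsub>K\<^esub>)"
    and sum: "\<And>v. v \<in> carrier S \<Longrightarrow> v \<ominus>\<^bsub>S\<^esub> (\<Oplus>\<^bsub>S\<^esub>e\<in>E. c e v \<odot>\<^bsub>S\<^esub> r e) \<in> I"
    using fin_codim_coordinates[OF SV ideal_submodule[OF S I(1)] I(2)] by blast
  \<comment> \<open>If all coordinates of \<open>y\<close> vanish, the sum that approximates
    \<open>y\<close> modulo \<open>I\<close> is zero.\<close>
  have mem: "y \<in> I" if y: "y \<in> carrier S" and 0: "\<forall>\<phi>\<in>c ` E. \<phi> y = \<zero>\<^bsub>K\<^esub>" for y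
  proof -
    have "(\<Oplus>\<^bsub>S\<^esub>e\<in>E. c e y \<odot>\<^bsub>S\<^esub> r e) = (\<Oplus>\<^bsub>S\<^esub>e\<in>E. \<zero>\<^bsub>S\<^esub>)"
      using 0 c by (intro S.finsum_cong') auto
    then show ?thesis using sum[OF y] y by (simp add: a_minus_def)
  qed
  have "?P (c ` E)"
  proof (intro conjI ballI impI)
    fix x y z assume "y \<in> carrier S" "\<forall>\<phi>\<in>c ` E. \<phi> y = \<zero>\<^bsub>K\<^esub>" "x \<in> carrier S" "z \<in> carrier S"
    then show "f (x \<otimes>\<^bsub>S\<^esub> (y \<otimes>\<^bsub>S\<^esub> z)) = \<zero>\<^bsub>K\<^esub>" by (intro null I.I_l_closed I.I_r_closed mem)
  qed (use \<open>finite E\<close> c in auto)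
  then show "\<exists>\<Phi>. ?P \<Phi>" ..
next
  assume "\<exists>\<Phi>. ?P \<Phi>"
  then obtain \<Phi> where P: "?P \<Phi>" ..
  note \<Phi> = P[THEN conjunct1] P[THEN conjunct2, THEN conjunct1]
    and ker = P[THEN conjunct2, THEN conjunct2, rule_format]
  \<comment> \<open>This is the largest two-sided ideal inside the kernel of \<open>f\<close>.
    Multiplication on both sides is built into it, and taking both outer factors to be 1 shows that
    \<open>f\<close> vanishes on it.\<close>
  define I where "I = {y \<in> carrier S. \<forall>x\<in>carrier S. \<forall>z\<in>carrier S. f (x \<otimes>\<^bsub>S\<^esub> (y \<otimes>\<^bsub>S\<^esub> z)) = \<zero>\<^bsub>K\<^esub>}"
  have sub: "submodule K I S"
    by (rule submoduleI'[OF SV])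
      (auto simp: I_def S.l_distr S.r_distr S.smult_mult_left S.smult_mult_right
        module_hom_zero[OF SV kV f(1)] module_hom_add[OF f(1)] module_hom_smult[OF f(1)])
  interpret I: abelian_subgroup I S by (rule submodule_abelian_subgroup[OF SV sub])
  have "ideal I S"
  proof (rule idealI[OF S.ring_axioms I.a_subgroup])
    fix a x assume ax: "a \<in> I" "x \<in> carrier S"
    have ac: "a \<in> carrier S" using ax by simp
    have a0: "f (u \<otimes>\<^bsub>S\<^esub> (a \<otimes>\<^bsub>S\<^esub> w)) = \<zero>\<^bsub>K\<^esub>" if "u \<in> carrier S" "w \<in> carrier S" for u w
      using ax(1) that unfolding I_def by blast
    have "f (u \<otimes>\<^bsub>S\<^esub> ((x \<otimes>\<^bsub>S\<^esub> a) \<otimes>\<^bsub>S\<^esub> w)) = \<zero>\<^bsub>K\<^esub>" "f (u \<otimes>\<^bsub>S\<^esub> ((a \<otimes>\<^bsub>S\<^esub> x) \<otimes>\<^bsub>S\<^esub> w)) = \<zero>\<^bsub>K\<^esub>"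
      if u: "u \<in> carrier S" and w: "w \<in> carrier S" for u w
      using a0[OF S.m_closed[OF u ax(2)] w] a0[OF u S.m_closed[OF ax(2) w]]
      by (simp_all add: S.m_assoc u w ac ax(2))
    then show "x \<otimes>\<^bsub>S\<^esub> a \<in> I" "a \<otimes>\<^bsub>S\<^esub> x \<in> I"
      unfolding I_def using S.m_closed[OF ax(2) ac] S.m_closed[OF ac ax(2)] by blast+
  qed
  moreover have "vectorspace.fin_dim K (quotient_module S I)"
  proof (rule functionals_fin_codim[OF SV sub \<Phi>])
    fix v assume v: "v \<in> carrier S" "\<forall>\<phi>\<in>\<Phi>. \<phi> v = \<zero>\<^bsub>K\<^esub>"
    have "f (x \<otimes>\<^bsub>S\<^esub> (v \<otimes>\<^bsub>S\<^esub> z)) = \<zero>\<^bsub>K\<^esub>" if "x \<in> carrier S" "z \<in> carrier S" for x z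
      by (rule ker[OF v(1) _ that]) (rule bspec[OF v(2)])
    with v(1) show "v \<in> I" unfolding I_def by blast
  qed
  moreover have "f x = \<zero>\<^bsub>K\<^esub>" if "x \<in> I" for x
  proof -
    have "f (\<one>\<^bsub>S\<^esub> \<otimes>\<^bsub>S\<^esub> (x \<otimes>\<^bsub>S\<^esub> \<one>\<^bsub>S\<^esub>)) = \<zero>\<^bsub>K\<^esub>" using that unfolding I_def by blast
    then show ?thesis using that by simp
  qed
  ultimately show "f \<in> carrier D" by (intro dual_coalgebraI[of f I] f)
qed

lemma dual_coalgebra_hom: "f \<in> carrier (dual_coalgebra K S) \<Longrightarrow> f \<in> module_hom K S (base_algebra K)"
  by simp

text \<open>The dual is a subspace of all functionals. By the criterion, a sum is handled by the
  union of two finite sets of functionals, and no intersection of ideals of finite codimension is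
  formed.\<close>

lemma vectorspace_dual_coalgebra: "vectorspace K (dual_coalgebra K S)"
proof -
  let ?H = "hom_space K S k"
  have H: "vectorspace K ?H" by (rule vectorspace_hom_space[OF SV kV])
  interpret H: vectorspace K ?H by (rule H)
  let ?W = "carrier D"
  have dest: "f \<in> carrier ?H \<and> f \<in> module_hom K S k \<and> f \<in> extensional (carrier S)" if "f \<in> ?W" for f
    using that by simp
  let ?N = "\<lambda>f \<Phi>. \<forall>y\<in>carrier S. (\<forall>\<phi>\<in>\<Phi>. \<phi> y = \<zero>\<^bsub>K\<^esub>) \<longrightarrow>
    (\<forall>x\<in>carrier S. \<forall>z\<in>carrier S. f (x \<otimes>\<^bsub>S\<^esub> (y \<otimes>\<^bsub>S\<^esub> z)) = \<zero>\<^bsub>K\<^esub>)"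
  have crit: "\<exists>\<Phi>. finite \<Phi> \<and> \<Phi> \<subseteq> module_hom K S k \<and> ?N f \<Phi>" if "f \<in> ?W" for f
    using dest[OF that] that dual_coalgebra_criterion[of f] by blast
  have crit': "f \<in> ?W"
    if "f \<in> carrier ?H" "\<exists>\<Phi>. finite \<Phi> \<and> \<Phi> \<subseteq> module_hom K S k \<and> ?N f \<Phi>" for f
    using that dual_coalgebra_criterion[of f] unfolding hom_space_simps by blast
  have W: "submodule K ?W ?H"
  proof (rule submoduleI'[OF H])
    show "?W \<subseteq> carrier ?H" using dest by blast
    have z: "\<zero>\<^bsub>?H\<^esub> \<in> carrier ?H" by (rule H.M.zero_closed)
    show "\<zero>\<^bsub>?H\<^esub> \<in> ?W"
      by (rule crit'[OF z]) (auto intro!: exI[of _ "{}"])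
  next
    fix f g assume f: "f \<in> ?W" and g: "g \<in> ?W"
    have fg: "f \<oplus>\<^bsub>?H\<^esub> g \<in> carrier ?H" using dest[OF f] dest[OF g] by (intro H.M.a_closed) simp_all
    from crit[OF f] obtain \<Phi> where \<Phi>: "finite \<Phi>" "\<Phi> \<subseteq> module_hom K S k" "?N f \<Phi>" by blast
    from crit[OF g] obtain \<Psi> where \<Psi>: "finite \<Psi>" "\<Psi> \<subseteq> module_hom K S k" "?N g \<Psi>" by blast
    from \<Phi>(3) \<Psi>(3) have "?N (f \<oplus>\<^bsub>?H\<^esub> g) (\<Phi> \<union> \<Psi>)" by (simp add: ball_Un)
    moreover have "finite (\<Phi> \<union> \<Psi>)" "\<Phi> \<union> \<Psi> \<subseteq> module_hom K S k" using \<Phi> \<Psi> by auto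
    ultimately show "f \<oplus>\<^bsub>?H\<^esub> g \<in> ?W" using fg by (intro crit') blast+
  next
    fix a f assume a: "a \<in> carrier K" and f: "f \<in> ?W"
    have af: "a \<odot>\<^bsub>?H\<^esub> f \<in> carrier ?H" using a dest[OF f] by (intro H.smult_closed) simp_all
    from crit[OF f] obtain \<Phi> where \<Phi>: "finite \<Phi>" "\<Phi> \<subseteq> module_hom K S k" "?N f \<Phi>" by blast
    from \<Phi>(3) have "?N (a \<odot>\<^bsub>?H\<^esub> f) \<Phi>" using a by simp
    with \<Phi> af show "a \<odot>\<^bsub>?H\<^esub> f \<in> ?W" by (intro crit') blast+
  qed
  have "module K (?H\<lparr>carrier := ?W\<rparr>)" by (rule H.submodule_is_module[OF W])
  then have "vectorspace K (?H\<lparr>carrier := ?W\<rparr>)"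
    using S.field_axioms by (simp add: vectorspace_def)
  then show ?thesis
    by (rule vectorspace_cong) (simp_all add: fun_eq_iff)
qed

private lemmas DV = vectorspace_dual_coalgebra

lemma dual_coalgebra_eqI:
  "\<lbrakk>f \<in> carrier (dual_coalgebra K S); g \<in> carrier (dual_coalgebra K S);
    \<And>x. x \<in> carrier S \<Longrightarrow> f x = g x\<rbrakk> \<Longrightarrow> f = g"
  by (auto intro: extensionalityI)

lemma dual_coalgebra_eval:
  "x \<in> carrier S \<Longrightarrow> (\<lambda>f. f x) \<in> module_hom K (dual_coalgebra K S) (base_algebra K)"
  by (rule module_homI) (auto dest: module_hom_mem)

lemma bilinear_dual_eval:
  "\<lbrakk>x \<in> carrier S; y \<in> carrier S\<rbrakk> \<Longrightarrow>
    bilinear K (dual_coalgebra K S) (dual_coalgebra K S) (base_algebra K) (\<lambda>g h. g x \<otimes>\<^bsub>K\<^esub> h y)"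
  using bilinear_mult_pair[OF k dual_coalgebra_eval dual_coalgebra_eval, of x y] by simp

text \<open>Evaluations at elements of \<open>S\<close> separate the points of the dual, so
  \<open>tensor_separating\<close> applies to its tensor square. This is the uniqueness behind the
  definite description in \<open>comult_dual_coalgebra\<close>.\<close>

lemma tensor_dual_null:
  assumes "t \<in> carrier (tensor K (dual_coalgebra K S) (dual_coalgebra K S))"
    and "\<And>x y. \<lbrakk>x \<in> carrier S; y \<in> carrier S\<rbrakk>
      \<Longrightarrow> tensor_lift K (base_algebra K) (\<lambda>g h. g x \<otimes>\<^bsub>K\<^esub> h y) t = \<zero>\<^bsub>K\<^esub>"
  shows "t = \<zero>\<^bsub>tensor K (dual_coalgebra K S) (dual_coalgebra K S)\<^esub>"
proof (rule tensor_separating[OF DV DV _ _ _ _ assms(1)])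
  let ?E = "(\<lambda>x f. f x) ` carrier S"
  show "\<phi> \<in> module_hom K D k" if "\<phi> \<in> ?E" for \<phi> using that dual_coalgebra_eval by auto
  then show "\<phi> \<in> module_hom K D k" if "\<phi> \<in> ?E" for \<phi> using that .
  interpret D: vectorspace K D by (rule DV)
  show sep: "v = \<zero>\<^bsub>D\<^esub>" if "v \<in> carrier D" "\<And>\<phi>. \<phi> \<in> ?E \<Longrightarrow> \<phi> v = \<zero>\<^bsub>K\<^esub>" for v
    by (rule dual_coalgebra_eqI[OF that(1) D.M.zero_closed]) (use that(2) in auto)
  then show "v = \<zero>\<^bsub>D\<^esub>" if "v \<in> carrier D" "\<And>\<phi>. \<phi> \<in> ?E \<Longrightarrow> \<phi> v = \<zero>\<^bsub>K\<^esub>" for v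
    using that .
qed (use assms(2) in auto)

lemma tensor_dual_eqI:
  assumes s: "s \<in> carrier (tensor K (dual_coalgebra K S) (dual_coalgebra K S))"
    and t: "t \<in> carrier (tensor K (dual_coalgebra K S) (dual_coalgebra K S))"
    and eq: "\<And>x y. \<lbrakk>x \<in> carrier S; y \<in> carrier S\<rbrakk> \<Longrightarrow>
      tensor_lift K (base_algebra K) (\<lambda>g h. g x \<otimes>\<^bsub>K\<^esub> h y) s =
      tensor_lift K (base_algebra K) (\<lambda>g h. g x \<otimes>\<^bsub>K\<^esub> h y) t"
  shows "s = t"
proof -
  interpret k: vectorspace K k by (rule kV)
  interpret DD: vectorspace K "tensor K D D" by (rule vectorspace_tensor[OF DV DV])
  have "s \<ominus>\<^bsub>tensor K D D\<^esub> t = \<zero>\<^bsub>tensor K D D\<^esub>"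
  proof (rule tensor_dual_null)
    fix x y assume xy: "x \<in> carrier S" "y \<in> carrier S"
    show "tensor_lift K k (\<lambda>g h. g x \<otimes>\<^bsub>K\<^esub> h y) (s \<ominus>\<^bsub>tensor K D D\<^esub> t) = \<zero>\<^bsub>K\<^esub>"
      using eq[OF xy] tensor_lift_mem[OF DV DV kV bilinear_dual_eval[OF xy] t]
        module_hom_minus[OF DD.vectorspace_axioms kV
          tensor_lift_linear[OF DV DV kV bilinear_dual_eval[OF xy]] s t]
      by (simp add: k.M.r_neg[simplified] a_minus_def)
  qed (use s t in auto)
  with s t show ?thesis by simp
qed

text \<open>With the dual basis \<open>c e\<close>, \<open>r e\<close> modulo \<open>I\<close>, the
  witness is the sum of \<open>c e \<otimes> f(r e \<cdot> _)\<close>. At \<open>(x, y)\<close> it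
  takes the value of \<open>f\<close> at \<open>s \<otimes> y\<close>, where \<open>s\<close> is the
  approximation of \<open>x\<close>; since \<open>x\<close> and \<open>s\<close> differ by an
  element of \<open>I\<close>, a right ideal killed by \<open>f\<close>, this is
  \<open>f (x \<otimes> y)\<close>.\<close>

lemma dual_comult_exists:
  assumes f: "f \<in> carrier (dual_coalgebra K S)"
  shows "\<exists>t\<in>carrier (tensor K (dual_coalgebra K S) (dual_coalgebra K S)).
    \<forall>x\<in>carrier S. \<forall>y\<in>carrier S.
      f (x \<otimes>\<^bsub>S\<^esub> y) = tensor_lift K (base_algebra K) (\<lambda>g h. g x \<otimes>\<^bsub>K\<^esub> h y) t"
proof -
  from f obtain I where I: "ideal I S" "vectorspace.fin_dim K (quotient_module S I)"
    and null: "\<And>x. x \<in> I \<Longrightarrow> f x = \<zero>\<^bsub>K\<^esub>" by auto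
  note fh = dual_coalgebra_hom[OF f]
  interpret I: ideal I S by fact
  interpret k: vectorspace K k by (rule kV)
  interpret DD: vectorspace K "tensor K D D" by (rule vectorspace_tensor[OF DV DV])
  obtain E :: "'s set set" and c r where "finite E"
    and c: "\<And>e. e \<in> E \<Longrightarrow> r e \<in> carrier S \<and> c e \<in> module_hom K S k \<and> (\<forall>x\<in>I. c e x = \<zero>\<^bsub>K\<^esub>)"
    and sum: "\<And>v. v \<in> carrier S \<Longrightarrow> v \<ominus>\<^bsub>S\<^esub> (\<Oplus>\<^bsub>S\<^esub>e\<in>E. c e v \<odot>\<^bsub>S\<^esub> r e) \<in> I"
    using fin_codim_coordinates[OF SV ideal_submodule[OF S I(1)] I(2)] by blast
  \<comment> \<open>Both families lie in the dual with the same ideal \<open>I\<close> as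
    \<open>f\<close>: the coordinates vanish on \<open>I\<close>, and
    \<open>f(r e \<cdot> _)\<close> does so because \<open>I\<close> is a left ideal.\<close>
  define g h where "g e = restrict (c e) (carrier S)"
    and "h e = (\<lambda>y\<in>carrier S. f (r e \<otimes>\<^bsub>S\<^esub> y))" for e
  have g: "g e \<in> carrier D" if "e \<in> E" for e
    by (rule dual_coalgebraI[OF _ _ I])
      (use c[OF that] in \<open>auto simp: g_def intro: module_hom_restrict[OF _ SV]\<close>)
  have h: "h e \<in> carrier D" if "e \<in> E" for e
    unfolding h_def
    by (rule dual_coalgebraI[OF module_hom_restrict[OF
            module_hom_comp[OF fh assoc_algebra_mult_right[OF S]] SV] _ I])
      (use c[OF that] in \<open>auto simp: null I.I_l_closed\<close>)
  have cc: "c e x \<in> carrier K" if "e \<in> E" "x \<in> carrier S" for e x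
    using c[OF that(1)] module_hom_mem[of "c e" K S k x] that by simp
  let ?t = "\<Oplus>\<^bsub>tensor K D D\<^esub>e\<in>E. pure_tensor K D D (g e) (h e)"
  have p: "(\<lambda>e. pure_tensor K D D (g e) (h e)) \<in> E \<rightarrow> carrier (tensor K D D)"
    using pure_tensor_mem[OF DV DV g h] by blast
  show ?thesis
  proof (intro bexI ballI)
    show "?t \<in> carrier (tensor K D D)" using p by (rule DD.M.finsum_closed)
    fix x y assume xy: "x \<in> carrier S" "y \<in> carrier S"
    let ?s = "\<Oplus>\<^bsub>S\<^esub>e\<in>E. c e x \<odot>\<^bsub>S\<^esub> r e"
    have m: "(\<lambda>e. c e x \<odot>\<^bsub>S\<^esub> r e) \<in> E \<rightarrow> carrier S" using c cc xy by auto
    have s: "?s \<in> carrier S" using m by (rule S.finsum_closed)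
    have fy: "(\<lambda>x. f (x \<otimes>\<^bsub>S\<^esub> y)) \<in> module_hom K S k"
      by (rule module_hom_comp[OF fh assoc_algebra_mult_left[OF S xy(2)]])
    have fm: "f z \<in> carrier K" if "z \<in> carrier S" for z using module_hom_mem[OF fh that] by simp
    have "tensor_lift K k (\<lambda>g h. g x \<otimes>\<^bsub>K\<^esub> h y) ?t =
        (\<Oplus>\<^bsub>k\<^esub>e\<in>E. tensor_lift K k (\<lambda>g h. g x \<otimes>\<^bsub>K\<^esub> h y) (pure_tensor K D D (g e) (h e)))"
      by (rule module_hom_finsum[OF DD.vectorspace_axioms kV
            tensor_lift_linear[OF DV DV kV bilinear_dual_eval[OF xy]] p])
    also have "\<dots> = (\<Oplus>\<^bsub>k\<^esub>e\<in>E. f ((c e x \<odot>\<^bsub>S\<^esub> r e) \<otimes>\<^bsub>S\<^esub> y))"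
    proof (rule k.M.finsum_cong')
      fix e assume e: "e \<in> E"
      have "tensor_lift K k (\<lambda>g h. g x \<otimes>\<^bsub>K\<^esub> h y) (pure_tensor K D D (g e) (h e)) = g e x \<otimes>\<^bsub>K\<^esub> h e y"
        by (rule tensor_lift_pure[OF DV DV kV bilinear_dual_eval[OF xy] g[OF e] h[OF e]])
      then show "tensor_lift K k (\<lambda>g h. g x \<otimes>\<^bsub>K\<^esub> h y) (pure_tensor K D D (g e) (h e)) =
          f ((c e x \<odot>\<^bsub>S\<^esub> r e) \<otimes>\<^bsub>S\<^esub> y)"
        using e xy c cc by (simp add: g_def h_def module_hom_smult[OF fh] S.smult_mult_left)
    qed (use xy c cc fm in auto)
    also have "\<dots> = f (?s \<otimes>\<^bsub>S\<^esub> y)"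
      by (rule module_hom_finsum[OF SV kV fy m, symmetric])
    also have "\<dots> = f (x \<otimes>\<^bsub>S\<^esub> y)"
    proof -
      have "f (x \<otimes>\<^bsub>S\<^esub> y) \<ominus>\<^bsub>k\<^esub> f (?s \<otimes>\<^bsub>S\<^esub> y) = \<zero>\<^bsub>K\<^esub>"
        using null[OF I.I_r_closed[OF sum[OF xy(1)] xy(2)]] module_hom_minus[OF SV kV fy xy(1) s]
        by simp
      then show ?thesis
        using k.M.minus_other_side[of "f (x \<otimes>\<^bsub>S\<^esub> y)" "f (?s \<otimes>\<^bsub>S\<^esub> y)"] fm xy s by simp
    qed
    finally show "f (x \<otimes>\<^bsub>S\<^esub> y) = tensor_lift K k (\<lambda>g h. g x \<otimes>\<^bsub>K\<^esub> h y) ?t" by simp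
  qed
qed

lemma dual_comult:
  assumes f: "f \<in> carrier (dual_coalgebra K S)"
  shows dual_comult_mem: "comult (dual_coalgebra K S) f
      \<in> carrier (tensor K (dual_coalgebra K S) (dual_coalgebra K S))"
    and dual_comult_eval: "\<lbrakk>x \<in> carrier S; y \<in> carrier S\<rbrakk> \<Longrightarrow>
      tensor_lift K (base_algebra K) (\<lambda>g h. g x \<otimes>\<^bsub>K\<^esub> h y) (comult (dual_coalgebra K S) f) =
      f (x \<otimes>\<^bsub>S\<^esub> y)"
proof -
  let ?P = "\<lambda>t. t \<in> carrier (tensor K D D) \<and> (\<forall>x\<in>carrier S. \<forall>y\<in>carrier S.
      f (x \<otimes>\<^bsub>S\<^esub> y) = tensor_lift K (base_algebra K) (\<lambda>g h. g x \<otimes>\<^bsub>K\<^esub> h y) t)"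
  have "\<exists>!t. ?P t"
  proof (rule ex_ex1I)
    show "\<exists>t. ?P t" using dual_comult_exists[OF f] by blast
    show "s = t" if "?P s" "?P t" for s t
      using that by (intro tensor_dual_eqI) auto
  qed
  from theI'[OF this]
  show "comult D f \<in> carrier (tensor K D D)"
    "\<lbrakk>x \<in> carrier S; y \<in> carrier S\<rbrakk> \<Longrightarrow> tensor_lift K k (\<lambda>g h. g x \<otimes>\<^bsub>K\<^esub> h y) (comult D f) = f (x \<otimes>\<^bsub>S\<^esub> y)"
    unfolding comult_dual_coalgebra[symmetric] by simp_all
qed

lemma dual_comult_eqI:
  assumes f: "f \<in> carrier (dual_coalgebra K S)"
    and t: "t \<in> carrier (tensor K (dual_coalgebra K S) (dual_coalgebra K S))"
    and eq: "\<And>x y. \<lbrakk>x \<in> carrier S; y \<in> carrier S\<rbrakk> \<Longrightarrow>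
      tensor_lift K (base_algebra K) (\<lambda>g h. g x \<otimes>\<^bsub>K\<^esub> h y) t = f (x \<otimes>\<^bsub>S\<^esub> y)"
  shows "comult (dual_coalgebra K S) f = t"
  by (rule tensor_dual_eqI[OF dual_comult_mem[OF f] t]) (simp add: dual_comult_eval[OF f] eq)

end

text \<open>Every axiom is an equation between functionals or tensors of them and is tested by
  evaluation at elements of \<open>S\<close>. Coassociativity then becomes
  \<open>f ((x y) z) = f (x (y z))\<close>, and the counit laws become the unit laws of
  \<open>S\<close>.\<close>

theorem coalgebra_dual_coalgebra:
  fixes K :: "('k, 'm) ring_scheme" and S :: "('k, 's, 'ms) module_scheme"
  assumes S: "assoc_algebra K S" shows "coalgebra K (dual_coalgebra K S)"
proof -
  interpret S: assoc_algebra K S by fact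
  let ?k = "base_algebra K" and ?D = "dual_coalgebra K S"
  let ?DD = "tensor K ?D ?D"
  let ?T = "tensor K ?D ?DD"
  have k: "assoc_algebra K ?k" by (rule assoc_algebra_base_algebra[OF S.field_axioms])
  note kV = assoc_algebra_vectorspace[OF k] and SV = assoc_algebra_vectorspace[OF S]
  note D = vectorspace_dual_coalgebra[OF S]
  note DD = vectorspace_tensor[OF D D]
  note T = vectorspace_tensor[OF D DD]
  interpret k: vectorspace K ?k by (rule kV)
  interpret D: vectorspace K ?D by (rule D)
  interpret DD: vectorspace K ?DD by (rule DD)
  interpret T: vectorspace K ?T by (rule T)
  note eval = dual_coalgebra_eval[OF S] and bil = bilinear_dual_eval[OF S]
  note cm = dual_comult_mem[OF S] and ce = dual_comult_eval[OF S]
  note lift = tensor_lift_linear[OF D D kV bil]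
  define L where "L x y = tensor_lift K ?k (\<lambda>g h. g x \<otimes>\<^bsub>K\<^esub> h y)" for x y :: 's
  have L: "L x y \<in> module_hom K ?DD ?k" if "x \<in> carrier S" "y \<in> carrier S" for x y
    unfolding L_def by (rule lift[OF that])
  have L_comult: "L x y (comult ?D f) = f (x \<otimes>\<^bsub>S\<^esub> y)"
    if "f \<in> carrier ?D" "x \<in> carrier S" "y \<in> carrier S" for f x y
    unfolding L_def by (rule ce[OF that])
  have L_pure: "L x y (pure_tensor K ?D ?D g h) = g x \<otimes>\<^bsub>K\<^esub> h y"
    if "x \<in> carrier S" "y \<in> carrier S" "g \<in> carrier ?D" "h \<in> carrier ?D" for x y g h
    unfolding L_def using tensor_lift_pure[OF D D kV bil that(3,4)] that by simp
  have ev: "f x \<in> carrier K" if "f \<in> carrier ?D" "x \<in> carrier S" for f x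
    using module_hom_mem[OF eval that(1)] that(2) by simp
  have comult_linear: "comult ?D \<in> module_hom K ?D ?DD"
  proof (rule module_homI[OF cm])
    fix f g assume f: "f \<in> carrier ?D" and g: "g \<in> carrier ?D"
    show "comult ?D (f \<oplus>\<^bsub>?D\<^esub> g) = comult ?D f \<oplus>\<^bsub>?DD\<^esub> comult ?D g"
    proof (rule dual_comult_eqI[OF S])
      fix x y assume xy: "x \<in> carrier S" "y \<in> carrier S"
      have "L x y (comult ?D f \<oplus>\<^bsub>?DD\<^esub> comult ?D g) = f (x \<otimes>\<^bsub>S\<^esub> y) \<oplus>\<^bsub>K\<^esub> g (x \<otimes>\<^bsub>S\<^esub> y)"
        by (simp add: module_hom_add[OF L] L_comult f g xy cm del: dual_coalgebra_simps(1))
      then show "tensor_lift K ?k (\<lambda>g h. g x \<otimes>\<^bsub>K\<^esub> h y) (comult ?D f \<oplus>\<^bsub>?DD\<^esub> comult ?D g) =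
          (f \<oplus>\<^bsub>?D\<^esub> g) (x \<otimes>\<^bsub>S\<^esub> y)" using xy by (simp add: L_def)
    qed (intro D.M.a_closed DD.M.a_closed f g cm)+
  next
    fix a f assume a: "a \<in> carrier K" and f: "f \<in> carrier ?D"
    show "comult ?D (a \<odot>\<^bsub>?D\<^esub> f) = a \<odot>\<^bsub>?DD\<^esub> comult ?D f"
    proof (rule dual_comult_eqI[OF S])
      fix x y assume xy: "x \<in> carrier S" "y \<in> carrier S"
      have "L x y (a \<odot>\<^bsub>?DD\<^esub> comult ?D f) = a \<otimes>\<^bsub>K\<^esub> f (x \<otimes>\<^bsub>S\<^esub> y)"
        by (simp add: module_hom_smult[OF L] L_comult f a xy cm del: dual_coalgebra_simps(1))
      then show "tensor_lift K ?k (\<lambda>g h. g x \<otimes>\<^bsub>K\<^esub> h y) (a \<odot>\<^bsub>?DD\<^esub> comult ?D f) =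
          (a \<odot>\<^bsub>?D\<^esub> f) (x \<otimes>\<^bsub>S\<^esub> y)" using xy by (simp add: L_def)
    qed (intro D.smult_closed DD.smult_closed a f cm)+
  qed
  have counit_linear: "counit ?D \<in> module_hom K ?D ?k"
  proof -
    have "counit ?D = (\<lambda>f. f \<one>\<^bsub>S\<^esub>)" by (rule ext) simp
    then show ?thesis using eval[OF S.one_closed] by (simp only:)
  qed
  \<comment> \<open>Evaluation of a triple tensor at \<open>x\<close>, \<open>y\<close> and
    \<open>z\<close>, composed from evaluation at \<open>x\<close> on the left and
    \<open>L y z\<close> on the inner tensor square.\<close>
  define M where "M x y z = tensor_lift K ?k (\<lambda>u s. u x \<otimes>\<^bsub>K\<^esub> L y z s)" for x y z :: 's
  have bM: "bilinear K ?D ?DD ?k (\<lambda>u s. u x \<otimes>\<^bsub>K\<^esub> L y z s)"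
    if "x \<in> carrier S" "y \<in> carrier S" "z \<in> carrier S" for x y z
    using bilinear_mult_pair[OF k eval[OF that(1)] L[OF that(2,3)]] by simp
  have M: "M x y z \<in> module_hom K ?T ?k" if "x \<in> carrier S" "y \<in> carrier S" "z \<in> carrier S" for x y z
    unfolding M_def by (rule tensor_lift_linear[OF D DD kV bM[OF that]])
  have M_pure: "M x y z (pure_tensor K ?D ?DD u s) = u x \<otimes>\<^bsub>K\<^esub> L y z s"
    if "x \<in> carrier S" "y \<in> carrier S" "z \<in> carrier S" "u \<in> carrier ?D" "s \<in> carrier ?DD"
    for x y z u s
    unfolding M_def by (rule tensor_lift_pure[OF D DD kV bM[OF that(1-3)] that(4,5)])
  \<comment> \<open>The evaluations separate triple tensors as well:
    \<open>tensor_separating\<close> is applied a second time, with evaluations on the left factor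
    and the maps \<open>L y z\<close> on the right one, which separate by
    \<open>tensor_dual_null\<close>.\<close>
  have sep: "s = t"
    if st: "s \<in> carrier ?T" "t \<in> carrier ?T"
      and eq: "\<And>x y z. \<lbrakk>x \<in> carrier S; y \<in> carrier S; z \<in> carrier S\<rbrakk> \<Longrightarrow> M x y z s = M x y z t" for s t
  proof -
    have "s \<ominus>\<^bsub>?T\<^esub> t = \<zero>\<^bsub>?T\<^esub>"
    proof (rule tensor_separating[OF D DD])
      let ?E = "(\<lambda>x (f :: 's \<Rightarrow> 'k). f x) ` carrier S" and ?F = "{L y z |y z. y \<in> carrier S \<and> z \<in> carrier S}"
      show "\<phi> \<in> module_hom K ?D ?k" if "\<phi> \<in> ?E" for \<phi> using that eval by auto
      show "\<phi> \<in> module_hom K ?DD ?k" if "\<phi> \<in> ?F" for \<phi> using that L by auto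
      show "v = \<zero>\<^bsub>?D\<^esub>" if "v \<in> carrier ?D" "\<And>\<phi>. \<phi> \<in> ?E \<Longrightarrow> \<phi> v = \<zero>\<^bsub>K\<^esub>" for v
        by (rule dual_coalgebra_eqI[OF S that(1) D.M.zero_closed]) (use that(2) in auto)
      show "w = \<zero>\<^bsub>?DD\<^esub>" if w: "w \<in> carrier ?DD" "\<And>\<phi>. \<phi> \<in> ?F \<Longrightarrow> \<phi> w = \<zero>\<^bsub>K\<^esub>" for w
      proof (rule tensor_dual_null[OF S w(1)])
        fix x y assume "x \<in> carrier S" "y \<in> carrier S"
        then have "L x y w = \<zero>\<^bsub>K\<^esub>" by (intro w(2)) auto
        then show "tensor_lift K ?k (\<lambda>g h. g x \<otimes>\<^bsub>K\<^esub> h y) w = \<zero>\<^bsub>K\<^esub>" by (simp add: L_def)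
      qed
      fix \<phi> \<psi> assume "\<phi> \<in> ?E" "\<psi> \<in> ?F"
      then obtain x y z where x: "x \<in> carrier S" "\<phi> = (\<lambda>f. f x)"
        and yz: "y \<in> carrier S" "z \<in> carrier S" "\<psi> = L y z" by auto
      have "M x y z (s \<ominus>\<^bsub>?T\<^esub> t) = M x y z s \<ominus>\<^bsub>?k\<^esub> M x y z t"
        by (rule module_hom_minus[OF T kV M st]) (use x yz in auto)
      also have "\<dots> = \<zero>\<^bsub>?k\<^esub>"
        using eq[of x y z] module_hom_mem[OF M st(2)] x yz by (simp add: k.M.r_neg[simplified] a_minus_def)
      finally show "tensor_lift K ?k (\<lambda>v w. \<phi> v \<otimes>\<^bsub>K\<^esub> \<psi> w) (s \<ominus>\<^bsub>?T\<^esub> t) = \<zero>\<^bsub>K\<^esub>"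
        by (simp add: M_def x yz)
    qed (use st in auto)
    with st show ?thesis by simp
  qed
  have p1: "bilinear K ?D ?D ?T (\<lambda>u v. pure_tensor K ?D ?DD u (pure_tensor K ?D ?D v y))"
    if "y \<in> carrier ?D" for y
    by (rule bilinear_pair[OF bilinear_pure_tensor[OF D DD] module_hom_id
          bilinear_left[OF bilinear_pure_tensor[OF D D] that]])
  have p2: "(\<lambda>y. pure_tensor K ?D ?DD u (pure_tensor K ?D ?D v y)) \<in> module_hom K ?D ?T"
    if "u \<in> carrier ?D" "v \<in> carrier ?D" for u v
    by (rule module_hom_comp[OF bilinear_right[OF bilinear_pure_tensor[OF D DD] that(1)]
          bilinear_right[OF bilinear_pure_tensor[OF D D] that(2)]])
  have b1: "bilinear K ?D ?D ?T (\<lambda>x y. tensor_lift K ?T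
      (\<lambda>u v. pure_tensor K ?D ?DD u (pure_tensor K ?D ?D v y)) (comult ?D x))"
    by (rule bilinear_tensor_lift_left[OF D D T D comult_linear p1 p2])
  have b2: "bilinear K ?D ?D ?T (\<lambda>x y. pure_tensor K ?D ?DD x (comult ?D y))"
    by (rule bilinear_pair[OF bilinear_pure_tensor[OF D DD] module_hom_id comult_linear])
  have coassoc: "tensor_lift K ?T (\<lambda>x y. tensor_lift K ?T
        (\<lambda>u v. pure_tensor K ?D ?DD u (pure_tensor K ?D ?D v y)) (comult ?D x)) (comult ?D f) =
      tensor_lift K ?T (\<lambda>x y. pure_tensor K ?D ?DD x (comult ?D y)) (comult ?D f)"
    (is "?l = ?r") if f: "f \<in> carrier ?D" for f
  proof (rule sep)
    show "?l \<in> carrier ?T" "?r \<in> carrier ?T"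
      using tensor_lift_mem[OF D D T b1 cm[OF f]] tensor_lift_mem[OF D D T b2 cm[OF f]] by auto
    fix x y z assume x: "x \<in> carrier S" and y: "y \<in> carrier S" and z: "z \<in> carrier S"
    note Mx = M[OF x y z]
    have inner: "M x y z (tensor_lift K ?T (\<lambda>u v. pure_tensor K ?D ?DD u (pure_tensor K ?D ?D v b))
        (comult ?D a)) = a (x \<otimes>\<^bsub>S\<^esub> y) \<otimes>\<^bsub>K\<^esub> b z"
      if a: "a \<in> carrier ?D" and b: "b \<in> carrier ?D" for a b
    proof -
      have bz: "b z \<in> carrier K" by (rule ev[OF b z])
      have bzl: "(\<lambda>c. c \<otimes>\<^bsub>K\<^esub> b z) \<in> module_hom K ?k ?k"
        using assoc_algebra_mult_left[OF k, of "b z"] bz by simp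
      have "M x y z (tensor_lift K ?T (\<lambda>u v. pure_tensor K ?D ?DD u (pure_tensor K ?D ?D v b))
          (comult ?D a)) = tensor_lift K ?k (\<lambda>u v. (u x \<otimes>\<^bsub>K\<^esub> v y) \<otimes>\<^bsub>K\<^esub> b z) (comult ?D a)"
        by (rule tensor_lift_comp_cong[OF D D T kV p1[OF b] Mx cm[OF a]])
          (simp add: M_pure L_pure x y z b ev S.R.m_assoc pure_tensor_mem[OF D D]
            del: dual_coalgebra_simps)
      also have "\<dots> = L x y (comult ?D a) \<otimes>\<^bsub>K\<^esub> b z"
        unfolding L_def
        by (rule tensor_lift_comp[OF D D kV kV bil[OF x y] bzl cm[OF a], symmetric])
      finally show ?thesis by (simp add: L_comult[OF a x y])
    qed
    have "M x y z ?l = tensor_lift K ?k (\<lambda>a b. a (x \<otimes>\<^bsub>S\<^esub> y) \<otimes>\<^bsub>K\<^esub> b z) (comult ?D f)"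
      by (rule tensor_lift_comp_cong[OF D D T kV b1 Mx cm[OF f] inner])
    also have "\<dots> = f (x \<otimes>\<^bsub>S\<^esub> (y \<otimes>\<^bsub>S\<^esub> z))"
      using ce[OF f S.m_closed[OF x y] z] by (simp add: S.m_assoc x y z)
    also have "\<dots> = tensor_lift K ?k (\<lambda>a b. a x \<otimes>\<^bsub>K\<^esub> b (y \<otimes>\<^bsub>S\<^esub> z)) (comult ?D f)"
      by (rule ce[OF f x S.m_closed[OF y z], symmetric])
    also have "\<dots> = tensor_lift K ?k (\<lambda>a b. M x y z (pure_tensor K ?D ?DD a (comult ?D b))) (comult ?D f)"
      by (rule tensor_lift_cong[OF D D kV bil[OF x S.m_closed[OF y z]] cm[OF f]])
        (simp add: M_pure x y z L_comult cm del: dual_coalgebra_simps)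
    also have "\<dots> = M x y z ?r"
      by (rule tensor_lift_comp[OF D D T kV b2 Mx cm[OF f], symmetric])
    finally show "M x y z ?l = M x y z ?r" .
  qed
  have bs: "bilinear K ?D ?D ?D (\<lambda>x y. counit ?D x \<odot>\<^bsub>?D\<^esub> y)"
    by (rule bilinear_pair[OF bilinear_smult[OF D] counit_linear module_hom_id])
  have bs': "bilinear K ?D ?D ?D (\<lambda>x y. counit ?D y \<odot>\<^bsub>?D\<^esub> x)"
    using bs by (simp add: bilinear_def)
  have counit_left: "tensor_lift K ?D (\<lambda>x y. counit ?D x \<odot>\<^bsub>?D\<^esub> y) (comult ?D f) = f"
    if f: "f \<in> carrier ?D" for f
  proof (rule dual_coalgebra_eqI[OF S tensor_lift_mem[OF D D D bs cm[OF f]] f])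
    fix x assume x: "x \<in> carrier S"
    have "tensor_lift K ?D (\<lambda>x y. counit ?D x \<odot>\<^bsub>?D\<^esub> y) (comult ?D f) x = tensor_lift K ?k (\<lambda>g h. g \<one>\<^bsub>S\<^esub> \<otimes>\<^bsub>K\<^esub> h x) (comult ?D f)"
      by (rule tensor_lift_comp_cong[OF D D D kV bs eval[OF x] cm[OF f]]) (simp add: x)
    also have "\<dots> = f x" using ce[OF f S.one_closed x] x by simp
    finally show "tensor_lift K ?D (\<lambda>x y. counit ?D x \<odot>\<^bsub>?D\<^esub> y) (comult ?D f) x = f x" .
  qed
  have counit_right: "tensor_lift K ?D (\<lambda>x y. counit ?D y \<odot>\<^bsub>?D\<^esub> x) (comult ?D f) = f"
    if f: "f \<in> carrier ?D" for f
  proof (rule dual_coalgebra_eqI[OF S tensor_lift_mem[OF D D D bs' cm[OF f]] f])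
    fix x assume x: "x \<in> carrier S"
    have "tensor_lift K ?D (\<lambda>x y. counit ?D y \<odot>\<^bsub>?D\<^esub> x) (comult ?D f) x = tensor_lift K ?k (\<lambda>g h. g x \<otimes>\<^bsub>K\<^esub> h \<one>\<^bsub>S\<^esub>) (comult ?D f)"
      by (rule tensor_lift_comp_cong[OF D D D kV bs' eval[OF x] cm[OF f]])
        (simp add: x ev S.m_comm del: dual_coalgebra_simps(1))
    also have "\<dots> = f x" using ce[OF f x S.one_closed] x by simp
    finally show "tensor_lift K ?D (\<lambda>x y. counit ?D y \<odot>\<^bsub>?D\<^esub> x) (comult ?D f) x = f x" .
  qed
  show ?thesis
    unfolding coalgebra_def coalgebra_axioms_def
    using D comult_linear counit_linear coassoc counit_left counit_right by blast
qed

section \<open>Measurings\<close>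

lemma measuring_linear: "measuring K H A B \<rho> \<Longrightarrow> \<rho> \<in> module_hom K H (hom_space K A B)"
  by (simp add: measuring_def)

lemma measuring_hom: "\<lbrakk>measuring K H A B \<rho>; h \<in> carrier H\<rbrakk> \<Longrightarrow> \<rho> h \<in> module_hom K A B"
  and measuring_ext: "\<lbrakk>measuring K H A B \<rho>; h \<in> carrier H\<rbrakk> \<Longrightarrow> \<rho> h \<in> extensional (carrier A)"
  using module_hom_mem[OF measuring_linear] by fastforce+

lemma measuring_apply:
  "\<lbrakk>measuring K H A B \<rho>; a \<in> carrier A\<rbrakk> \<Longrightarrow> (\<lambda>h. \<rho> h a) \<in> module_hom K H B"
  by (rule module_hom_comp[OF eval_linear measuring_linear])

lemma measuring_mult:
  "\<lbrakk>measuring K H A B \<rho>; h \<in> carrier H; a \<in> carrier A; a' \<in> carrier A\<rbrakk> \<Longrightarrow>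
    \<rho> h (a \<otimes>\<^bsub>A\<^esub> a') = tensor_lift K B (\<lambda>x y. \<rho> x a \<otimes>\<^bsub>B\<^esub> \<rho> y a') (comult H h)"
  and measuring_one:
  "\<lbrakk>measuring K H A B \<rho>; h \<in> carrier H\<rbrakk> \<Longrightarrow> \<rho> h \<one>\<^bsub>A\<^esub> = counit H h \<odot>\<^bsub>B\<^esub> \<one>\<^bsub>B\<^esub>"
  by (simp_all add: measuring_def)

lemma measuring_mem:
  "\<lbrakk>measuring K H A B \<rho>; h \<in> carrier H; a \<in> carrier A\<rbrakk> \<Longrightarrow> \<rho> h a \<in> carrier B"
  using module_hom_mem[OF measuring_hom] .

lemma bilinear_measuring:
  assumes "assoc_algebra K B" "measuring K H A B \<rho>" "a \<in> carrier A" "a' \<in> carrier A"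
  shows "bilinear K H H B (\<lambda>x y. \<rho> x a \<otimes>\<^bsub>B\<^esub> \<rho> y a')"
  by (rule bilinear_mult_pair[OF assms(1) measuring_apply[OF assms(2,3)] measuring_apply[OF assms(2,4)]])

lemma coalgebra_hom_linear: "f \<in> coalgebra_hom K C D \<Longrightarrow> f \<in> module_hom K C D"
  and coalgebra_hom_comult: "\<lbrakk>f \<in> coalgebra_hom K C D; c \<in> carrier C\<rbrakk> \<Longrightarrow>
    comult D (f c) = tensor_lift K (tensor K D D) (\<lambda>x y. pure_tensor K D D (f x) (f y)) (comult C c)"
  and coalgebra_hom_counit:
    "\<lbrakk>f \<in> coalgebra_hom K C D; c \<in> carrier C\<rbrakk> \<Longrightarrow> counit D (f c) = counit C c"
  by (simp_all add: coalgebra_hom_def)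

lemma bilinear_pure_pair:
  assumes "vectorspace K D" "f \<in> module_hom K C D"
  shows "bilinear K C C (tensor K D D) (\<lambda>x y. pure_tensor K D D (f x) (f y))"
  by (rule bilinear_pair[OF bilinear_pure_tensor[OF assms(1,1)] assms(2,2)])

text \<open>Compatibility with the comultiplications as a substitution rule: inside a Sweedler sum,
  the components of \<open>f c\<close> may be replaced by the images of the components of
  \<open>c\<close>.\<close>

lemma tensor_lift_coalgebra_hom:
  assumes C: "coalgebra K C" and D: "coalgebra K D" and U: "vectorspace K U"
    and f: "f \<in> coalgebra_hom K C D" and c: "c \<in> carrier C" and \<beta>: "bilinear K D D U \<beta>"
  shows "tensor_lift K U \<beta> (comult D (f c)) = tensor_lift K U (\<lambda>x y. \<beta> (f x) (f y)) (comult C c)"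
proof -
  interpret C: coalgebra K C by fact
  interpret D: coalgebra K D by fact
  note CV = C.vectorspace_axioms and DV = D.vectorspace_axioms
  note DD = vectorspace_tensor[OF DV DV]
  note bp = bilinear_pure_pair[OF DV coalgebra_hom_linear[OF f]]
    and lift = tensor_lift_linear[OF DV DV U \<beta>]
  have "tensor_lift K U \<beta> (comult D (f c)) = tensor_lift K U (\<lambda>x y. \<beta> (f x) (f y)) (comult C c)"
    unfolding coalgebra_hom_comult[OF f c]
    by (rule tensor_lift_comp_cong[OF CV CV DD U bp lift C.comult_mem[OF c]])
      (simp add: tensor_lift_pure[OF DV DV U \<beta>] module_hom_mem[OF coalgebra_hom_linear[OF f]])
  then show ?thesis .
qed

text \<open>Composed with the evaluation measuring, this turns a coalgebra map into the dual
  coalgebra back into a measuring, so that uniqueness of such maps reduces to uniqueness of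
  measurings.\<close>

lemma measuring_comp:
  assumes H: "coalgebra K H" and P: "coalgebra K P" and B: "assoc_algebra K B"
    and f: "f \<in> coalgebra_hom K H P" and \<pi>: "measuring K P A B \<pi>"
  shows "measuring K H A B (\<lambda>h. \<pi> (f h))"
  unfolding measuring_def
proof (intro conjI ballI)
  note fl = coalgebra_hom_linear[OF f]
  show "(\<lambda>h. \<pi> (f h)) \<in> module_hom K H (hom_space K A B)"
    by (rule module_hom_comp[OF measuring_linear[OF \<pi>] fl])
  fix h assume h: "h \<in> carrier H"
  have fh: "f h \<in> carrier P" by (rule module_hom_mem[OF fl h])
  show "\<pi> (f h) \<one>\<^bsub>A\<^esub> = counit H h \<odot>\<^bsub>B\<^esub> \<one>\<^bsub>B\<^esub>"
    by (simp add: measuring_one[OF \<pi> fh] coalgebra_hom_counit[OF f h])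
  fix a a' assume aa: "a \<in> carrier A" "a' \<in> carrier A"
  show "\<pi> (f h) (a \<otimes>\<^bsub>A\<^esub> a') =
      tensor_lift K B (\<lambda>x y. \<pi> (f x) a \<otimes>\<^bsub>B\<^esub> \<pi> (f y) a') (comult H h)"
    unfolding measuring_mult[OF \<pi> fh aa]
    by (rule tensor_lift_coalgebra_hom[OF H P assoc_algebra_vectorspace[OF B] f h
          bilinear_measuring[OF B \<pi> aa]])
qed

lemma coalgebra_hom_comp:
  assumes C: "coalgebra K C" and D: "coalgebra K D" and E: "coalgebra K E"
    and f: "f \<in> coalgebra_hom K C D" and g: "g \<in> coalgebra_hom K D E"
  shows "(\<lambda>x. g (f x)) \<in> coalgebra_hom K C E"
  unfolding coalgebra_hom_def
proof (intro CollectI conjI ballI)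
  interpret E: coalgebra K E by fact
  note EV = E.vectorspace_axioms
  note fl = coalgebra_hom_linear[OF f] and gl = coalgebra_hom_linear[OF g]
  show "(\<lambda>x. g (f x)) \<in> module_hom K C E" by (rule module_hom_comp[OF gl fl])
  fix c assume c: "c \<in> carrier C"
  have fc: "f c \<in> carrier D" by (rule module_hom_mem[OF fl c])
  show "counit E (g (f c)) = counit C c"
    by (simp add: coalgebra_hom_counit[OF g fc] coalgebra_hom_counit[OF f c])
  show "comult E (g (f c)) = tensor_lift K (tensor K E E)
      (\<lambda>x y. pure_tensor K E E (g (f x)) (g (f y))) (comult C c)"
    unfolding coalgebra_hom_comult[OF g fc]
    by (rule tensor_lift_coalgebra_hom[OF C D vectorspace_tensor[OF EV EV] f c
          bilinear_pure_pair[OF EV gl]])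
qed

lemma coalgebra_hom_id:
  assumes "coalgebra K C" shows "(\<lambda>x. x) \<in> coalgebra_hom K C C"
proof -
  interpret coalgebra K C by fact
  show ?thesis
    using tensor_lift_pure_tensor[OF vectorspace_axioms vectorspace_axioms comult_mem]
    by (auto simp: coalgebra_hom_def module_hom_id)
qed

text \<open>The universal property asks for extensional maps. Restricting changes nothing in the
  comultiplication condition, since a bilinear form is only consulted on the carriers.\<close>

lemma coalgebra_hom_restrict:
  assumes C: "coalgebra K C" and D: "coalgebra K D" and f: "f \<in> coalgebra_hom K C D"
  shows "restrict f (carrier C) \<in> coalgebra_hom K C D"
proof -
  interpret C: coalgebra K C by fact
  interpret D: coalgebra K D by fact
  note CV = C.vectorspace_axioms and DV = D.vectorspace_axioms
  have "tensor_lift K (tensor K D D) (\<lambda>x y. pure_tensor K D D (f x) (f y)) (comult C c) =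
      tensor_lift K (tensor K D D) (\<lambda>x y. pure_tensor K D D (restrict f (carrier C) x)
        (restrict f (carrier C) y)) (comult C c)" if "c \<in> carrier C" for c
    by (rule tensor_lift_cong[OF CV CV vectorspace_tensor[OF DV DV]
          bilinear_pure_pair[OF DV coalgebra_hom_linear[OF f]] C.comult_mem[OF that]]) simp
  then show ?thesis
    using f by (auto simp: coalgebra_hom_def module_hom_restrict[OF _ CV])
qed

section \<open>Uniqueness of universal measuring coalgebras\<close>

text \<open>Frees the uniqueness clause from extensionality, so that it applies directly to
  composites and to the identity; the conclusion then holds on the carrier only.\<close>

lemma universal_measuring_unique:
  fixes H :: "('k, 'h) coalgebra"
  assumes P: "universal_measuring_coalgebra TYPE('h) K A B P \<pi>" and H: "coalgebra K H"
    and \<rho>: "measuring K H A B \<rho>"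
    and \<phi>: "\<phi> \<in> coalgebra_hom K H P" and \<psi>: "\<psi> \<in> coalgebra_hom K H P"
    and eq: "\<And>h. h \<in> carrier H \<Longrightarrow> \<pi> (\<phi> h) = \<rho> h \<and> \<pi> (\<psi> h) = \<rho> h"
    and h: "h \<in> carrier H"
  shows "\<phi> h = \<psi> h"
proof -
  have cP: "coalgebra K P" using P by (simp add: universal_measuring_coalgebra_def)
  have "\<exists>!\<phi>. \<phi> \<in> coalgebra_hom K H P \<inter> extensional (carrier H) \<and> (\<forall>h\<in>carrier H. \<pi> (\<phi> h) = \<rho> h)"
    using P H \<rho> unfolding universal_measuring_coalgebra_def by blast
  then have uniq: "\<phi> = \<psi>"
    if "\<phi> \<in> coalgebra_hom K H P \<inter> extensional (carrier H) \<and> (\<forall>h\<in>carrier H. \<pi> (\<phi> h) = \<rho> h)"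
      "\<psi> \<in> coalgebra_hom K H P \<inter> extensional (carrier H) \<and> (\<forall>h\<in>carrier H. \<pi> (\<psi> h) = \<rho> h)"
    for \<phi> \<psi> using that by blast
  have "restrict \<phi> (carrier H) = restrict \<psi> (carrier H)"
    by (rule uniq) (use coalgebra_hom_restrict[OF H cP] \<phi> \<psi> eq in auto)
  from fun_cong[OF this, of h] h show ?thesis by simp
qed

text \<open>The usual argument, with attention to types. A map out of \<open>P\<close> is governed
  by the universal properties for the type \<open>'p\<close>, a map out of \<open>Q\<close> by those
  for \<open>'q\<close>: the former give \<open>f\<close> and \<open>g \<circ> f = id\<close>, the
  latter \<open>g\<close> and \<open>f \<circ> g = id\<close>. Hence each object is needed at both
  types.\<close>

lemma universal_measuring_isomorphic:
  fixes P :: "('k, 'p) coalgebra" and Q :: "('k, 'q) coalgebra"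
  assumes B: "assoc_algebra K B"
    and P: "universal_measuring_coalgebra TYPE('p) K A B P \<pi>"
      "universal_measuring_coalgebra TYPE('q) K A B P \<pi>"
    and Q: "universal_measuring_coalgebra TYPE('p) K A B Q \<kappa>"
      "universal_measuring_coalgebra TYPE('q) K A B Q \<kappa>"
  shows "coalgebra_isomorphic K P Q"
proof -
  have cP: "coalgebra K P" and mP: "measuring K P A B \<pi>"
    and cQ: "coalgebra K Q" and mQ: "measuring K Q A B \<kappa>"
    using P(1) Q(1) by (auto simp: universal_measuring_coalgebra_def)
  obtain f where f: "f \<in> coalgebra_hom K P Q" "\<And>h. h \<in> carrier P \<Longrightarrow> \<kappa> (f h) = \<pi> h"
    using Q(1) cP mP unfolding universal_measuring_coalgebra_def by blast
  obtain g where g: "g \<in> coalgebra_hom K Q P" "\<And>h. h \<in> carrier Q \<Longrightarrow> \<pi> (g h) = \<kappa> h"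
    using P(2) cQ mQ unfolding universal_measuring_coalgebra_def by blast
  note fm = module_hom_mem[OF coalgebra_hom_linear[OF f(1)]]
    and gm = module_hom_mem[OF coalgebra_hom_linear[OF g(1)]]
  have gf: "g (f h) = h" if "h \<in> carrier P" for h
    by (rule universal_measuring_unique[OF P(1) cP _ coalgebra_hom_comp[OF cP cQ cP f(1) g(1)]
          coalgebra_hom_id[OF cP] _ that]) (use mP f g fm in auto)
  have fg: "f (g h) = h" if "h \<in> carrier Q" for h
    by (rule universal_measuring_unique[OF Q(2) cQ _ coalgebra_hom_comp[OF cQ cP cQ g(1) f(1)]
          coalgebra_hom_id[OF cQ] _ that]) (use mQ f g gm in auto)
  have "bij_betw f (carrier P) (carrier Q)"
    by (rule bij_betw_byWitness[of _ g]) (use gf fg fm gm in auto)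
  with f(1) show ?thesis unfolding coalgebra_isomorphic_def by blast
qed

text \<open>
  If \<open>\<kappa> h (x y z)\<close> is a finite sum of terms \<open>a\<^sub>i x \<cdot> b\<^sub>i y \<cdot> c\<^sub>i z\<close>, then \<open>\<kappa> h\<close> vanishes on the ideal of
  those \<open>y\<close> with \<open>\<kappa> h (x y z) = 0\<close> for all \<open>x\<close> and \<open>z\<close>, which contains the common kernel of the \<open>b\<^sub>i\<close>.
\<close>

lemma measuring_mem_dual:
  assumes H: "coalgebra K H" and S: "assoc_algebra K S"
    and \<kappa>: "measuring K H S (base_algebra K) \<kappa>" and h: "h \<in> carrier H"
  shows "\<kappa> h \<in> carrier (dual_coalgebra K S)"
proof -
  interpret H: coalgebra K H by fact
  interpret S: assoc_algebra K S by fact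
  let ?k = "base_algebra K"
  have k: "assoc_algebra K ?k" by (rule assoc_algebra_base_algebra[OF H.field_axioms])
  note HV = H.vectorspace_axioms and kV = assoc_algebra_vectorspace[OF k]
  interpret k: vectorspace K ?k by (rule kV)
  note bil = bilinear_measuring[OF k \<kappa>]
  have mem: "\<kappa> u a \<in> carrier K" if "u \<in> carrier H" "a \<in> carrier S" for u a
    using measuring_mem[OF \<kappa> that] by simp
  \<comment> \<open>\<open>Y\<close> collects the right factors of \<open>comult H h\<close>, and
    below \<open>U y\<close> collects the left factors of \<open>comult H y\<close>. The functionals
    \<open>\<kappa> u\<close> for \<open>u\<close> in some \<open>U y\<close> are thus the ones
    acting on the middle argument.\<close>
  obtain Y where Y: "finite Y" "Y \<subseteq> carrier H" "\<forall>\<beta>. bilinear K H H ?k \<beta> \<longrightarrow>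
      (\<forall>v\<in>carrier H. \<forall>w\<in>Y. \<beta> v w = \<zero>\<^bsub>?k\<^esub>) \<longrightarrow> tensor_lift K ?k \<beta> (comult H h) = \<zero>\<^bsub>?k\<^esub>"
    using tensor_lift_finite_right[OF HV HV H.comult_mem[OF h] kV] by (elim exE conjE) (rule that)
  have "\<forall>y\<in>Y. \<exists>S. finite S \<and> S \<subseteq> carrier H \<and> (\<forall>\<beta>. bilinear K H H ?k \<beta> \<longrightarrow>
      (\<forall>v\<in>S. \<forall>w\<in>carrier H. \<beta> v w = \<zero>\<^bsub>?k\<^esub>) \<longrightarrow> tensor_lift K ?k \<beta> (comult H y) = \<zero>\<^bsub>?k\<^esub>)"
    using tensor_lift_finite_left[OF HV HV H.comult_mem kV] Y(2) by (intro ballI) (drule (1) subsetD)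
  from bchoice[OF this] obtain U where "\<forall>y\<in>Y. finite (U y) \<and> U y \<subseteq> carrier H \<and>
      (\<forall>\<beta>. bilinear K H H ?k \<beta> \<longrightarrow> (\<forall>v\<in>U y. \<forall>w\<in>carrier H. \<beta> v w = \<zero>\<^bsub>?k\<^esub>) \<longrightarrow>
        tensor_lift K ?k \<beta> (comult H y) = \<zero>\<^bsub>?k\<^esub>)" ..
  then have U: "finite (U y)" "U y \<subseteq> carrier H" "\<And>\<beta>. \<lbrakk>bilinear K H H ?k \<beta>;
      \<And>v w. \<lbrakk>v \<in> U y; w \<in> carrier H\<rbrakk> \<Longrightarrow> \<beta> v w = \<zero>\<^bsub>?k\<^esub>\<rbrakk> \<Longrightarrow>
        tensor_lift K ?k \<beta> (comult H y) = \<zero>\<^bsub>?k\<^esub>" if "y \<in> Y" for y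
    using that by blast+
  let ?\<Phi> = "\<kappa> ` (\<Union>y\<in>Y. U y)"
  have null: "\<kappa> h (x \<otimes>\<^bsub>S\<^esub> (y \<otimes>\<^bsub>S\<^esub> z)) = \<zero>\<^bsub>K\<^esub>"
    if y: "y \<in> carrier S" and 0: "\<forall>\<phi>\<in>?\<Phi>. \<phi> y = \<zero>\<^bsub>K\<^esub>" and x: "x \<in> carrier S" and z: "z \<in> carrier S"
    for x y z
  proof -
    have "\<kappa> b (y \<otimes>\<^bsub>S\<^esub> z) = \<zero>\<^bsub>K\<^esub>" if b: "b \<in> Y" for b
    proof -
      have bH: "b \<in> carrier H" using b Y(2) by blast
      have "\<kappa> v y \<otimes>\<^bsub>?k\<^esub> \<kappa> w z = \<zero>\<^bsub>?k\<^esub>" if v: "v \<in> U b" "w \<in> carrier H" for v w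
      proof -
        have "\<kappa> v y = \<zero>\<^bsub>K\<^esub>" using 0 v b by blast
        then show ?thesis using mem[OF v(2) z] by simp
      qed
      then have "tensor_lift K ?k (\<lambda>v w. \<kappa> v y \<otimes>\<^bsub>?k\<^esub> \<kappa> w z) (comult H b) = \<zero>\<^bsub>?k\<^esub>"
        by (intro U(3)[OF b] bil y z)
      then show ?thesis using measuring_mult[OF \<kappa> bH y z] by simp
    qed
    then have "\<forall>v\<in>carrier H. \<forall>w\<in>Y. \<kappa> v x \<otimes>\<^bsub>?k\<^esub> \<kappa> w (y \<otimes>\<^bsub>S\<^esub> z) = \<zero>\<^bsub>?k\<^esub>"
      using mem[OF _ x] by simp
    then have "tensor_lift K ?k (\<lambda>v w. \<kappa> v x \<otimes>\<^bsub>?k\<^esub> \<kappa> w (y \<otimes>\<^bsub>S\<^esub> z)) (comult H h) = \<zero>\<^bsub>?k\<^esub>"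
      using Y(3)[rule_format, OF bil[OF x S.m_closed[OF y z]]] by blast
    then show ?thesis using measuring_mult[OF \<kappa> h x S.m_closed[OF y z]] by simp
  qed
  have "finite ?\<Phi>" using Y(1) U(1) by blast
  moreover have "?\<Phi> \<subseteq> module_hom K S ?k" using U(2) measuring_hom[OF \<kappa>] by blast
  moreover have "\<forall>y\<in>carrier S. (\<forall>\<phi>\<in>?\<Phi>. \<phi> y = \<zero>\<^bsub>K\<^esub>) \<longrightarrow>
      (\<forall>x\<in>carrier S. \<forall>z\<in>carrier S. \<kappa> h (x \<otimes>\<^bsub>S\<^esub> (y \<otimes>\<^bsub>S\<^esub> z)) = \<zero>\<^bsub>K\<^esub>)"
    by (intro ballI impI) (rule null)
  ultimately show ?thesis
    using dual_coalgebra_criterion[OF S measuring_hom[OF \<kappa> h] measuring_ext[OF \<kappa> h]] by blast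
qed

text \<open>The comultiplication of the dual is determined by the values at products, and for these
  the compatibility required of a coalgebra map is exactly the multiplicativity of the measuring.
  Likewise the counit condition is the value at the unit.\<close>

lemma measuring_dual_hom:
  assumes H: "coalgebra K H" and S: "assoc_algebra K S"
    and \<kappa>: "measuring K H S (base_algebra K) \<kappa>"
  shows "\<kappa> \<in> coalgebra_hom K H (dual_coalgebra K S)"
  unfolding coalgebra_hom_def
proof (intro CollectI conjI ballI)
  interpret H: coalgebra K H by fact
  interpret S: assoc_algebra K S by fact
  let ?k = "base_algebra K" and ?D = "dual_coalgebra K S"
  let ?DD = "tensor K ?D ?D"
  have k: "assoc_algebra K ?k" by (rule assoc_algebra_base_algebra[OF H.field_axioms])
  note HV = H.vectorspace_axioms and kV = assoc_algebra_vectorspace[OF k]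
  note D = vectorspace_dual_coalgebra[OF S]
  note DD = vectorspace_tensor[OF D D]
  note mem = measuring_mem_dual[OF H S \<kappa>]
  show lin: "\<kappa> \<in> module_hom K H ?D"
  proof (rule module_homI[OF mem])
    show "\<kappa> (x \<oplus>\<^bsub>H\<^esub> y) = \<kappa> x \<oplus>\<^bsub>?D\<^esub> \<kappa> y" if "x \<in> carrier H" "y \<in> carrier H" for x y
      using module_hom_add[OF measuring_linear[OF \<kappa>] that] by simp
    show "\<kappa> (a \<odot>\<^bsub>H\<^esub> x) = a \<odot>\<^bsub>?D\<^esub> \<kappa> x" if "a \<in> carrier K" "x \<in> carrier H" for a x
      using module_hom_smult[OF measuring_linear[OF \<kappa>] that] by simp
  qed
  note bp = bilinear_pure_pair[OF D lin]
  fix h assume h: "h \<in> carrier H"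
  have "counit H h \<in> carrier K" using module_hom_mem[OF H.counit_linear h] by simp
  then show "counit ?D (\<kappa> h) = counit H h" using measuring_one[OF \<kappa> h] by simp
  show "comult ?D (\<kappa> h) =
      tensor_lift K ?DD (\<lambda>x y. pure_tensor K ?D ?D (\<kappa> x) (\<kappa> y)) (comult H h)"
  proof (rule dual_comult_eqI[OF S mem[OF h] tensor_lift_mem[OF HV HV DD bp H.comult_mem[OF h]]])
    fix x y assume xy: "x \<in> carrier S" "y \<in> carrier S"
    note lift = tensor_lift_linear[OF D D kV bilinear_dual_eval[OF S xy]]
    have "tensor_lift K ?k (\<lambda>g h. g x \<otimes>\<^bsub>K\<^esub> h y)
        (tensor_lift K ?DD (\<lambda>x y. pure_tensor K ?D ?D (\<kappa> x) (\<kappa> y)) (comult H h)) = tensor_lift K ?k (\<lambda>u v. \<kappa> u x \<otimes>\<^bsub>K\<^esub> \<kappa> v y) (comult H h)"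
      by (rule tensor_lift_comp_cong[OF HV HV DD kV bp lift H.comult_mem[OF h]])
        (rule tensor_lift_pure[OF D D kV bilinear_dual_eval[OF S xy] mem mem])
    also have "\<dots> = \<kappa> h (x \<otimes>\<^bsub>S\<^esub> y)" using measuring_mult[OF \<kappa> h xy] by simp
    finally show "tensor_lift K ?k (\<lambda>g h. g x \<otimes>\<^bsub>K\<^esub> h y)
        (tensor_lift K ?DD (\<lambda>x y. pure_tensor K ?D ?D (\<kappa> x) (\<kappa> y)) (comult H h)) =
      \<kappa> h (x \<otimes>\<^bsub>S\<^esub> y)" .
  qed
qed

lemma measuring_dual_eval:
  assumes S: "assoc_algebra K S"
  shows "measuring K (dual_coalgebra K S) S (base_algebra K) (\<lambda>f. f)"
  unfolding measuring_def
proof (intro conjI ballI)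
  interpret S: assoc_algebra K S by fact
  show "(\<lambda>f. f) \<in> module_hom K (dual_coalgebra K S) (hom_space K S (base_algebra K))"
    by (rule module_homI) auto
  fix f assume f: "f \<in> carrier (dual_coalgebra K S)"
  show "f \<one>\<^bsub>S\<^esub> = counit (dual_coalgebra K S) f \<odot>\<^bsub>base_algebra K\<^esub> \<one>\<^bsub>base_algebra K\<^esub>"
    using module_hom_mem[OF dual_coalgebra_hom[OF S f] S.one_closed] by simp
  fix x y assume "x \<in> carrier S" "y \<in> carrier S"
  then show "f (x \<otimes>\<^bsub>S\<^esub> y) = tensor_lift K (base_algebra K)
      (\<lambda>g h. g x \<otimes>\<^bsub>base_algebra K\<^esub> h y) (comult (dual_coalgebra K S) f)"
    using dual_comult_eval[OF S f] by simp
qed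

text \<open>The universal measuring is the identity, because elements of the dual are functionals
  already. The factorisation of \<open>\<rho>\<close> is therefore \<open>\<rho>\<close> itself,
  restricted to the carrier; what has to be known is that it lands in the dual and is a coalgebra
  map. The type \<open>'h\<close> is arbitrary.\<close>

lemma universal_measuring_dual:
  assumes S: "assoc_algebra K S"
  shows "universal_measuring_coalgebra TYPE('h) K S (base_algebra K) (dual_coalgebra K S) (\<lambda>f. f)"
  unfolding universal_measuring_coalgebra_def
proof (intro conjI allI impI)
  note D = coalgebra_dual_coalgebra[OF S]
  show "coalgebra K (dual_coalgebra K S)" by (rule D)
  show "measuring K (dual_coalgebra K S) S (base_algebra K) (\<lambda>f. f)" by (rule measuring_dual_eval[OF S])
  fix H :: "('a, 'h) coalgebra" and \<rho>
  assume H: "coalgebra K H \<and> measuring K H S (base_algebra K) \<rho>"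
  show "\<exists>!\<phi>. \<phi> \<in> coalgebra_hom K H (dual_coalgebra K S) \<inter> extensional (carrier H) \<and>
      (\<forall>h\<in>carrier H. \<phi> h = \<rho> h)"
  proof (rule ex1I)
    show "restrict \<rho> (carrier H) \<in> coalgebra_hom K H (dual_coalgebra K S) \<inter> extensional (carrier H) \<and>
        (\<forall>h\<in>carrier H. restrict \<rho> (carrier H) h = \<rho> h)"
      using H coalgebra_hom_restrict[OF _ D measuring_dual_hom[OF _ S]] by auto
  qed (auto intro: extensionalityI)
qed

section \<open>Algebra homomorphisms and quotient algebras\<close>

definition algebra_hom ::
  "('k, 'm) ring_scheme \<Rightarrow> ('k, 'a, 'ma) module_scheme \<Rightarrow> ('k, 'b, 'mb) module_scheme \<Rightarrow> ('a \<Rightarrow> 'b) set" where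
  "algebra_hom K A B = {f \<in> module_hom K A B.
    (\<forall>x\<in>carrier A. \<forall>y\<in>carrier A. f (x \<otimes>\<^bsub>A\<^esub> y) = f x \<otimes>\<^bsub>B\<^esub> f y) \<and> f \<one>\<^bsub>A\<^esub> = \<one>\<^bsub>B\<^esub>}"

lemma algebra_hom_linear: "f \<in> algebra_hom K A B \<Longrightarrow> f \<in> module_hom K A B"
  and algebra_hom_mult:
    "\<lbrakk>f \<in> algebra_hom K A B; x \<in> carrier A; y \<in> carrier A\<rbrakk> \<Longrightarrow> f (x \<otimes>\<^bsub>A\<^esub> y) = f x \<otimes>\<^bsub>B\<^esub> f y"
  and algebra_hom_one: "f \<in> algebra_hom K A B \<Longrightarrow> f \<one>\<^bsub>A\<^esub> = \<one>\<^bsub>B\<^esub>"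
  by (simp_all add: algebra_hom_def)

text \<open>The kernel of an algebra homomorphism is an ideal, so it absorbs the ideal generated by
  any relations that it contains. Both the tensor algebra and the Sweedler product get their
  universal properties this way.\<close>

lemma algebra_hom_kernel_genideal:
  assumes A: "assoc_algebra K A" and B: "assoc_algebra K B" and f: "f \<in> algebra_hom K A B"
    and R: "R \<subseteq> carrier A" and null: "\<And>x. x \<in> R \<Longrightarrow> f x = \<zero>\<^bsub>B\<^esub>"
    and x: "x \<in> Idl\<^bsub>A\<^esub> R"
  shows "f x = \<zero>\<^bsub>B\<^esub>"
proof -
  interpret A: assoc_algebra K A by fact
  interpret B: assoc_algebra K B by fact
  note AV = assoc_algebra_vectorspace[OF A] and BV = assoc_algebra_vectorspace[OF B]
  note fl = algebra_hom_linear[OF f]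
  let ?I = "{x \<in> carrier A. f x = \<zero>\<^bsub>B\<^esub>}"
  interpret I: abelian_subgroup ?I A
    by (rule submodule_abelian_subgroup[OF AV submodule_kernel[OF AV BV fl]])
  have "ideal ?I A"
  proof (rule idealI[OF A.ring_axioms I.a_subgroup])
    fix a x assume a: "a \<in> ?I" and x: "x \<in> carrier A"
    have a': "a \<in> carrier A" and fa: "f a = \<zero>\<^bsub>B\<^esub>" using a by blast+
    have "f (x \<otimes>\<^bsub>A\<^esub> a) = \<zero>\<^bsub>B\<^esub>" "f (a \<otimes>\<^bsub>A\<^esub> x) = \<zero>\<^bsub>B\<^esub>"
      unfolding algebra_hom_mult[OF f x a'] algebra_hom_mult[OF f a' x] fa
      by (rule B.r_null[OF module_hom_mem[OF fl x]], rule B.l_null[OF module_hom_mem[OF fl x]])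
    then show "x \<otimes>\<^bsub>A\<^esub> a \<in> ?I" "a \<otimes>\<^bsub>A\<^esub> x \<in> ?I"
      using A.m_closed[OF x a'] A.m_closed[OF a' x] by blast+
  qed
  moreover have "R \<subseteq> ?I" using R null by blast
  ultimately have "Idl\<^bsub>A\<^esub> R \<subseteq> ?I" by (rule A.genideal_minimal)
  with x show ?thesis by blast
qed

context
  fixes K :: "('k, 'm) ring_scheme" and A :: "('k, 'a, 'ma) module_scheme" and I :: "'a set"
  assumes A: "assoc_algebra K A" and I: "ideal I A"
begin

interpretation A: assoc_algebra K A by (rule A)
interpretation I: ideal I A by (rule I)

private lemma AV: "vectorspace K A" by (rule assoc_algebra_vectorspace[OF A])
private lemma sub: "submodule K I A" by (rule ideal_submodule[OF A I])

lemma quotient_module_mult: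
  "\<lbrakk>x \<in> carrier A; y \<in> carrier A\<rbrakk> \<Longrightarrow>
    (I +>\<^bsub>A\<^esub> x) \<otimes>\<^bsub>quotient_module A I\<^esub> (I +>\<^bsub>A\<^esub> y) = I +>\<^bsub>A\<^esub> (x \<otimes>\<^bsub>A\<^esub> y)"
  by (simp add: quotient_module_def FactRing_def I.rcoset_mult_add)

lemma quotient_module_one: "\<one>\<^bsub>quotient_module A I\<^esub> = I +>\<^bsub>A\<^esub> \<one>\<^bsub>A\<^esub>"
  by (simp add: quotient_module_def FactRing_def)

lemma assoc_algebra_quotient_module: "assoc_algebra K (quotient_module A I)"
proof (rule assoc_algebraI[OF vectorspace_quotient_module[OF AV sub]])
  note carrier = carrier_quotient_module[OF AV sub]
  note simps = quotient_module_mult quotient_module_one quotient_module_add[OF AV sub]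
    quotient_module_smult[OF AV sub] quotient_module_mem[OF AV sub]
    A.l_distr A.r_distr A.smult_mult_left A.smult_mult_right A.m_assoc
  let ?Q = "quotient_module A I"
  show "x \<otimes>\<^bsub>?Q\<^esub> y \<in> carrier ?Q" if "x \<in> carrier ?Q" "y \<in> carrier ?Q" for x y
    using that unfolding carrier by (auto simp: simps)
  show "\<one>\<^bsub>?Q\<^esub> \<in> carrier ?Q" unfolding carrier by (auto simp: simps)
  show "(x \<otimes>\<^bsub>?Q\<^esub> y) \<otimes>\<^bsub>?Q\<^esub> z = x \<otimes>\<^bsub>?Q\<^esub> (y \<otimes>\<^bsub>?Q\<^esub> z)"
    if "x \<in> carrier ?Q" "y \<in> carrier ?Q" "z \<in> carrier ?Q" for x y z
    using that unfolding carrier by (auto simp: simps)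
  show "\<one>\<^bsub>?Q\<^esub> \<otimes>\<^bsub>?Q\<^esub> x = x" "x \<otimes>\<^bsub>?Q\<^esub> \<one>\<^bsub>?Q\<^esub> = x" if "x \<in> carrier ?Q" for x
    using that unfolding carrier by (auto simp: simps)
  show "(\<lambda>x. x \<otimes>\<^bsub>?Q\<^esub> y) \<in> module_hom K ?Q ?Q" "(\<lambda>x. y \<otimes>\<^bsub>?Q\<^esub> x) \<in> module_hom K ?Q ?Q"
    if "y \<in> carrier ?Q" for y
    using that by (auto intro!: module_homI simp: carrier simps)
qed

lemma quotient_module_algebra_hom: "(\<lambda>x. I +>\<^bsub>A\<^esub> x) \<in> algebra_hom K A (quotient_module A I)"
  by (simp add: algebra_hom_def quotient_module_proj[OF AV sub] quotient_module_mult quotient_module_one)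

lemma quotient_module_algebra_lift:
  assumes E: "assoc_algebra K E" and f: "f \<in> algebra_hom K A E"
    and null: "\<And>x. x \<in> I \<Longrightarrow> f x = \<zero>\<^bsub>E\<^esub>"
  shows "\<exists>g\<in>algebra_hom K (quotient_module A I) E. \<forall>x\<in>carrier A. g (I +>\<^bsub>A\<^esub> x) = f x"
proof (intro bexI ballI)
  let ?g = "\<lambda>T. f (SOME y. y \<in> T)"
  note fl = algebra_hom_linear[OF f] and EV = assoc_algebra_vectorspace[OF E]
  show eq: "?g (I +>\<^bsub>A\<^esub> x) = f x" if "x \<in> carrier A" for x
    by (rule quotient_module_lift_eq[OF AV sub EV fl null that])
  have lin: "?g \<in> module_hom K (quotient_module A I) E"
    by (rule quotient_module_lift_linear[OF AV sub EV fl null])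
  have "?g (S \<otimes>\<^bsub>quotient_module A I\<^esub> T) = ?g S \<otimes>\<^bsub>E\<^esub> ?g T"
    if ST: "S \<in> carrier (quotient_module A I)" "T \<in> carrier (quotient_module A I)" for S T
  proof -
    from ST obtain x y where "x \<in> carrier A" "S = I +>\<^bsub>A\<^esub> x" "y \<in> carrier A" "T = I +>\<^bsub>A\<^esub> y"
      by (auto simp: carrier_quotient_module[OF AV sub])
    then show ?thesis by (simp add: quotient_module_mult eq algebra_hom_mult[OF f])
  qed
  moreover have "?g \<one>\<^bsub>quotient_module A I\<^esub> = \<one>\<^bsub>E\<^esub>"
    by (simp add: quotient_module_one eq algebra_hom_one[OF f])
  ultimately show "?g \<in> algebra_hom K (quotient_module A I) E"
    using lin by (simp add: algebra_hom_def)
qed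

end

section \<open>The algebra of words\<close>

lemma word_algebra_simps [simp]:
  "carrier (word_algebra K X) = carrier (free_module K (lists X))"
  "\<zero>\<^bsub>word_algebra K X\<^esub> = \<zero>\<^bsub>free_module K (lists X)\<^esub>"
  "ring.add (word_algebra K X) = ring.add (free_module K (lists X))"
  "module.smult (word_algebra K X) = module.smult (free_module K (lists X))"
  "(f \<otimes>\<^bsub>word_algebra K X\<^esub> g) w =
    (\<Oplus>\<^bsub>K\<^esub>i\<in>{..length w}. f (take i w) \<otimes>\<^bsub>K\<^esub> g (drop i w))"
  "\<one>\<^bsub>word_algebra K X\<^esub> = free_gen K []"
  by (simp_all add: word_algebra_def)

lemma vectorspace_word_algebra: "field K \<Longrightarrow> vectorspace K (word_algebra K X)"
  by (rule vectorspace_cong[OF vectorspace_free_module]) simp_all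

lemma module_hom_word_algebra:
  "module_hom K (word_algebra K X) U = module_hom K (free_module K (lists X)) U"
  by (rule module_hom_cong_domain) simp_all

lemma free_module_ext:
  assumes K: "field K" and f: "f \<in> module_hom K (free_module K X) U"
    and g: "g \<in> module_hom K (free_module K X) U" and U: "vectorspace K U"
    and eq: "\<And>x. x \<in> X \<Longrightarrow> f (free_gen K x) = g (free_gen K x)"
    and h: "h \<in> carrier (free_module K X)"
  shows "f h = g h"
  using K h
proof (induction rule: free_module_induct)
  case zero
  show ?case
    by (simp only: module_hom_zero[OF vectorspace_free_module[OF K] U f]
        module_hom_zero[OF vectorspace_free_module[OF K] U g])
next
  case (add h a x)
  interpret F: vectorspace K "free_module K X" by (rule vectorspace_free_module[OF K])
  have "a \<odot>\<^bsub>free_module K X\<^esub> free_gen K x \<in> carrier (free_module K X)"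
    using add.hyps by (intro F.smult_closed free_gen_mem[OF K])
  then show ?case
    using add free_gen_mem[OF K, of x X]
    by (simp add: module_hom_add[OF f] module_hom_add[OF g] module_hom_smult[OF f]
        module_hom_smult[OF g] eq del: free_module_simps)
qed

text \<open>A product is nonzero only at concatenations of a word from each support, which are
  finitely many. At a word with a letter outside \<open>X\<close> it vanishes, since for every cut
  one of the two pieces still contains that letter.\<close>

lemma word_algebra_mult_closed:
  assumes "field K" and f: "f \<in> carrier (free_module K (lists X))"
    and g: "g \<in> carrier (free_module K (lists X))"
  shows "f \<otimes>\<^bsub>word_algebra K X\<^esub> g \<in> carrier (free_module K (lists X))"
proof -
  interpret field K by fact
  let ?p = "f \<otimes>\<^bsub>word_algebra K X\<^esub> g"
  have c: "f u \<in> carrier K" "g u \<in> carrier K" for u using f g by auto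
  have zero: "?p w = \<zero>\<^bsub>K\<^esub>" if "\<And>i. f (take i w) = \<zero>\<^bsub>K\<^esub> \<or> g (drop i w) = \<zero>\<^bsub>K\<^esub>" for w
  proof -
    have "f (take i w) \<otimes>\<^bsub>K\<^esub> g (drop i w) = \<zero>\<^bsub>K\<^esub>" for i using that[of i] c by auto
    then show ?thesis by simp
  qed
  have "{w. ?p w \<noteq> \<zero>\<^bsub>K\<^esub>} \<subseteq> (\<lambda>(u, v). u @ v) ` ({u. f u \<noteq> \<zero>\<^bsub>K\<^esub>} \<times> {v. g v \<noteq> \<zero>\<^bsub>K\<^esub>})"
  proof
    fix w assume "w \<in> {w. ?p w \<noteq> \<zero>\<^bsub>K\<^esub>}"
    then obtain i where "f (take i w) \<noteq> \<zero>\<^bsub>K\<^esub>" "g (drop i w) \<noteq> \<zero>\<^bsub>K\<^esub>" using zero by blast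
    then show "w \<in> (\<lambda>(u, v). u @ v) ` ({u. f u \<noteq> \<zero>\<^bsub>K\<^esub>} \<times> {v. g v \<noteq> \<zero>\<^bsub>K\<^esub>})"
      by (intro image_eqI[of _ _ "(take i w, drop i w)"]) auto
  qed
  then have "finite {w. ?p w \<noteq> \<zero>\<^bsub>K\<^esub>}"
    by (rule finite_subset) (use f g in auto)
  moreover have "?p w = \<zero>\<^bsub>K\<^esub>" if "w \<notin> lists X" for w
  proof (rule zero)
    fix i
    have "take i w \<notin> lists X \<or> drop i w \<notin> lists X"
      using that by (metis append_in_lists_conv append_take_drop_id)
    then show "f (take i w) = \<zero>\<^bsub>K\<^esub> \<or> g (drop i w) = \<zero>\<^bsub>K\<^esub>" using f g by auto
  qed
  moreover have "?p w \<in> carrier K" for w using c by (auto intro!: finsum_closed)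
  ultimately show ?thesis by (simp del: word_algebra_simps(5))
qed

lemma word_algebra_mult_gen:
  assumes "field K"
  shows "free_gen K u \<otimes>\<^bsub>word_algebra K X\<^esub> free_gen K v = free_gen K (u @ v)"
proof
  fix w
  interpret field K by fact
  show "(free_gen K u \<otimes>\<^bsub>word_algebra K X\<^esub> free_gen K v) w = free_gen K (u @ v) w"
  proof (cases "w = u @ v")
    case True
    have "(free_gen K u \<otimes>\<^bsub>word_algebra K X\<^esub> free_gen K v) w =
        (\<Oplus>\<^bsub>K\<^esub>i\<in>{..length w}. if length u = i then \<one>\<^bsub>K\<^esub> else \<zero>\<^bsub>K\<^esub>)"
      unfolding word_algebra_simps
    proof (rule finsum_cong')
      fix i assume "i \<in> {..length w}"
      \<comment> \<open>All cuts from 0 to \<open>length w\<close> occur in the sum, both ends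
        included. Because \<open>i\<close> does not exceed the length, \<open>take i w\<close> has
        exactly \<open>i\<close> letters, so only the cut right after \<open>u\<close>
        contributes.\<close>
      then have "take i w = u \<and> drop i w = v \<longleftrightarrow> length u = i"
        unfolding True by (metis append_eq_conv_conj append_take_drop_id atMost_iff length_take min_absorb2)
      then show "free_gen K u (take i w) \<otimes>\<^bsub>K\<^esub> free_gen K v (drop i w) =
          (if length u = i then \<one>\<^bsub>K\<^esub> else \<zero>\<^bsub>K\<^esub>)"
        by (auto simp: free_gen_def)
    qed auto
    also have "\<dots> = \<one>\<^bsub>K\<^esub>"
      using add.finprod_singleton[of "length u" "{..length w}" "\<lambda>_. \<one>\<^bsub>K\<^esub>"] by (simp add: True)
    finally show ?thesis by (simp add: free_gen_def True)
  next
    case False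
    then have "free_gen K u (take i w) \<otimes>\<^bsub>K\<^esub> free_gen K v (drop i w) = \<zero>\<^bsub>K\<^esub>" for i
      using append_take_drop_id[of i w] by (auto simp: free_gen_def)
    then show ?thesis using False by (simp add: free_gen_def)
  qed
qed

text \<open>Associativity is not proved by reindexing double sums. Both sides are linear in each
  argument, so it reduces to words, where multiplication is concatenation; the restriction to words
  is lifted from the first, the second and then the third argument.\<close>

lemma assoc_algebra_word_algebra:
  fixes K :: "('k, 'm) ring_scheme" and X :: "'x set"
  assumes K: "field K" shows "assoc_algebra K (word_algebra K X)"
proof -
  interpret field K by fact
  let ?W = "word_algebra K X" and ?F = "free_module K (lists X)"
  have W: "vectorspace K ?W" by (rule vectorspace_word_algebra[OF K])
  note F = vectorspace_free_module[OF K]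
  note closed = word_algebra_mult_closed[OF K]
  have c: "f u \<in> carrier K" if "f \<in> carrier ?F" for f u using that by auto
  have left: "(\<lambda>f. f \<otimes>\<^bsub>?W\<^esub> g) \<in> module_hom K ?F ?F" if g: "g \<in> carrier ?F" for g
  proof (rule module_homI)
    fix f h assume f: "f \<in> carrier ?F" and h: "h \<in> carrier ?F"
    have "((f \<oplus>\<^bsub>?F\<^esub> h) \<otimes>\<^bsub>?W\<^esub> g) w = (f \<otimes>\<^bsub>?W\<^esub> g \<oplus>\<^bsub>?F\<^esub> h \<otimes>\<^bsub>?W\<^esub> g) w" for w
    proof -
      have "((f \<oplus>\<^bsub>?F\<^esub> h) \<otimes>\<^bsub>?W\<^esub> g) w = (\<Oplus>\<^bsub>K\<^esub>i\<in>{..length w}.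
          f (take i w) \<otimes>\<^bsub>K\<^esub> g (drop i w) \<oplus>\<^bsub>K\<^esub> h (take i w) \<otimes>\<^bsub>K\<^esub> g (drop i w))"
        unfolding word_algebra_simps
        by (rule finsum_cong') (auto simp: c f g h l_distr simp del: free_module_simps(1))
      also have "\<dots> = (f \<otimes>\<^bsub>?W\<^esub> g \<oplus>\<^bsub>?F\<^esub> h \<otimes>\<^bsub>?W\<^esub> g) w"
        by (simp add: finsum_addf c[OF f] c[OF g] c[OF h])
      finally show ?thesis .
    qed
    then show "(f \<oplus>\<^bsub>?F\<^esub> h) \<otimes>\<^bsub>?W\<^esub> g = f \<otimes>\<^bsub>?W\<^esub> g \<oplus>\<^bsub>?F\<^esub> h \<otimes>\<^bsub>?W\<^esub> g" by (rule ext)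
  next
    fix a f assume a: "a \<in> carrier K" and f: "f \<in> carrier ?F"
    have "((a \<odot>\<^bsub>?F\<^esub> f) \<otimes>\<^bsub>?W\<^esub> g) w = (a \<odot>\<^bsub>?F\<^esub> (f \<otimes>\<^bsub>?W\<^esub> g)) w" for w
    proof -
      have "((a \<odot>\<^bsub>?F\<^esub> f) \<otimes>\<^bsub>?W\<^esub> g) w = (\<Oplus>\<^bsub>K\<^esub>i\<in>{..length w}.
          a \<otimes>\<^bsub>K\<^esub> (f (take i w) \<otimes>\<^bsub>K\<^esub> g (drop i w)))"
        unfolding word_algebra_simps
        by (rule finsum_cong') (auto simp: c f g a m_assoc simp del: free_module_simps(1))
      also have "\<dots> = (a \<odot>\<^bsub>?F\<^esub> (f \<otimes>\<^bsub>?W\<^esub> g)) w"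
        by (simp add: finsum_rdistr c[OF f] c[OF g] a)
      finally show ?thesis .
    qed
    then show "(a \<odot>\<^bsub>?F\<^esub> f) \<otimes>\<^bsub>?W\<^esub> g = a \<odot>\<^bsub>?F\<^esub> (f \<otimes>\<^bsub>?W\<^esub> g)" by (rule ext)
  qed (rule closed[OF _ g])
  have right: "(\<lambda>f. g \<otimes>\<^bsub>?W\<^esub> f) \<in> module_hom K ?F ?F" if g: "g \<in> carrier ?F" for g
  proof (rule module_homI)
    fix f h assume f: "f \<in> carrier ?F" and h: "h \<in> carrier ?F"
    have "(g \<otimes>\<^bsub>?W\<^esub> (f \<oplus>\<^bsub>?F\<^esub> h)) w = (g \<otimes>\<^bsub>?W\<^esub> f \<oplus>\<^bsub>?F\<^esub> g \<otimes>\<^bsub>?W\<^esub> h) w" for w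
    proof -
      have "(g \<otimes>\<^bsub>?W\<^esub> (f \<oplus>\<^bsub>?F\<^esub> h)) w = (\<Oplus>\<^bsub>K\<^esub>i\<in>{..length w}.
          g (take i w) \<otimes>\<^bsub>K\<^esub> f (drop i w) \<oplus>\<^bsub>K\<^esub> g (take i w) \<otimes>\<^bsub>K\<^esub> h (drop i w))"
        unfolding word_algebra_simps
        by (rule finsum_cong') (auto simp: c f g h r_distr simp del: free_module_simps(1))
      also have "\<dots> = (g \<otimes>\<^bsub>?W\<^esub> f \<oplus>\<^bsub>?F\<^esub> g \<otimes>\<^bsub>?W\<^esub> h) w"
        by (simp add: finsum_addf c[OF f] c[OF g] c[OF h])
      finally show ?thesis .
    qed
    then show "g \<otimes>\<^bsub>?W\<^esub> (f \<oplus>\<^bsub>?F\<^esub> h) = g \<otimes>\<^bsub>?W\<^esub> f \<oplus>\<^bsub>?F\<^esub> g \<otimes>\<^bsub>?W\<^esub> h" by (rule ext)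
  next
    fix a f assume a: "a \<in> carrier K" and f: "f \<in> carrier ?F"
    have "(g \<otimes>\<^bsub>?W\<^esub> (a \<odot>\<^bsub>?F\<^esub> f)) w = (a \<odot>\<^bsub>?F\<^esub> (g \<otimes>\<^bsub>?W\<^esub> f)) w" for w
    proof -
      have "(g \<otimes>\<^bsub>?W\<^esub> (a \<odot>\<^bsub>?F\<^esub> f)) w = (\<Oplus>\<^bsub>K\<^esub>i\<in>{..length w}.
          a \<otimes>\<^bsub>K\<^esub> (g (take i w) \<otimes>\<^bsub>K\<^esub> f (drop i w)))"
        unfolding word_algebra_simps
        by (rule finsum_cong') (auto simp: c f g a m_lcomm simp del: free_module_simps(1))
      also have "\<dots> = (a \<odot>\<^bsub>?F\<^esub> (g \<otimes>\<^bsub>?W\<^esub> f)) w"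
        by (simp add: finsum_rdistr c[OF f] c[OF g] a)
      finally show ?thesis .
    qed
    then show "g \<otimes>\<^bsub>?W\<^esub> (a \<odot>\<^bsub>?F\<^esub> f) = a \<odot>\<^bsub>?F\<^esub> (g \<otimes>\<^bsub>?W\<^esub> f)" by (rule ext)
  qed (rule closed[OF g])
  have gen: "free_gen K w \<in> carrier ?F" if "w \<in> lists X" for w by (rule free_gen_mem[OF K that])
  note mult_gen = word_algebra_mult_gen[OF K, where X = X]
  note ext = free_module_ext[OF K _ _ F]
  have assoc1: "(x \<otimes>\<^bsub>?W\<^esub> free_gen K v) \<otimes>\<^bsub>?W\<^esub> free_gen K w = x \<otimes>\<^bsub>?W\<^esub> (free_gen K v \<otimes>\<^bsub>?W\<^esub> free_gen K w)"
    if "x \<in> carrier ?F" "v \<in> lists X" "w \<in> lists X" for x v w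
    by (rule ext[OF module_hom_comp[OF left left] left])
      (use that in \<open>simp_all add: gen closed mult_gen del: free_module_simps word_algebra_simps\<close>)
  have assoc2: "(x \<otimes>\<^bsub>?W\<^esub> y) \<otimes>\<^bsub>?W\<^esub> free_gen K w = x \<otimes>\<^bsub>?W\<^esub> (y \<otimes>\<^bsub>?W\<^esub> free_gen K w)"
    if "x \<in> carrier ?F" "y \<in> carrier ?F" "w \<in> lists X" for x y w
    by (rule ext[OF module_hom_comp[OF left right] module_hom_comp[OF right left]])
      (use that in \<open>simp_all add: gen closed assoc1 del: free_module_simps word_algebra_simps\<close>)
  have assoc3: "(x \<otimes>\<^bsub>?W\<^esub> y) \<otimes>\<^bsub>?W\<^esub> z = x \<otimes>\<^bsub>?W\<^esub> (y \<otimes>\<^bsub>?W\<^esub> z)"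
    if "x \<in> carrier ?F" "y \<in> carrier ?F" "z \<in> carrier ?F" for x y z
    by (rule ext[OF right module_hom_comp[OF right right]])
      (use that in \<open>simp_all add: gen closed assoc2 del: free_module_simps word_algebra_simps\<close>)
  have unit_left: "free_gen K [] \<otimes>\<^bsub>?W\<^esub> x = x" if "x \<in> carrier ?F" for x
    by (rule ext[OF right module_hom_id]) (use that in \<open>simp_all add: gen mult_gen del: free_module_simps word_algebra_simps\<close>)
  have unit_right: "x \<otimes>\<^bsub>?W\<^esub> free_gen K [] = x" if "x \<in> carrier ?F" for x
    by (rule ext[OF left module_hom_id]) (use that in \<open>simp_all add: gen mult_gen del: free_module_simps word_algebra_simps\<close>)
  have hom: "module_hom K ?W ?W = module_hom K ?F ?F"
    by (simp add: module_hom_word_algebra module_hom_cong_codomain[of ?W ?F])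
  show ?thesis
    by (rule assoc_algebraI[OF W])
      (use closed gen assoc3 unit_left unit_right left right in
        \<open>simp_all add: hom del: free_module_simps word_algebra_simps(5)\<close>)
qed

text \<open>A word goes to the product of the images of its letters, and linearity does the rest.
  Multiplicativity holds on words by \<open>p_append\<close> and is then extended in one argument at
  a time.\<close>

lemma word_algebra_lift:
  assumes K: "field K" and E: "assoc_algebra K E" and g: "g \<in> X \<rightarrow> carrier E"
  shows "\<exists>F\<in>algebra_hom K (word_algebra K X) E. \<forall>x\<in>X. F (free_gen K [x]) = g x"
proof -
  interpret E: assoc_algebra K E by fact
  note EV = assoc_algebra_vectorspace[OF E]
  let ?W = "word_algebra K X"
  note W = assoc_algebra_word_algebra[OF K, of X]
  interpret W: assoc_algebra K ?W by (rule W)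
  define p where "p w = foldr (\<lambda>x e. g x \<otimes>\<^bsub>E\<^esub> e) w \<one>\<^bsub>E\<^esub>" for w
  have p_mem: "p w \<in> carrier E" if "w \<in> lists X" for w
    using that g by (induction w) (auto simp: p_def)
  have p_append: "p (u @ v) = p u \<otimes>\<^bsub>E\<^esub> p v" if "u \<in> lists X" "v \<in> lists X" for u v
    using that(1)
  proof (induction u)
    case Nil
    then show ?case using p_mem[OF that(2)] by (simp add: p_def)
  next
    case (Cons x u)
    then have "p (x # (u @ v)) = g x \<otimes>\<^bsub>E\<^esub> (p u \<otimes>\<^bsub>E\<^esub> p v)" by (simp add: p_def)
    also have "\<dots> = (g x \<otimes>\<^bsub>E\<^esub> p u) \<otimes>\<^bsub>E\<^esub> p v"
      using Cons.hyps g p_mem[OF that(2)] p_mem[OF Cons.hyps(2)] by (intro E.m_assoc[symmetric]) auto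
    finally show ?case by (simp add: p_def)
  qed
  have p: "p \<in> lists X \<rightarrow> carrier E" using p_mem by blast
  define F where "F = free_lift K E p"
  have F: "F \<in> module_hom K ?W E"
    unfolding F_def module_hom_word_algebra by (rule free_lift_linear[OF EV p])
  have F_gen: "F (free_gen K w) = p w" if "w \<in> lists X" for w
    unfolding F_def by (rule free_lift_gen[OF EV p that])
  note gen = free_gen_mem[OF K, of _ "lists X"]
  note ext = free_module_ext[OF K _ _ EV, of _ "lists X", folded module_hom_word_algebra]
  have 1: "F (x \<otimes>\<^bsub>?W\<^esub> free_gen K v) = F x \<otimes>\<^bsub>E\<^esub> F (free_gen K v)"
    if "x \<in> carrier ?W" "v \<in> lists X" for x v
  proof (rule ext[OF module_hom_comp[OF F assoc_algebra_mult_left[OF W]]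
        module_hom_comp[OF assoc_algebra_mult_left[OF E] F]])
    show "F (free_gen K v) \<in> carrier E" using F_gen p_mem that by simp
    show "free_gen K v \<in> carrier ?W" using gen that by simp
    show "x \<in> carrier (free_module K (lists X))" using that by simp
    show "F (free_gen K w \<otimes>\<^bsub>?W\<^esub> free_gen K v) = F (free_gen K w) \<otimes>\<^bsub>E\<^esub> F (free_gen K v)"
      if w: "w \<in> lists X" for w
      using w \<open>v \<in> lists X\<close> F_gen[of "w @ v"]
      by (simp add: word_algebra_mult_gen[OF K] F_gen p_append)
  qed
  have 2: "F (x \<otimes>\<^bsub>?W\<^esub> y) = F x \<otimes>\<^bsub>E\<^esub> F y" if "x \<in> carrier ?W" "y \<in> carrier ?W" for x y
  proof (rule ext[OF module_hom_comp[OF F assoc_algebra_mult_right[OF W]]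
        module_hom_comp[OF assoc_algebra_mult_right[OF E] F]])
    show "F x \<in> carrier E" by (rule module_hom_mem[OF F that(1)])
    show "y \<in> carrier (free_module K (lists X))" using that by simp
  qed (use that 1 in auto)
  have "F \<in> algebra_hom K ?W E"
    using F 2 F_gen[of "[]"] by (simp add: algebra_hom_def p_def)
  moreover have "F (free_gen K [x]) = g x" if "x \<in> X" for x
    using F_gen[of "[x]"] that E.r_one[OF Pi_mem[OF g that]] by (simp add: p_def)
  ultimately show ?thesis by blast
qed

text \<open>Serves as an induction predicate: a property closed under the algebra operations holds
  everywhere once it holds on generators. Zero and negatives are covered by the scalar
  multiples.\<close>

definition unital_subalgebra ::
  "('k, 'm) ring_scheme \<Rightarrow> ('k, 'a, 'ma) module_scheme \<Rightarrow> 'a set \<Rightarrow> bool" where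
  "unital_subalgebra K A M \<longleftrightarrow> \<one>\<^bsub>A\<^esub> \<in> M \<and>
    (\<forall>x\<in>M. \<forall>y\<in>M. x \<oplus>\<^bsub>A\<^esub> y \<in> M \<and> x \<otimes>\<^bsub>A\<^esub> y \<in> M) \<and> (\<forall>a\<in>carrier K. \<forall>x\<in>M. a \<odot>\<^bsub>A\<^esub> x \<in> M)"

lemma unital_subalgebraD:
  assumes "unital_subalgebra K A M"
  shows "\<one>\<^bsub>A\<^esub> \<in> M" "\<lbrakk>x \<in> M; y \<in> M\<rbrakk> \<Longrightarrow> x \<oplus>\<^bsub>A\<^esub> y \<in> M"
    "\<lbrakk>x \<in> M; y \<in> M\<rbrakk> \<Longrightarrow> x \<otimes>\<^bsub>A\<^esub> y \<in> M" "\<lbrakk>a \<in> carrier K; x \<in> M\<rbrakk> \<Longrightarrow> a \<odot>\<^bsub>A\<^esub> x \<in> M"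
  using assms by (auto simp: unital_subalgebra_def)

lemma unital_subalgebra_vimage:
  assumes A: "assoc_algebra K A" and f: "f \<in> algebra_hom K A B" and M: "unital_subalgebra K B M"
  shows "unital_subalgebra K A {x \<in> carrier A. f x \<in> M}"
proof -
  interpret A: assoc_algebra K A by fact
  note fl = algebra_hom_linear[OF f]
  show ?thesis
    unfolding unital_subalgebra_def
    by (auto simp: algebra_hom_one[OF f] algebra_hom_mult[OF f] module_hom_add[OF fl]
        module_hom_smult[OF fl] unital_subalgebraD[OF M])
qed

lemma word_algebra_generated:
  assumes K: "field K" and M: "unital_subalgebra K (word_algebra K X) M"
    and gen: "\<And>x. x \<in> X \<Longrightarrow> free_gen K [x] \<in> M"
  shows "carrier (word_algebra K X) \<subseteq> M"
proof
  interpret field K by fact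
  let ?W = "word_algebra K X" and ?F = "free_module K (lists X)"
  note D = unital_subalgebraD[OF M]
  have word: "free_gen K w \<in> M" if "w \<in> lists X" for w
    using that
  proof (induction w)
    case Nil
    then show ?case using D(1) by simp
  next
    case (Cons x w)
    have "free_gen K [x] \<otimes>\<^bsub>?W\<^esub> free_gen K w \<in> M" by (rule D(3)[OF gen Cons.IH]) (rule Cons.hyps(1))
    then show ?case by (simp add: word_algebra_mult_gen[OF K] del: word_algebra_simps)
  qed
  fix f assume "f \<in> carrier ?W"
  then have "f \<in> carrier ?F" by (simp only: word_algebra_simps)
  with K show "f \<in> M"
  proof (induction rule: free_module_induct)
    case zero
    have "\<zero>\<^bsub>K\<^esub> \<odot>\<^bsub>?W\<^esub> \<one>\<^bsub>?W\<^esub> \<in> M" by (rule D(4)[OF zero_closed D(1)])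
    moreover have "\<zero>\<^bsub>K\<^esub> \<odot>\<^bsub>?W\<^esub> \<one>\<^bsub>?W\<^esub> = \<zero>\<^bsub>?F\<^esub>" by (auto simp: free_gen_def)
    ultimately show ?case by (simp only:)
  next
    case (add f a w)
    show ?case
      using D(2)[OF add.IH D(4)[OF add.hyps(2) word[OF add.hyps(3)]]]
      by (simp only: word_algebra_simps)
  qed
qed

section \<open>The tensor algebra\<close>

text \<open>The generating set inside \<open>tensor_algebra_ideal\<close>, given a name so that its
  containment in the carrier and in kernels can be stated; \<open>sweedler_relations\<close> does
  the same for \<open>sweedler_ideal\<close>.\<close>

definition tensor_algebra_relations ::
  "('k, 'm) ring_scheme \<Rightarrow> ('k, 'v, 'mv) module_scheme \<Rightarrow> ('v list \<Rightarrow> 'k) set" where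
  "tensor_algebra_relations K V = (let W = word_algebra K (carrier V); \<delta> = free_gen K in
    {\<delta> [v \<oplus>\<^bsub>V\<^esub> v'] \<ominus>\<^bsub>W\<^esub> \<delta> [v] \<ominus>\<^bsub>W\<^esub> \<delta> [v'] | v v'. v \<in> carrier V \<and> v' \<in> carrier V} \<union>
    {\<delta> [a \<odot>\<^bsub>V\<^esub> v] \<ominus>\<^bsub>W\<^esub> a \<odot>\<^bsub>W\<^esub> \<delta> [v] | a v. a \<in> carrier K \<and> v \<in> carrier V})"

context
  fixes K :: "('k, 'm) ring_scheme" and V :: "('k, 'v, 'mv) module_scheme"
  assumes V: "vectorspace K V"
begin

interpretation V: vectorspace K V by (rule V)

private abbreviation (input) "W \<equiv> word_algebra K (carrier V)"
private abbreviation (input) "J \<equiv> tensor_algebra_ideal K V"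
private abbreviation (input) "R \<equiv> tensor_algebra_relations K V"

private lemma W: "assoc_algebra K W" by (rule assoc_algebra_word_algebra[OF V.field_axioms])
private lemma WV: "vectorspace K W" by (rule assoc_algebra_vectorspace[OF W])

interpretation W: assoc_algebra K W by (rule W)

private lemma J: "J = Idl\<^bsub>W\<^esub> R" by (simp only: tensor_algebra_ideal_def tensor_algebra_relations_def Let_def)

private lemma letter_mem: "v \<in> carrier V \<Longrightarrow> free_gen K [v] \<in> carrier W"
  using free_gen_mem[OF V.field_axioms, of "[v]" "lists (carrier V)"] by simp

private lemma R_sub: "R \<subseteq> carrier W"
proof
  fix x assume "x \<in> R"
  then show "x \<in> carrier W"
    unfolding tensor_algebra_relations_def Let_def
  proof (elim UnE CollectE exE conjE)
    fix v v' assume "x = free_gen K [v \<oplus>\<^bsub>V\<^esub> v'] \<ominus>\<^bsub>W\<^esub> free_gen K [v] \<ominus>\<^bsub>W\<^esub> free_gen K [v']"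
      "v \<in> carrier V" "v' \<in> carrier V"
    then show ?thesis by (simp only:) (intro W.minus_closed letter_mem V.M.a_closed)
  next
    fix a v assume "x = free_gen K [a \<odot>\<^bsub>V\<^esub> v] \<ominus>\<^bsub>W\<^esub> a \<odot>\<^bsub>W\<^esub> free_gen K [v]"
      "a \<in> carrier K" "v \<in> carrier V"
    then show ?thesis by (simp only:) (intro W.minus_closed W.smult_closed letter_mem V.smult_closed)
  qed
qed

private lemma J_ideal: "ideal J W" unfolding J by (rule W.genideal_ideal[OF R_sub])
private lemma J_sub: "submodule K J W" by (rule ideal_submodule[OF W J_ideal])

lemma assoc_algebra_tensor_algebra: "assoc_algebra K (tensor_algebra K V)"
  unfolding tensor_algebra_def by (rule assoc_algebra_quotient_module[OF W J_ideal])

private lemma W_proj: "(\<lambda>x. J +>\<^bsub>W\<^esub> x) \<in> algebra_hom K W (tensor_algebra K V)"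
  unfolding tensor_algebra_def by (rule quotient_module_algebra_hom[OF W J_ideal])

lemma tensor_algebra_incl_linear: "tensor_algebra_incl K V \<in> module_hom K V (tensor_algebra K V)"
proof (rule module_homI)
  note pl = algebra_hom_linear[OF W_proj]
  fix v v' assume v: "v \<in> carrier V" "v' \<in> carrier V"
  show "tensor_algebra_incl K V v \<in> carrier (tensor_algebra K V)"
    unfolding tensor_algebra_incl_def by (rule module_hom_mem[OF pl letter_mem[OF v(1)]])
  have "free_gen K [v \<oplus>\<^bsub>V\<^esub> v'] \<ominus>\<^bsub>W\<^esub> free_gen K [v] \<ominus>\<^bsub>W\<^esub> free_gen K [v'] \<in> R"
    unfolding tensor_algebra_relations_def Let_def using v by blast
  then have "free_gen K [v \<oplus>\<^bsub>V\<^esub> v'] \<ominus>\<^bsub>W\<^esub> free_gen K [v] \<ominus>\<^bsub>W\<^esub> free_gen K [v'] \<in> J"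
    unfolding J using W.genideal_self[OF R_sub] by blast
  moreover have "x \<ominus>\<^bsub>W\<^esub> y \<ominus>\<^bsub>W\<^esub> z = x \<ominus>\<^bsub>W\<^esub> (y \<oplus>\<^bsub>W\<^esub> z)"
    if "x \<in> carrier W" "y \<in> carrier W" "z \<in> carrier W" for x y z
    using that by (simp add: a_minus_def W.minus_add W.a_assoc del: word_algebra_simps)
  ultimately have "free_gen K [v \<oplus>\<^bsub>V\<^esub> v'] \<ominus>\<^bsub>W\<^esub> (free_gen K [v] \<oplus>\<^bsub>W\<^esub> free_gen K [v']) \<in> J"
    using v letter_mem V.M.a_closed by metis
  then show "tensor_algebra_incl K V (v \<oplus>\<^bsub>V\<^esub> v') = tensor_algebra_incl K V v
      \<oplus>\<^bsub>tensor_algebra K V\<^esub> tensor_algebra_incl K V v'"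
    unfolding tensor_algebra_incl_def module_hom_add[OF pl letter_mem[OF v(1)] letter_mem[OF v(2)], symmetric]
    using quotient_module_eq_iff[OF WV J_sub letter_mem W.a_closed[OF letter_mem letter_mem]] v V.M.a_closed by blast
next
  note pl = algebra_hom_linear[OF W_proj]
  fix a v assume a: "a \<in> carrier K" and v: "v \<in> carrier V"
  have "free_gen K [a \<odot>\<^bsub>V\<^esub> v] \<ominus>\<^bsub>W\<^esub> a \<odot>\<^bsub>W\<^esub> free_gen K [v] \<in> R"
    unfolding tensor_algebra_relations_def Let_def using a v by blast
  then have "free_gen K [a \<odot>\<^bsub>V\<^esub> v] \<ominus>\<^bsub>W\<^esub> a \<odot>\<^bsub>W\<^esub> free_gen K [v] \<in> J"
    unfolding J using W.genideal_self[OF R_sub] by blast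
  then show "tensor_algebra_incl K V (a \<odot>\<^bsub>V\<^esub> v) = a \<odot>\<^bsub>tensor_algebra K V\<^esub> tensor_algebra_incl K V v"
    unfolding tensor_algebra_incl_def module_hom_smult[OF pl a letter_mem[OF v], symmetric]
    using quotient_module_eq_iff[OF WV J_sub letter_mem W.smult_closed[OF a letter_mem]] a v V.smult_closed by blast
qed

text \<open>The universal property that justifies the encoding by words modulo linear relations.
  Linearity of \<open>g\<close> is precisely what kills these relations under the homomorphism from
  the word algebra.\<close>

lemma tensor_algebra_lift:
  assumes E: "assoc_algebra K E" and g: "g \<in> module_hom K V E"
  shows "\<exists>G\<in>algebra_hom K (tensor_algebra K V) E. \<forall>v\<in>carrier V. G (tensor_algebra_incl K V v) = g v"
proof -
  interpret E: assoc_algebra K E by fact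
  note EV = assoc_algebra_vectorspace[OF E]
  have "g \<in> carrier V \<rightarrow> carrier E" using module_hom_mem[OF g] by blast
  from word_algebra_lift[OF V.field_axioms E this] obtain F
    where F: "F \<in> algebra_hom K W E" and F_gen: "\<And>v. v \<in> carrier V \<Longrightarrow> F (free_gen K [v]) = g v" by blast
  note Fl = algebra_hom_linear[OF F]
  have minus: "x \<ominus>\<^bsub>W\<^esub> y \<in> carrier W" if "x \<in> carrier W" "y \<in> carrier W" for x y
    using that by (rule W.minus_closed)
  have "F x = \<zero>\<^bsub>E\<^esub>" if "x \<in> R" for x
    using that unfolding tensor_algebra_relations_def Let_def
  proof (elim UnE CollectE exE conjE)
    fix v v' assume x: "x = free_gen K [v \<oplus>\<^bsub>V\<^esub> v'] \<ominus>\<^bsub>W\<^esub> free_gen K [v] \<ominus>\<^bsub>W\<^esub> free_gen K [v']"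
      and v: "v \<in> carrier V" "v' \<in> carrier V"
    have "F x = (g v \<oplus>\<^bsub>E\<^esub> g v') \<ominus>\<^bsub>E\<^esub> g v \<ominus>\<^bsub>E\<^esub> g v'"
      unfolding x using v
      by (simp add: module_hom_minus[OF WV EV Fl] F_gen letter_mem minus module_hom_add[OF g] del: word_algebra_simps)
    also have "\<dots> = (g v \<oplus>\<^bsub>E\<^esub> g v') \<oplus>\<^bsub>E\<^esub> \<ominus>\<^bsub>E\<^esub> (g v \<oplus>\<^bsub>E\<^esub> g v')"
      using module_hom_mem[OF g v(1)] module_hom_mem[OF g v(2)]
      by (simp add: a_minus_def E.a_assoc E.minus_add)
    also have "\<dots> = \<zero>\<^bsub>E\<^esub>"
      using module_hom_mem[OF g v(1)] module_hom_mem[OF g v(2)] by (simp add: E.r_neg)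
    finally show ?thesis .
  next
    fix a v assume x: "x = free_gen K [a \<odot>\<^bsub>V\<^esub> v] \<ominus>\<^bsub>W\<^esub> a \<odot>\<^bsub>W\<^esub> free_gen K [v]"
      and a: "a \<in> carrier K" and v: "v \<in> carrier V"
    have "a \<odot>\<^bsub>W\<^esub> free_gen K [v] \<in> carrier W" by (rule W.smult_closed[OF a letter_mem[OF v]])
    then have "F x = a \<odot>\<^bsub>E\<^esub> g v \<ominus>\<^bsub>E\<^esub> a \<odot>\<^bsub>E\<^esub> g v"
      unfolding x using v a
      by (simp add: module_hom_minus[OF WV EV Fl] F_gen letter_mem module_hom_smult[OF Fl] module_hom_smult[OF g]
          del: word_algebra_simps)
    then show ?thesis using module_hom_mem[OF g v] a by (simp add: E.r_neg a_minus_def)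
  qed
  then have "F x = \<zero>\<^bsub>E\<^esub>" if "x \<in> J" for x
    using algebra_hom_kernel_genideal[OF W E F R_sub] that unfolding J by blast
  from quotient_module_algebra_lift[OF W J_ideal E F this] obtain G
    where "G \<in> algebra_hom K (tensor_algebra K V) E" "\<And>x. x \<in> carrier W \<Longrightarrow> G (J +>\<^bsub>W\<^esub> x) = F x"
    unfolding tensor_algebra_def by blast
  then show ?thesis
    by (intro bexI[of _ G]) (simp_all add: tensor_algebra_incl_def letter_mem F_gen del: word_algebra_simps)
qed

lemma tensor_algebra_generated:
  assumes M: "unital_subalgebra K (tensor_algebra K V) M"
    and gen: "\<And>v. v \<in> carrier V \<Longrightarrow> tensor_algebra_incl K V v \<in> M"
  shows "carrier (tensor_algebra K V) \<subseteq> M"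
proof -
  have "carrier W \<subseteq> {x \<in> carrier W. J +>\<^bsub>W\<^esub> x \<in> M}"
    by (rule word_algebra_generated[OF V.field_axioms unital_subalgebra_vimage[OF W W_proj M]])
      (use gen letter_mem in
        \<open>simp add: tensor_algebra_incl_def del: word_algebra_simps\<close>)
  then show ?thesis
    unfolding tensor_algebra_def carrier_quotient_module[OF WV J_sub] by blast
qed

end

section \<open>The Sweedler product\<close>

definition sweedler_relations ::
  "('k, 'm) ring_scheme \<Rightarrow> ('k, 'a, 'ma) module_scheme \<Rightarrow> ('k, 'h, 'mh) coalgebra_scheme
    \<Rightarrow> (('k, 'a, 'h) tensor list \<Rightarrow> 'k) set set" where
  "sweedler_relations K A H =
    (let T = tensor_algebra K (tensor K A H);
         \<tau> = (\<lambda>a h. tensor_algebra_incl K (tensor K A H) (pure_tensor K A H a h)) in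
      {\<tau> (a \<otimes>\<^bsub>A\<^esub> a') h \<ominus>\<^bsub>T\<^esub> tensor_lift K T (\<lambda>x y. \<tau> a x \<otimes>\<^bsub>T\<^esub> \<tau> a' y) (comult H h) | a a' h.
        a \<in> carrier A \<and> a' \<in> carrier A \<and> h \<in> carrier H} \<union>
      {\<tau> \<one>\<^bsub>A\<^esub> h \<ominus>\<^bsub>T\<^esub> counit H h \<odot>\<^bsub>T\<^esub> \<one>\<^bsub>T\<^esub> | h. h \<in> carrier H})"

text \<open>The class of \<open>a \<otimes> h\<close>. By \<open>sweedler_gen_mult\<close> and
  \<open>sweedler_gen_one\<close> it satisfies the measuring identities, and it is the universal
  bilinear map doing so.\<close>

definition sweedler_gen ::
  "('k, 'm) ring_scheme \<Rightarrow> ('k, 'a, 'ma) module_scheme \<Rightarrow> ('k, 'h, 'mh) coalgebra_scheme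
    \<Rightarrow> 'a \<Rightarrow> 'h \<Rightarrow> ('k, 'a, 'h) sweedler" where
  "sweedler_gen K A H a h = sweedler_ideal K A H +>\<^bsub>tensor_algebra K (tensor K A H)\<^esub>
    tensor_algebra_incl K (tensor K A H) (pure_tensor K A H a h)"

context
  fixes K :: "('k, 'm) ring_scheme" and A :: "('k, 'a, 'ma) module_scheme"
    and H :: "('k, 'h, 'mh) coalgebra_scheme"
  assumes A: "assoc_algebra K A" and H: "coalgebra K H"
begin

interpretation A: assoc_algebra K A by (rule A)
interpretation H: coalgebra K H by (rule H)

private abbreviation (input) "V \<equiv> tensor K A H"
private abbreviation (input) "T \<equiv> tensor_algebra K V"
private abbreviation (input) "\<iota> \<equiv> tensor_algebra_incl K V"
private abbreviation (input) "\<tau> a h \<equiv> \<iota> (pure_tensor K A H a h)"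
private abbreviation (input) "J' \<equiv> sweedler_ideal K A H"
private abbreviation (input) "S \<equiv> sweedler_product K A H"
private abbreviation (input) "\<sigma> \<equiv> sweedler_gen K A H"
private abbreviation (input) "R' \<equiv> sweedler_relations K A H"

private lemmas A_vs = assoc_algebra_vectorspace[OF A]
private lemmas H_vs = H.vectorspace_axioms
private lemmas V = vectorspace_tensor[OF A_vs H_vs]
private lemmas T = assoc_algebra_tensor_algebra[OF V]
private lemmas T_vs = assoc_algebra_vectorspace[OF T]
private lemmas \<iota> = tensor_algebra_incl_linear[OF V]

interpretation T: assoc_algebra K T by (rule T)

private lemma J': "J' = Idl\<^bsub>T\<^esub> R'" by (simp only: sweedler_ideal_def sweedler_relations_def Let_def)

private lemma \<tau>: "bilinear K A H T \<tau>"
  by (rule bilinear_comp[OF bilinear_pure_tensor[OF A_vs H_vs] \<iota>])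

private lemma \<tau>\<tau>: "\<lbrakk>a \<in> carrier A; a' \<in> carrier A\<rbrakk> \<Longrightarrow> bilinear K H H T (\<lambda>x y. \<tau> a x \<otimes>\<^bsub>T\<^esub> \<tau> a' y)"
  by (rule bilinear_mult_pair[OF T bilinear_right[OF \<tau>] bilinear_right[OF \<tau>]])

private lemma cu: "h \<in> carrier H \<Longrightarrow> counit H h \<in> carrier K"
  using module_hom_mem[OF H.counit_linear] by simp

private lemma mem:
  "\<lbrakk>a \<in> carrier A; h \<in> carrier H\<rbrakk> \<Longrightarrow> \<tau> a h \<in> carrier T"
  "\<lbrakk>a \<in> carrier A; a' \<in> carrier A; h \<in> carrier H\<rbrakk> \<Longrightarrow>
    tensor_lift K T (\<lambda>x y. \<tau> a x \<otimes>\<^bsub>T\<^esub> \<tau> a' y) (comult H h) \<in> carrier T"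
  "h \<in> carrier H \<Longrightarrow> counit H h \<odot>\<^bsub>T\<^esub> \<one>\<^bsub>T\<^esub> \<in> carrier T"
  using bilinear_mem[OF \<tau>] tensor_lift_mem[OF H_vs H_vs T_vs \<tau>\<tau> H.comult_mem] cu by auto

private lemma R'_sub: "R' \<subseteq> carrier T"
proof
  fix x assume "x \<in> R'"
  then show "x \<in> carrier T"
    unfolding sweedler_relations_def Let_def
  proof (elim UnE CollectE exE conjE)
    fix a a' h assume "x = \<tau> (a \<otimes>\<^bsub>A\<^esub> a') h \<ominus>\<^bsub>T\<^esub>
        tensor_lift K T (\<lambda>x y. \<tau> a x \<otimes>\<^bsub>T\<^esub> \<tau> a' y) (comult H h)"
      "a \<in> carrier A" "a' \<in> carrier A" "h \<in> carrier H"
    then show ?thesis by (simp only:) (intro T.minus_closed mem A.m_closed)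
  next
    fix h assume "x = \<tau> \<one>\<^bsub>A\<^esub> h \<ominus>\<^bsub>T\<^esub> counit H h \<odot>\<^bsub>T\<^esub> \<one>\<^bsub>T\<^esub>" "h \<in> carrier H"
    then show ?thesis by (simp only:) (intro T.minus_closed mem A.one_closed)
  qed
qed

private lemma J'_ideal: "ideal J' T" unfolding J' by (rule T.genideal_ideal[OF R'_sub])
private lemma J'_sub: "submodule K J' T" by (rule ideal_submodule[OF T J'_ideal])

lemma assoc_algebra_sweedler_product: "assoc_algebra K (sweedler_product K A H)"
  unfolding sweedler_product_def by (rule assoc_algebra_quotient_module[OF T J'_ideal])

private lemmas S = assoc_algebra_sweedler_product
private lemmas S_vs = assoc_algebra_vectorspace[OF S]

private lemma T_proj: "(\<lambda>x. J' +>\<^bsub>T\<^esub> x) \<in> algebra_hom K T S"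
  unfolding sweedler_product_def by (rule quotient_module_algebra_hom[OF T J'_ideal])

private lemmas T_proj_linear = algebra_hom_linear[OF T_proj]

lemma bilinear_sweedler_gen: "bilinear K A H (sweedler_product K A H) (sweedler_gen K A H)"
  using bilinear_comp[OF \<tau> T_proj_linear] by (simp add: sweedler_gen_def[abs_def])

private lemma R'_eq:
  assumes "x \<in> carrier T" "y \<in> carrier T" "x \<ominus>\<^bsub>T\<^esub> y \<in> R'" shows "J' +>\<^bsub>T\<^esub> x = J' +>\<^bsub>T\<^esub> y"
  using assms quotient_module_eq_iff[OF T_vs J'_sub assms(1,2)]
    T.genideal_self[OF R'_sub]
  unfolding J' by blast

lemma sweedler_gen_mult:
  assumes a: "a \<in> carrier A" "a' \<in> carrier A" and h: "h \<in> carrier H"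
  shows "sweedler_gen K A H (a \<otimes>\<^bsub>A\<^esub> a') h =
    tensor_lift K (sweedler_product K A H)
      (\<lambda>x y. sweedler_gen K A H a x \<otimes>\<^bsub>sweedler_product K A H\<^esub> sweedler_gen K A H a' y) (comult H h)"
proof -
  have "\<sigma> (a \<otimes>\<^bsub>A\<^esub> a') h = J' +>\<^bsub>T\<^esub> tensor_lift K T (\<lambda>x y. \<tau> a x \<otimes>\<^bsub>T\<^esub> \<tau> a' y) (comult H h)"
    unfolding sweedler_gen_def
    by (rule R'_eq[OF mem(1,2)], unfold sweedler_relations_def Let_def) (use a h A.m_closed in blast)+
  also have "\<dots> = tensor_lift K S (\<lambda>x y. \<sigma> a x \<otimes>\<^bsub>S\<^esub> \<sigma> a' y) (comult H h)"
    by (rule tensor_lift_comp_cong[OF H_vs H_vs T_vs S_vs \<tau>\<tau>[OF a] T_proj_linear H.comult_mem[OF h]])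
      (simp add: sweedler_gen_def algebra_hom_mult[OF T_proj] mem a)
  finally show ?thesis .
qed

lemma sweedler_gen_one:
  assumes h: "h \<in> carrier H"
  shows "sweedler_gen K A H \<one>\<^bsub>A\<^esub> h = counit H h \<odot>\<^bsub>sweedler_product K A H\<^esub> \<one>\<^bsub>sweedler_product K A H\<^esub>"
proof -
  have "\<sigma> \<one>\<^bsub>A\<^esub> h = J' +>\<^bsub>T\<^esub> (counit H h \<odot>\<^bsub>T\<^esub> \<one>\<^bsub>T\<^esub>)"
    unfolding sweedler_gen_def
    by (rule R'_eq[OF mem(1,3)], unfold sweedler_relations_def Let_def) (use h A.one_closed in blast)+
  also have "\<dots> = counit H h \<odot>\<^bsub>S\<^esub> \<one>\<^bsub>S\<^esub>"
    by (simp add: module_hom_smult[OF T_proj_linear cu[OF h]] algebra_hom_one[OF T_proj])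
  finally show ?thesis .
qed

text \<open>The induction principle behind the uniqueness of extensions: two measurings from the
  Sweedler product that agree on the classes of \<open>a \<otimes> h\<close> agree everywhere.
  Additivity reduces general tensors to pure ones.\<close>

lemma sweedler_product_generated:
  assumes M: "unital_subalgebra K (sweedler_product K A H) M"
    and gen: "\<And>a h. \<lbrakk>a \<in> carrier A; h \<in> carrier H\<rbrakk> \<Longrightarrow> sweedler_gen K A H a h \<in> M"
  shows "carrier (sweedler_product K A H) \<subseteq> M"
proof -
  let ?N = "{x \<in> carrier T. J' +>\<^bsub>T\<^esub> x \<in> M}"
  note N = unital_subalgebra_vimage[OF T T_proj M]
  have "\<iota> v \<in> ?N" if "v \<in> carrier V" for v
    using that
  proof (induction v rule: tensor_induct[OF A_vs H_vs, consumes 1, case_names pure add])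
    case (pure a h)
    then show ?case using gen[OF pure] mem(1)[OF pure] by (simp add: sweedler_gen_def)
  next
    case (add s t)
    show ?case
      unfolding module_hom_add[OF \<iota> add.hyps] by (rule unital_subalgebraD(2)[OF N add.IH])
  qed
  from tensor_algebra_generated[OF V N this] have "carrier T \<subseteq> ?N" .
  then show ?thesis
    unfolding sweedler_product_def carrier_quotient_module[OF T_vs J'_sub] by blast
qed

text \<open>Algebra homomorphisms out of the Sweedler product correspond to measurings, here in the
  form of a bilinear \<open>\<beta>\<close>. Such a form gives a linear map on
  \<open>A \<otimes> H\<close>, hence a homomorphism on the tensor algebra, and the measuring
  identities say that it kills the generators of the Sweedler ideal.\<close>

lemma sweedler_product_lift:
  assumes E: "assoc_algebra K E" and \<beta>: "bilinear K A H E \<beta>"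
    and mult: "\<And>a a' h. \<lbrakk>a \<in> carrier A; a' \<in> carrier A; h \<in> carrier H\<rbrakk> \<Longrightarrow>
      \<beta> (a \<otimes>\<^bsub>A\<^esub> a') h = tensor_lift K E (\<lambda>x y. \<beta> a x \<otimes>\<^bsub>E\<^esub> \<beta> a' y) (comult H h)"
    and one: "\<And>h. h \<in> carrier H \<Longrightarrow> \<beta> \<one>\<^bsub>A\<^esub> h = counit H h \<odot>\<^bsub>E\<^esub> \<one>\<^bsub>E\<^esub>"
  shows "\<exists>G\<in>algebra_hom K (sweedler_product K A H) E.
    \<forall>a\<in>carrier A. \<forall>h\<in>carrier H. G (sweedler_gen K A H a h) = \<beta> a h"
proof -
  interpret E: assoc_algebra K E by fact
  note EV = assoc_algebra_vectorspace[OF E]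
  obtain F where F: "F \<in> algebra_hom K T E"
    and F\<iota>: "\<And>v. v \<in> carrier V \<Longrightarrow> F (\<iota> v) = tensor_lift K E \<beta> v"
    using tensor_algebra_lift[OF V E tensor_lift_linear[OF A_vs H_vs EV \<beta>]] by blast
  note Fl = algebra_hom_linear[OF F]
  have F\<tau>: "F (\<tau> a h) = \<beta> a h" if "a \<in> carrier A" "h \<in> carrier H" for a h
    using that by (simp add: F\<iota> pure_tensor_mem[OF A_vs H_vs] tensor_lift_pure[OF A_vs H_vs EV \<beta>])
  have \<beta>mem: "\<beta> a h \<in> carrier E" if "a \<in> carrier A" "h \<in> carrier H" for a h
    by (rule bilinear_mem[OF \<beta> that])
  have "F x = \<zero>\<^bsub>E\<^esub>" if "x \<in> R'" for x
    using that unfolding sweedler_relations_def Let_def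
  proof (elim UnE CollectE exE conjE)
    fix a a' h assume x: "x = \<tau> (a \<otimes>\<^bsub>A\<^esub> a') h \<ominus>\<^bsub>T\<^esub>
        tensor_lift K T (\<lambda>x y. \<tau> a x \<otimes>\<^bsub>T\<^esub> \<tau> a' y) (comult H h)"
      and a: "a \<in> carrier A" "a' \<in> carrier A" and h: "h \<in> carrier H"
    have "F (tensor_lift K T (\<lambda>x y. \<tau> a x \<otimes>\<^bsub>T\<^esub> \<tau> a' y) (comult H h)) = tensor_lift K E (\<lambda>x y. \<beta> a x \<otimes>\<^bsub>E\<^esub> \<beta> a' y) (comult H h)"
      by (rule tensor_lift_comp_cong[OF H_vs H_vs T_vs EV \<tau>\<tau>[OF a] Fl H.comult_mem[OF h]])
        (simp add: algebra_hom_mult[OF F] mem a F\<tau>)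
    then have "F x = \<beta> (a \<otimes>\<^bsub>A\<^esub> a') h \<ominus>\<^bsub>E\<^esub> \<beta> (a \<otimes>\<^bsub>A\<^esub> a') h"
      unfolding x using a h by (simp add: module_hom_minus[OF T_vs EV Fl] mem F\<tau> mult)
    then show ?thesis using \<beta>mem a h by (simp add: E.r_neg a_minus_def)
  next
    fix h assume x: "x = \<tau> \<one>\<^bsub>A\<^esub> h \<ominus>\<^bsub>T\<^esub> counit H h \<odot>\<^bsub>T\<^esub> \<one>\<^bsub>T\<^esub>" and h: "h \<in> carrier H"
    have "F x = \<beta> \<one>\<^bsub>A\<^esub> h \<ominus>\<^bsub>E\<^esub> \<beta> \<one>\<^bsub>A\<^esub> h"
      unfolding x using h
      by (simp add: module_hom_minus[OF T_vs EV Fl] mem F\<tau> one module_hom_smult[OF Fl] cu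
          algebra_hom_one[OF F])
    then show ?thesis using \<beta>mem h by (simp add: E.r_neg a_minus_def)
  qed
  then have "F x = \<zero>\<^bsub>E\<^esub>" if "x \<in> J'" for x
    using algebra_hom_kernel_genideal[OF T E F R'_sub] that unfolding J' by blast
  from quotient_module_algebra_lift[OF T J'_ideal E F this] obtain G
    where "G \<in> algebra_hom K S E" "\<And>x. x \<in> carrier T \<Longrightarrow> G (J' +>\<^bsub>T\<^esub> x) = F x"
    unfolding sweedler_product_def by blast
  then show ?thesis
    by (intro bexI[of _ G]) (simp_all add: sweedler_gen_def mem F\<tau>)
qed

end

section \<open>Measurings into the convolution algebra\<close>

context
  fixes K :: "('k, 'm) ring_scheme" and A :: "('k, 'a, 'ma) module_scheme"
    and C :: "('k, 'c, 'mc) coalgebra_scheme" and H :: "('k, 'h, 'mh) coalgebra_scheme"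
  assumes A: "assoc_algebra K A" and C: "coalgebra K C" and H: "coalgebra K H"
begin

interpretation A: assoc_algebra K A by (rule A)
interpretation C: coalgebra K C by (rule C)
interpretation H: coalgebra K H by (rule H)

private abbreviation (input) "kalg \<equiv> base_algebra K"
private abbreviation (input) "SP \<equiv> sweedler_product K A C"
private abbreviation (input) "CA \<equiv> convolution_algebra K C kalg"
private abbreviation (input) "\<gamma> \<equiv> sweedler_gen K A C"

private lemma kalg: "assoc_algebra K kalg" by (rule assoc_algebra_base_algebra[OF A.field_axioms])

private lemmas vs_k = assoc_algebra_vectorspace[OF kalg]
private lemmas vs_A = assoc_algebra_vectorspace[OF A]
private lemmas vs_C = C.vectorspace_axioms
private lemmas vs_H = H.vectorspace_axioms
private lemmas vs_CA = vectorspace_convolution_algebra[OF vs_C vs_k]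
private lemmas SP = assoc_algebra_sweedler_product[OF A C]
private lemmas vs_SP = assoc_algebra_vectorspace[OF SP]
private lemmas CA = assoc_algebra_convolution_algebra[OF C kalg]

private lemma eval_CA: "c \<in> carrier C \<Longrightarrow> (\<lambda>f. f c) \<in> module_hom K CA kalg"
  by (rule module_homI) (auto dest: module_hom_mem)

text \<open>The product of [C,k] is itself a Sweedler sum, so evaluating the measuring identity at
  \<open>c\<close> produces a double sum in which \<open>H\<close> and \<open>C\<close> play
  symmetric parts.\<close>

private lemma convolution_apply:
  assumes \<rho>: "measuring K H A CA \<rho>" and h: "h \<in> carrier H"
    and a: "a \<in> carrier A" "a' \<in> carrier A" and c: "c \<in> carrier C"
  shows "\<rho> h (a \<otimes>\<^bsub>A\<^esub> a') c = tensor_lift K kalg (\<lambda>u v. tensor_lift K kalg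
    (\<lambda>x y. \<rho> u a x \<otimes>\<^bsub>K\<^esub> \<rho> v a' y) (comult C c)) (comult H h)"
proof -
  note bil = bilinear_measuring[OF CA \<rho> a]
  have "\<rho> h (a \<otimes>\<^bsub>A\<^esub> a') c = tensor_lift K CA (\<lambda>u v. \<rho> u a \<otimes>\<^bsub>CA\<^esub> \<rho> v a') (comult H h) c"
    by (simp only: measuring_mult[OF \<rho> h a])
  also have "\<dots> = tensor_lift K kalg (\<lambda>u v. (\<rho> u a \<otimes>\<^bsub>CA\<^esub> \<rho> v a') c) (comult H h)"
    by (rule tensor_lift_comp[OF vs_H vs_H vs_CA vs_k bil eval_CA[OF c] H.comult_mem[OF h]])
  finally show ?thesis using c by simp
qed

text \<open>The defining relation of the Sweedler product expands \<open>\<kappa> h\<close> of a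
  generator into a sum over the components of \<open>c\<close>, and multiplicativity of
  \<open>\<kappa>\<close> expands each summand over those of \<open>h\<close>. Exchanging the sums
  gives the product of [C,k] inside and the sum over \<open>h\<close> outside.\<close>

lemma measuring_sweedler_product_restrict:
  assumes \<kappa>: "measuring K H (sweedler_product K A C) (base_algebra K) \<kappa>"
  shows "measuring K H A (convolution_algebra K C (base_algebra K))
    (\<lambda>h. \<lambda>a\<in>carrier A. \<lambda>c\<in>carrier C. \<kappa> h (sweedler_gen K A C a c))"
    (is "measuring K H A _ ?\<rho>")
proof -
  note b\<gamma> = bilinear_sweedler_gen[OF A C]
  have \<gamma>mem: "\<gamma> a c \<in> carrier SP" if "a \<in> carrier A" "c \<in> carrier C" for a c
    by (rule bilinear_mem[OF b\<gamma> that])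
  have row: "(\<lambda>c\<in>carrier C. \<kappa> h (\<gamma> a c)) \<in> carrier CA" if "h \<in> carrier H" "a \<in> carrier A" for h a
    using module_hom_restrict[OF module_hom_comp[OF measuring_hom[OF \<kappa> that(1)]
          bilinear_right[OF b\<gamma> that(2)]] vs_C] by simp
  have inner: "(\<lambda>a. \<lambda>c\<in>carrier C. \<kappa> h (\<gamma> a c)) \<in> module_hom K A CA" if h: "h \<in> carrier H" for h
    unfolding module_hom_hom_space_convolution
    by (rule curry_linear[OF vs_C vs_k])
      (intro module_hom_comp[OF measuring_hom[OF \<kappa> h]] bilinear_left[OF b\<gamma>] bilinear_right[OF b\<gamma>];
        assumption)+
  have outer: "?\<rho> \<in> module_hom K H (hom_space K A CA)"
  proof (rule curry_linear[OF vs_A vs_CA _ inner])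
    fix a assume a: "a \<in> carrier A"
    show "(\<lambda>h. \<lambda>c\<in>carrier C. \<kappa> h (\<gamma> a c)) \<in> module_hom K H CA"
      unfolding module_hom_hom_space_convolution
      by (rule curry_linear[OF vs_C vs_k])
        (use measuring_apply[OF \<kappa> \<gamma>mem[OF a]] module_hom_comp[OF measuring_hom[OF \<kappa>]
            bilinear_right[OF b\<gamma> a]] in blast)+
  qed
  show ?thesis
    unfolding measuring_def
  proof (intro conjI ballI)
    show "?\<rho> \<in> module_hom K H (hom_space K A CA)" by (rule outer)
    fix h assume h: "h \<in> carrier H"
    have eps: "counit H h \<in> carrier K" using module_hom_mem[OF H.counit_linear h] by simp
    show "?\<rho> h \<one>\<^bsub>A\<^esub> = counit H h \<odot>\<^bsub>CA\<^esub> \<one>\<^bsub>CA\<^esub>"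
    proof -
      have "\<kappa> h (\<gamma> \<one>\<^bsub>A\<^esub> c) = counit H h \<otimes>\<^bsub>K\<^esub> (counit C c \<otimes>\<^bsub>K\<^esub> \<one>\<^bsub>K\<^esub>)" if c: "c \<in> carrier C" for c
      proof -
        have ec: "counit C c \<in> carrier K" using module_hom_mem[OF C.counit_linear c] by simp
        interpret SP: assoc_algebra K SP by (rule SP)
        show ?thesis
          using module_hom_smult[OF measuring_hom[OF \<kappa> h] ec SP.one_closed]
            measuring_one[OF \<kappa> h] eps ec
          by (simp add: sweedler_gen_one[OF A C c] A.R.m_ac)
      qed
      then show ?thesis using A.one_closed by (simp add: restrict_def fun_eq_iff)
    qed
    fix a a' assume a: "a \<in> carrier A" "a' \<in> carrier A"
    have bil: "bilinear K H H CA (\<lambda>x y. ?\<rho> x a \<otimes>\<^bsub>CA\<^esub> ?\<rho> y a')"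
      using bilinear_mult_pair[OF CA module_hom_comp[OF eval_linear[OF a(1)] outer]
          module_hom_comp[OF eval_linear[OF a(2)] outer]] .
    show "?\<rho> h (a \<otimes>\<^bsub>A\<^esub> a') = tensor_lift K CA (\<lambda>x y. ?\<rho> x a \<otimes>\<^bsub>CA\<^esub> ?\<rho> y a') (comult H h)"
      (is "_ = ?r")
    proof (rule extensionalityI[of _ "carrier C"])
      show "?\<rho> h (a \<otimes>\<^bsub>A\<^esub> a') \<in> extensional (carrier C)" using a by simp
      show "?r \<in> extensional (carrier C)"
        using tensor_lift_mem[OF vs_H vs_H vs_CA bil H.comult_mem[OF h]] by simp
      fix c assume c: "c \<in> carrier C"
      have g1: "bilinear K C C SP (\<lambda>x y. \<gamma> a x \<otimes>\<^bsub>SP\<^esub> \<gamma> a' y)"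
        by (rule bilinear_mult_pair[OF SP bilinear_right[OF b\<gamma> a(1)] bilinear_right[OF b\<gamma> a(2)]])
      have k1: "bilinear K H H kalg (\<lambda>u v. \<kappa> u (\<gamma> a x) \<otimes>\<^bsub>K\<^esub> \<kappa> v (\<gamma> a' y))"
        if "x \<in> carrier C" "y \<in> carrier C" for x y
        using bilinear_measuring[OF kalg \<kappa> \<gamma>mem[OF a(1) that(1)] \<gamma>mem[OF a(2) that(2)]] by simp
      have k2: "bilinear K C C kalg (\<lambda>x y. \<kappa> u (\<gamma> a x) \<otimes>\<^bsub>K\<^esub> \<kappa> v (\<gamma> a' y))"
        if "u \<in> carrier H" "v \<in> carrier H" for u v
        using bilinear_mult_pair[OF kalg module_hom_comp[OF measuring_hom[OF \<kappa> that(1)] bilinear_right[OF b\<gamma> a(1)]]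
            module_hom_comp[OF measuring_hom[OF \<kappa> that(2)] bilinear_right[OF b\<gamma> a(2)]]] by simp
      have "?\<rho> h (a \<otimes>\<^bsub>A\<^esub> a') c = \<kappa> h (tensor_lift K SP (\<lambda>x y. \<gamma> a x \<otimes>\<^bsub>SP\<^esub> \<gamma> a' y) (comult C c))"
        using a c by (simp add: sweedler_gen_mult[OF A C a c])
      also have "\<dots> = tensor_lift K kalg (\<lambda>x y. tensor_lift K kalg
          (\<lambda>u v. \<kappa> u (\<gamma> a x) \<otimes>\<^bsub>K\<^esub> \<kappa> v (\<gamma> a' y)) (comult H h)) (comult C c)"
        by (rule tensor_lift_comp_cong[OF vs_C vs_C vs_SP vs_k g1 measuring_hom[OF \<kappa> h] C.comult_mem[OF c]])
          (use measuring_mult[OF \<kappa> h \<gamma>mem[OF a(1)] \<gamma>mem[OF a(2)]] in simp)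
      \<comment> \<open>Before the exchange the sum over \<open>C\<close> is outside, as the
        relations of the Sweedler product dictate; the measuring identity needs the sum over
        \<open>H\<close> outside.\<close>
      also have "\<dots> = tensor_lift K kalg (\<lambda>u v. tensor_lift K kalg
          (\<lambda>x y. \<kappa> u (\<gamma> a x) \<otimes>\<^bsub>K\<^esub> \<kappa> v (\<gamma> a' y)) (comult C c)) (comult H h)"
        by (rule tensor_lift_swap[OF vs_C vs_C vs_H vs_H vs_k C.comult_mem[OF c] H.comult_mem[OF h] k1 k2])
      also have "\<dots> = tensor_lift K kalg (\<lambda>u v. (?\<rho> u a \<otimes>\<^bsub>CA\<^esub> ?\<rho> v a') c) (comult H h)"
      proof (rule tensor_lift_cong[OF vs_H vs_H vs_k bilinear_comp[OF bil eval_CA[OF c]] H.comult_mem[OF h], symmetric])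
        fix u v assume uv: "u \<in> carrier H" "v \<in> carrier H"
        have "tensor_lift K kalg (\<lambda>x y. \<kappa> u (\<gamma> a x) \<otimes>\<^bsub>K\<^esub> \<kappa> v (\<gamma> a' y)) (comult C c) =
          tensor_lift K kalg (\<lambda>x y. ?\<rho> u a x \<otimes>\<^bsub>K\<^esub> ?\<rho> v a' y) (comult C c)"
          by (rule tensor_lift_cong[OF vs_C vs_C vs_k k2[OF uv] C.comult_mem[OF c]]) (simp add: a)
        then show "(?\<rho> u a \<otimes>\<^bsub>CA\<^esub> ?\<rho> v a') c =
            tensor_lift K kalg (\<lambda>x y. \<kappa> u (\<gamma> a x) \<otimes>\<^bsub>K\<^esub> \<kappa> v (\<gamma> a' y)) (comult C c)"
          using c by simp
      qed
      also have "\<dots> = ?r c"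
        by (rule tensor_lift_comp[OF vs_H vs_H vs_CA vs_k bil eval_CA[OF c] H.comult_mem[OF h], symmetric])
      finally show "?\<rho> h (a \<otimes>\<^bsub>A\<^esub> a') c = ?r c" .
    qed
  qed
qed

text \<open>For fixed \<open>a\<close> and \<open>c\<close> the function sending \<open>h\<close> to
  \<open>\<rho> h a c\<close> belongs to [H,k]. After exchanging the two sums, this assignment
  satisfies the measuring identities of \<open>C\<close> from \<open>A\<close> to [H,k], so it
  extends to an algebra homomorphism from the Sweedler product to [H,k]. Its transpose is
  \<open>\<kappa>\<close>.\<close>

lemma measuring_sweedler_product_extend:
  assumes \<rho>: "measuring K H A (convolution_algebra K C (base_algebra K)) \<rho>"
  shows "\<exists>\<kappa>. measuring K H (sweedler_product K A C) (base_algebra K) \<kappa> \<and>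
    (\<forall>h\<in>carrier H. \<forall>a\<in>carrier A. \<forall>c\<in>carrier C. \<kappa> h (sweedler_gen K A C a c) = \<rho> h a c)"
proof -
  let ?E = "convolution_algebra K H kalg"
  note E = assoc_algebra_convolution_algebra[OF H kalg]
  note EV = assoc_algebra_vectorspace[OF E]
  have eval_E: "(\<lambda>f. f h) \<in> module_hom K ?E kalg" if "h \<in> carrier H" for h
    by (rule module_homI) (use that in \<open>auto dest: module_hom_mem\<close>)
  have mem: "\<rho> h a \<in> carrier CA" if "h \<in> carrier H" "a \<in> carrier A" for h a
    by (rule measuring_mem[OF \<rho> that])
  have lin_h: "(\<lambda>h. \<rho> h a c) \<in> module_hom K H kalg" if "a \<in> carrier A" "c \<in> carrier C" for a c
    by (rule module_hom_comp[OF eval_CA[OF that(2)] measuring_apply[OF \<rho> that(1)]])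
  have lin_a: "(\<lambda>a. \<rho> h a c) \<in> module_hom K A kalg" if "h \<in> carrier H" "c \<in> carrier C" for h c
    by (rule module_hom_comp[OF eval_CA[OF that(2)] measuring_hom[OF \<rho> that(1)]])
  have lin_c: "\<rho> h a \<in> module_hom K C kalg" if "h \<in> carrier H" "a \<in> carrier A" for h a
    using mem[OF that] by simp
  define \<beta> where "\<beta> a c = (\<lambda>h\<in>carrier H. \<rho> h a c)" for a c
  have \<beta>_app: "\<beta> a c h = \<rho> h a c" if "h \<in> carrier H" for a c h using that by (simp add: \<beta>_def)
  have \<beta>: "bilinear K A C ?E \<beta>"
    unfolding \<beta>_def
    by (rule bilinearI; unfold module_hom_hom_space_convolution; rule curry_linear[OF vs_H vs_k])
      (blast intro: lin_h lin_a lin_c)+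
  have bil: "bilinear K C C ?E (\<lambda>x y. \<beta> a x \<otimes>\<^bsub>?E\<^esub> \<beta> a' y)" if "a \<in> carrier A" "a' \<in> carrier A" for a a'
    by (rule bilinear_mult_pair[OF E bilinear_right[OF \<beta> that(1)] bilinear_right[OF \<beta> that(2)]])
  have \<beta>_mult: "\<beta> (a \<otimes>\<^bsub>A\<^esub> a') c = tensor_lift K ?E (\<lambda>x y. \<beta> a x \<otimes>\<^bsub>?E\<^esub> \<beta> a' y) (comult C c)"
    (is "_ = ?r") if a: "a \<in> carrier A" "a' \<in> carrier A" and c: "c \<in> carrier C" for a a' c
  proof (rule extensionalityI[of _ "carrier H"])
    show "\<beta> (a \<otimes>\<^bsub>A\<^esub> a') c \<in> extensional (carrier H)" by (simp add: \<beta>_def)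
    show "?r \<in> extensional (carrier H)"
      using tensor_lift_mem[OF vs_C vs_C EV bil[OF a] C.comult_mem[OF c]] by simp
    fix h assume h: "h \<in> carrier H"
    have k1: "bilinear K C C kalg (\<lambda>x y. \<rho> u a x \<otimes>\<^bsub>K\<^esub> \<rho> v a' y)" if "u \<in> carrier H" "v \<in> carrier H" for u v
      using bilinear_mult_pair[OF kalg lin_c[OF that(1) a(1)] lin_c[OF that(2) a(2)]] by simp
    have k2: "bilinear K H H kalg (\<lambda>u v. \<rho> u a x \<otimes>\<^bsub>K\<^esub> \<rho> v a' y)" if "x \<in> carrier C" "y \<in> carrier C" for x y
      using bilinear_mult_pair[OF kalg lin_h[OF a(1) that(1)] lin_h[OF a(2) that(2)]] by simp
    have "\<beta> (a \<otimes>\<^bsub>A\<^esub> a') c h = \<rho> h (a \<otimes>\<^bsub>A\<^esub> a') c" by (rule \<beta>_app[OF h])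
    also have "\<dots> = tensor_lift K kalg (\<lambda>u v. tensor_lift K kalg
        (\<lambda>x y. \<rho> u a x \<otimes>\<^bsub>K\<^esub> \<rho> v a' y) (comult C c)) (comult H h)"
      by (rule convolution_apply[OF \<rho> h a c])
    also have "\<dots> = tensor_lift K kalg (\<lambda>x y. tensor_lift K kalg
        (\<lambda>u v. \<rho> u a x \<otimes>\<^bsub>K\<^esub> \<rho> v a' y) (comult H h)) (comult C c)"
      by (rule tensor_lift_swap[OF vs_H vs_H vs_C vs_C vs_k H.comult_mem[OF h] C.comult_mem[OF c] k1 k2])
    also have "\<dots> = tensor_lift K kalg (\<lambda>x y. (\<beta> a x \<otimes>\<^bsub>?E\<^esub> \<beta> a' y) h) (comult C c)"
    proof (rule tensor_lift_cong[OF vs_C vs_C vs_k bilinear_comp[OF bil[OF a] eval_E[OF h]] C.comult_mem[OF c], symmetric])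
      fix x y assume xy: "x \<in> carrier C" "y \<in> carrier C"
      have "tensor_lift K kalg (\<lambda>u v. \<rho> u a x \<otimes>\<^bsub>K\<^esub> \<rho> v a' y) (comult H h) =
          tensor_lift K kalg (\<lambda>u v. \<beta> a x u \<otimes>\<^bsub>K\<^esub> \<beta> a' y v) (comult H h)"
        by (rule tensor_lift_cong[OF vs_H vs_H vs_k k2[OF xy] H.comult_mem[OF h]]) (simp add: \<beta>_app)
      then show "(\<beta> a x \<otimes>\<^bsub>?E\<^esub> \<beta> a' y) h = tensor_lift K kalg (\<lambda>u v. \<rho> u a x \<otimes>\<^bsub>K\<^esub> \<rho> v a' y) (comult H h)"
        using h by simp
    qed
    also have "\<dots> = ?r h"
      by (rule tensor_lift_comp[OF vs_C vs_C EV vs_k bil[OF a] eval_E[OF h] C.comult_mem[OF c], symmetric])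
    finally show "\<beta> (a \<otimes>\<^bsub>A\<^esub> a') c h = ?r h" .
  qed
  have \<beta>_one: "\<beta> \<one>\<^bsub>A\<^esub> c = counit C c \<odot>\<^bsub>?E\<^esub> \<one>\<^bsub>?E\<^esub>" if c: "c \<in> carrier C" for c
  proof -
    have ec: "counit C c \<in> carrier K" using module_hom_mem[OF C.counit_linear c] by simp
    have "\<rho> h \<one>\<^bsub>A\<^esub> c = counit C c \<otimes>\<^bsub>K\<^esub> (counit H h \<otimes>\<^bsub>K\<^esub> \<one>\<^bsub>K\<^esub>)" if h: "h \<in> carrier H" for h
      using measuring_one[OF \<rho> h] ec c module_hom_mem[OF H.counit_linear h] by (simp add: A.R.m_ac)
    then show ?thesis by (simp add: \<beta>_def restrict_def fun_eq_iff)
  qed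
  obtain G where G: "G \<in> algebra_hom K SP ?E"
    and G_gen: "\<And>a c. \<lbrakk>a \<in> carrier A; c \<in> carrier C\<rbrakk> \<Longrightarrow> G (\<gamma> a c) = \<beta> a c"
    using sweedler_product_lift[OF A C E \<beta> \<beta>_mult \<beta>_one] by blast
  note Gl = algebra_hom_linear[OF G]
  interpret SP: assoc_algebra K SP by (rule SP)
  have G_hom: "G s \<in> module_hom K H kalg" if "s \<in> carrier SP" for s
    using module_hom_mem[OF Gl that] by simp
  \<comment> \<open>The product and unit of [H,k] are the right-hand sides of the measuring
    identities, so transposing the homomorphism \<open>G\<close> yields a measuring without further
    computation.\<close>
  let ?\<kappa> = "\<lambda>h. \<lambda>s\<in>carrier SP. G s h"
  have "measuring K H SP kalg ?\<kappa>"
    unfolding measuring_def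
  proof (intro conjI ballI)
    show "?\<kappa> \<in> module_hom K H (hom_space K SP kalg)"
      by (rule curry_linear[OF vs_SP vs_k]) (use G_hom module_hom_comp[OF eval_E Gl] in blast)+
    fix h assume h: "h \<in> carrier H"
    show "?\<kappa> h \<one>\<^bsub>SP\<^esub> = counit H h \<odot>\<^bsub>kalg\<^esub> \<one>\<^bsub>kalg\<^esub>"
      using h by (simp add: algebra_hom_one[OF G])
    fix s t assume st: "s \<in> carrier SP" "t \<in> carrier SP"
    have "?\<kappa> h (s \<otimes>\<^bsub>SP\<^esub> t) = tensor_lift K kalg (\<lambda>x y. G s x \<otimes>\<^bsub>kalg\<^esub> G t y) (comult H h)"
      using h st by (simp add: algebra_hom_mult[OF G])
    then show "?\<kappa> h (s \<otimes>\<^bsub>SP\<^esub> t) = tensor_lift K kalg (\<lambda>x y. ?\<kappa> x s \<otimes>\<^bsub>kalg\<^esub> ?\<kappa> y t) (comult H h)"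
      using st by simp
  qed
  moreover have "?\<kappa> h (\<gamma> a c) = \<rho> h a c" if "h \<in> carrier H" "a \<in> carrier A" "c \<in> carrier C" for h a c
    using that bilinear_mem[OF bilinear_sweedler_gen[OF A C]] by (simp add: G_gen \<beta>_app)
  ultimately show ?thesis by blast
qed

text \<open>Agreement on generators propagates because the elements on which \<open>\<kappa>\<close>
  and \<open>\<mu>\<close> agree form a unital subalgebra.\<close>

lemma measuring_sweedler_product_ext:
  assumes \<kappa>: "measuring K H (sweedler_product K A C) (base_algebra K) \<kappa>"
    and \<mu>: "measuring K H (sweedler_product K A C) (base_algebra K) \<mu>"
    and eq: "\<And>h a c. \<lbrakk>h \<in> carrier H; a \<in> carrier A; c \<in> carrier C\<rbrakk> \<Longrightarrow>
      \<kappa> h (sweedler_gen K A C a c) = \<mu> h (sweedler_gen K A C a c)"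
    and h: "h \<in> carrier H"
  shows "\<kappa> h = \<mu> h"
proof -
  interpret SP: assoc_algebra K SP by (rule SP)
  \<comment> \<open>Agreement is required for all \<open>h\<close> at once: at a product, the value
    for one \<open>h\<close> involves the values of both factors for the components of
    \<open>comult H h\<close>.\<close>
  let ?M = "{s \<in> carrier SP. \<forall>h\<in>carrier H. \<kappa> h s = \<mu> h s}"
  have mult: "\<kappa> h (s \<otimes>\<^bsub>SP\<^esub> t) = \<mu> h (s \<otimes>\<^bsub>SP\<^esub> t)"
    if s: "s \<in> ?M" and t: "t \<in> ?M" and h: "h \<in> carrier H" for s t h
  proof -
    have sc: "s \<in> carrier SP" "t \<in> carrier SP" using s t by blast+
    have "tensor_lift K kalg (\<lambda>x y. \<kappa> x s \<otimes>\<^bsub>kalg\<^esub> \<kappa> y t) (comult H h) =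
        tensor_lift K kalg (\<lambda>x y. \<mu> x s \<otimes>\<^bsub>kalg\<^esub> \<mu> y t) (comult H h)"
      by (rule tensor_lift_cong[OF vs_H vs_H vs_k bilinear_measuring[OF kalg \<kappa> sc] H.comult_mem[OF h]])
        (use s t in simp)
    then show ?thesis by (simp add: measuring_mult[OF \<kappa> h sc] measuring_mult[OF \<mu> h sc])
  qed
  have "unital_subalgebra K SP ?M"
    unfolding unital_subalgebra_def
  proof (intro conjI ballI)
    show "\<one>\<^bsub>SP\<^esub> \<in> ?M" by (simp add: measuring_one[OF \<kappa>] measuring_one[OF \<mu>])
    show "s \<otimes>\<^bsub>SP\<^esub> t \<in> ?M" if "s \<in> ?M" "t \<in> ?M" for s t
      using mult[OF that] that SP.m_closed by blast
    show "s \<oplus>\<^bsub>SP\<^esub> t \<in> ?M" if "s \<in> ?M" "t \<in> ?M" for s t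
      using that by (simp add: module_hom_add[OF measuring_hom[OF \<kappa>]] module_hom_add[OF measuring_hom[OF \<mu>]])
    show "a \<odot>\<^bsub>SP\<^esub> s \<in> ?M" if "a \<in> carrier K" "s \<in> ?M" for a s
      using that by (simp add: module_hom_smult[OF measuring_hom[OF \<kappa>]] module_hom_smult[OF measuring_hom[OF \<mu>]])
  qed
  from sweedler_product_generated[OF A C this]
  have "carrier SP \<subseteq> ?M" using eq bilinear_mem[OF bilinear_sweedler_gen[OF A C]] by blast
  then have "\<kappa> h s = \<mu> h s" if "s \<in> carrier SP" for s using that h by blast
  then show ?thesis
    by (intro extensionalityI[OF measuring_ext[OF \<kappa> h] measuring_ext[OF \<mu> h]])
qed

end

text \<open>Identifies P(A,[C,k]) with the dual of the Sweedler product for any coalgebra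
  \<open>C\<close> and any type of test coalgebras. A measuring \<open>\<rho>\<close> extends to the
  Sweedler product, and this extension is the desired coalgebra map to the dual by
  \<open>measuring_dual_hom\<close>; uniqueness comes from generation.\<close>

theorem universal_measuring_sweedler_dual:
  fixes K :: "('k, 'm) ring_scheme" and C :: "('k, 'c, 'mc) coalgebra_scheme"
  assumes A: "assoc_algebra K A" and C: "coalgebra K C"
  shows "universal_measuring_coalgebra TYPE('h) K A (convolution_algebra K C (base_algebra K))
    (dual_coalgebra K (sweedler_product K A C))
    (\<lambda>f. \<lambda>a\<in>carrier A. \<lambda>c\<in>carrier C. f (sweedler_gen K A C a c))"
    (is "universal_measuring_coalgebra _ _ _ ?CA ?D ?\<pi>")
  unfolding universal_measuring_coalgebra_def
proof (intro conjI allI impI)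
  let ?S = "sweedler_product K A C" and ?k = "base_algebra K"
  note S = assoc_algebra_sweedler_product[OF A C]
  interpret A: assoc_algebra K A by fact
  have k: "assoc_algebra K ?k" by (rule assoc_algebra_base_algebra[OF A.field_axioms])
  show D: "coalgebra K ?D" by (rule coalgebra_dual_coalgebra[OF S])
  show "measuring K ?D A ?CA ?\<pi>"
    by (rule measuring_sweedler_product_restrict[OF A C D measuring_dual_eval[OF S]])
  fix H :: "('k, 'h) coalgebra" and \<rho>
  assume "coalgebra K H \<and> measuring K H A ?CA \<rho>"
  then have H: "coalgebra K H" and \<rho>: "measuring K H A ?CA \<rho>" by auto
  have \<rho>_ext: "\<rho> h \<in> extensional (carrier A)" "a \<in> carrier A \<Longrightarrow> \<rho> h a \<in> extensional (carrier C)"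
    if "h \<in> carrier H" for h a
    using measuring_ext[OF \<rho> that] measuring_mem[OF \<rho> that, of a] by auto
  obtain \<kappa> where \<kappa>: "measuring K H ?S ?k \<kappa>"
    and \<kappa>_gen: "\<And>h a c. \<lbrakk>h \<in> carrier H; a \<in> carrier A; c \<in> carrier C\<rbrakk> \<Longrightarrow>
      \<kappa> h (sweedler_gen K A C a c) = \<rho> h a c"
    using measuring_sweedler_product_extend[OF A C H \<rho>] by blast
  show "\<exists>!\<phi>. \<phi> \<in> coalgebra_hom K H ?D \<inter> extensional (carrier H) \<and> (\<forall>h\<in>carrier H. ?\<pi> (\<phi> h) = \<rho> h)"
  proof (rule ex1I)
    have "?\<pi> (\<kappa> h) = \<rho> h" if h: "h \<in> carrier H" for h
    proof (rule extensionalityI[OF _ \<rho>_ext(1)[OF h]])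
      show "?\<pi> (\<kappa> h) a = \<rho> h a" if a: "a \<in> carrier A" for a
        by (rule extensionalityI[OF _ \<rho>_ext(2)[OF h a]]) (use a h \<kappa>_gen in auto)
    qed simp
    then show "restrict \<kappa> (carrier H) \<in> coalgebra_hom K H ?D \<inter> extensional (carrier H) \<and>
        (\<forall>h\<in>carrier H. ?\<pi> (restrict \<kappa> (carrier H) h) = \<rho> h)"
      using coalgebra_hom_restrict[OF H D measuring_dual_hom[OF H S \<kappa>]] by simp
  next
    fix \<phi> assume \<phi>: "\<phi> \<in> coalgebra_hom K H ?D \<inter> extensional (carrier H) \<and> (\<forall>h\<in>carrier H. ?\<pi> (\<phi> h) = \<rho> h)"
    \<comment> \<open>A coalgebra map to the dual is itself a measuring of \<open>H\<close> from the
      Sweedler product to the ground field, so it can be compared with \<open>\<kappa>\<close> on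
      generators.\<close>
    then have \<phi>': "measuring K H ?S ?k \<phi>"
      using measuring_comp[OF H D k _ measuring_dual_eval[OF S]] by blast
    have "\<phi> h = \<kappa> h" if h: "h \<in> carrier H" for h
    proof (rule measuring_sweedler_product_ext[OF A C H \<phi>' \<kappa> _ h])
      fix h a c assume *: "h \<in> carrier H" "a \<in> carrier A" "c \<in> carrier C"
      then have "?\<pi> (\<phi> h) a c = \<rho> h a c" using \<phi> by simp
      then show "\<phi> h (sweedler_gen K A C a c) = \<kappa> h (sweedler_gen K A C a c)"
        using * \<kappa>_gen by simp
    qed
    then show "\<phi> = restrict \<kappa> (carrier H)"
      using \<phi> by (intro extensionalityI[of _ "carrier H"]) auto
  qed
qed

section \<open>Finite-dimensional algebras\<close>

lemma measuring_algebra_hom: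
  assumes H: "coalgebra K H" and A: "assoc_algebra K A" and B: "assoc_algebra K B" and B': "assoc_algebra K B'"
    and \<rho>: "measuring K H A B \<rho>" and \<theta>: "\<theta> \<in> algebra_hom K B B'"
  shows "measuring K H A B' (\<lambda>h. \<lambda>a\<in>carrier A. \<theta> (\<rho> h a))"
  unfolding measuring_def
proof (intro conjI ballI)
  interpret H: coalgebra K H by fact
  interpret A: assoc_algebra K A by fact
  interpret B: assoc_algebra K B by fact
  note AV = assoc_algebra_vectorspace[OF A] and BV = assoc_algebra_vectorspace[OF B]
    and B'V = assoc_algebra_vectorspace[OF B'] and HV = H.vectorspace_axioms
  note \<theta>l = algebra_hom_linear[OF \<theta>]
  show "(\<lambda>h. \<lambda>a\<in>carrier A. \<theta> (\<rho> h a)) \<in> module_hom K H (hom_space K A B')"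
    by (rule curry_linear[OF AV B'V])
      (use module_hom_comp[OF \<theta>l measuring_apply[OF \<rho>]] module_hom_comp[OF \<theta>l measuring_hom[OF \<rho>]] in blast)+
  fix h assume h: "h \<in> carrier H"
  have "counit H h \<in> carrier K" using module_hom_mem[OF H.counit_linear h] by simp
  then show "(\<lambda>a\<in>carrier A. \<theta> (\<rho> h a)) \<one>\<^bsub>A\<^esub> = counit H h \<odot>\<^bsub>B'\<^esub> \<one>\<^bsub>B'\<^esub>"
    by (simp add: measuring_one[OF \<rho> h] module_hom_smult[OF \<theta>l] algebra_hom_one[OF \<theta>])
  fix a a' assume a: "a \<in> carrier A" "a' \<in> carrier A"
  note bil = bilinear_measuring[OF B \<rho> a]
  have "\<theta> (\<rho> h (a \<otimes>\<^bsub>A\<^esub> a')) = tensor_lift K B' (\<lambda>x y. \<theta> (\<rho> x a) \<otimes>\<^bsub>B'\<^esub> \<theta> (\<rho> y a')) (comult H h)"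
    unfolding measuring_mult[OF \<rho> h a]
    by (rule tensor_lift_comp_cong[OF HV HV BV B'V bil \<theta>l H.comult_mem[OF h]])
      (rule algebra_hom_mult[OF \<theta> measuring_mem[OF \<rho> _ a(1)] measuring_mem[OF \<rho> _ a(2)]])
  then show "(\<lambda>a\<in>carrier A. \<theta> (\<rho> h a)) (a \<otimes>\<^bsub>A\<^esub> a') = tensor_lift K B'
      (\<lambda>x y. (\<lambda>a\<in>carrier A. \<theta> (\<rho> x a)) a \<otimes>\<^bsub>B'\<^esub> (\<lambda>a\<in>carrier A. \<theta> (\<rho> y a)) a') (comult H h)"
    using a by simp
qed

lemma algebra_hom_inverse:
  assumes B: "assoc_algebra K B" and \<theta>: "\<theta> \<in> algebra_hom K B B'"
    and bij: "bij_betw \<theta> (carrier B) (carrier B')"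
  shows "inv_into (carrier B) \<theta> \<in> algebra_hom K B' B"
proof -
  interpret B: assoc_algebra K B by fact
  let ?i = "inv_into (carrier B) \<theta>"
  note \<theta>l = algebra_hom_linear[OF \<theta>]
  have i: "?i y \<in> carrier B" "\<theta> (?i y) = y" if "y \<in> carrier B'" for y
    using bij that by (auto simp: bij_betw_def inv_into_into f_inv_into_f)
  have eqI: "?i y = x" if "x \<in> carrier B" "\<theta> x = y" for x y
    using bij that by (auto simp: bij_betw_def)
  have "?i (x \<otimes>\<^bsub>B'\<^esub> y) = ?i x \<otimes>\<^bsub>B\<^esub> ?i y" if "x \<in> carrier B'" "y \<in> carrier B'" for x y
    by (rule eqI) (simp_all add: i that algebra_hom_mult[OF \<theta>])
  moreover have "?i \<one>\<^bsub>B'\<^esub> = \<one>\<^bsub>B\<^esub>" by (rule eqI) (simp_all add: algebra_hom_one[OF \<theta>])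
  moreover have "?i \<in> module_hom K B' B"
  proof (rule module_homI[OF i(1)])
    show "?i (x \<oplus>\<^bsub>B'\<^esub> y) = ?i x \<oplus>\<^bsub>B\<^esub> ?i y" if "x \<in> carrier B'" "y \<in> carrier B'" for x y
      by (rule eqI) (simp_all add: i that module_hom_add[OF \<theta>l])
    show "?i (a \<odot>\<^bsub>B'\<^esub> x) = a \<odot>\<^bsub>B\<^esub> ?i x" if "a \<in> carrier K" "x \<in> carrier B'" for a x
      by (rule eqI) (simp_all add: i that module_hom_smult[OF \<theta>l])
  qed
  ultimately show ?thesis by (simp add: algebra_hom_def)
qed

text \<open>Composition with \<open>\<theta>\<close> and with its inverse matches the measurings
  into \<open>B\<close> with those into \<open>B'\<close>. The coalgebra \<open>R\<close> and the
  factoring maps stay the same, and only the universal measuring is changed.\<close>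

lemma universal_measuring_transfer:
  fixes K :: "('k, 'm) ring_scheme"
  assumes A: "assoc_algebra K A" and B: "assoc_algebra K B" and B': "assoc_algebra K B'"
    and \<theta>: "\<theta> \<in> algebra_hom K B B'" and bij: "bij_betw \<theta> (carrier B) (carrier B')"
    and R: "universal_measuring_coalgebra TYPE('h) K A B R \<pi>"
  shows "universal_measuring_coalgebra TYPE('h) K A B' R (\<lambda>r. \<lambda>a\<in>carrier A. \<theta> (\<pi> r a))"
  unfolding universal_measuring_coalgebra_def
proof (intro conjI allI impI)
  have cR: "coalgebra K R" and mR: "measuring K R A B \<pi>"
    using R by (auto simp: universal_measuring_coalgebra_def)
  show "coalgebra K R" by (rule cR)
  show "measuring K R A B' (\<lambda>r. \<lambda>a\<in>carrier A. \<theta> (\<pi> r a))"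
    by (rule measuring_algebra_hom[OF cR A B B' mR \<theta>])
  fix H :: "('k, 'h) coalgebra" and \<rho>
  assume "coalgebra K H \<and> measuring K H A B' \<rho>"
  then have H: "coalgebra K H" and \<rho>: "measuring K H A B' \<rho>" by auto
  let ?i = "inv_into (carrier B) \<theta>"
  have "measuring K H A B (\<lambda>h. \<lambda>a\<in>carrier A. ?i (\<rho> h a))"
    by (rule measuring_algebra_hom[OF H A B' B \<rho> algebra_hom_inverse[OF B \<theta> bij]])
  with R H have ex1: "\<exists>!\<phi>. \<phi> \<in> coalgebra_hom K H R \<inter> extensional (carrier H) \<and>
      (\<forall>h\<in>carrier H. \<pi> (\<phi> h) = (\<lambda>a\<in>carrier A. ?i (\<rho> h a)))"
    unfolding universal_measuring_coalgebra_def by blast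
  \<comment> \<open>The factorisation condition for \<open>\<rho>\<close> is equivalent to that for
    the measuring pulled back to \<open>B\<close>, so unique existence carries over
    literally.\<close>
  have iff: "(\<lambda>a\<in>carrier A. \<theta> (\<pi> (\<phi> h) a)) = \<rho> h \<longleftrightarrow> \<pi> (\<phi> h) = (\<lambda>a\<in>carrier A. ?i (\<rho> h a))"
    if \<phi>: "\<phi> \<in> coalgebra_hom K H R" and h: "h \<in> carrier H" for \<phi> h
  proof -
    have r: "\<phi> h \<in> carrier R" by (rule module_hom_mem[OF coalgebra_hom_linear[OF \<phi>] h])
    have p: "\<pi> (\<phi> h) a \<in> carrier B" "\<rho> h a \<in> carrier B'" if "a \<in> carrier A" for a
      using measuring_mem[OF mR r that] measuring_mem[OF \<rho> h that] .
    have "\<theta> x = y \<longleftrightarrow> x = ?i y" if "x \<in> carrier B" "y \<in> carrier B'" for x y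
      using that bij by (auto simp: bij_betw_def f_inv_into_f)
    then have "(\<forall>a\<in>carrier A. \<theta> (\<pi> (\<phi> h) a) = \<rho> h a) \<longleftrightarrow> (\<forall>a\<in>carrier A. \<pi> (\<phi> h) a = ?i (\<rho> h a))"
      using p by blast
    moreover have "(\<lambda>a\<in>carrier A. \<theta> (\<pi> (\<phi> h) a)) = \<rho> h \<longleftrightarrow> (\<forall>a\<in>carrier A. \<theta> (\<pi> (\<phi> h) a) = \<rho> h a)"
    proof (intro iffI ballI)
      fix a assume e: "(\<lambda>a\<in>carrier A. \<theta> (\<pi> (\<phi> h) a)) = \<rho> h" and a: "a \<in> carrier A"
      from fun_cong[OF e, of a] a show "\<theta> (\<pi> (\<phi> h) a) = \<rho> h a" by simp
    next
      assume "\<forall>a\<in>carrier A. \<theta> (\<pi> (\<phi> h) a) = \<rho> h a"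
      then show "(\<lambda>a\<in>carrier A. \<theta> (\<pi> (\<phi> h) a)) = \<rho> h"
        by (intro extensionalityI[OF restrict_extensional measuring_ext[OF \<rho> h]]) simp
    qed
    moreover have "\<pi> (\<phi> h) = (\<lambda>a\<in>carrier A. ?i (\<rho> h a)) \<longleftrightarrow> (\<forall>a\<in>carrier A. \<pi> (\<phi> h) a = ?i (\<rho> h a))"
      using measuring_ext[OF mR r] by (auto intro!: extensionalityI[of _ "carrier A"])
    ultimately show ?thesis by blast
  qed
  have "(\<phi> \<in> coalgebra_hom K H R \<inter> extensional (carrier H) \<and>
      (\<forall>h\<in>carrier H. (\<lambda>a\<in>carrier A. \<theta> (\<pi> (\<phi> h) a)) = \<rho> h)) \<longleftrightarrow>
    (\<phi> \<in> coalgebra_hom K H R \<inter> extensional (carrier H) \<and>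
      (\<forall>h\<in>carrier H. \<pi> (\<phi> h) = (\<lambda>a\<in>carrier A. ?i (\<rho> h a))))" for \<phi>
    using iff by blast
  with ex1 show "\<exists>!\<phi>. \<phi> \<in> coalgebra_hom K H R \<inter> extensional (carrier H) \<and>
      (\<forall>h\<in>carrier H. (\<lambda>a\<in>carrier A. \<theta> (\<pi> (\<phi> h) a)) = \<rho> h)"
    by (simp only:)
qed

section \<open>The double dual of a finite-dimensional algebra\<close>

text \<open>For finite-dimensional \<open>B\<close> the zero ideal has finite codimension, so the
  dual coalgebra consists of all functionals and evaluation is the classical isomorphism to the
  double dual. It is multiplicative because the comultiplication of the dual is defined through
  values at products.\<close>

lemma finite_dim_double_dual:
  assumes B: "assoc_algebra K B" and fin: "vectorspace.fin_dim K B"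
  defines "\<theta> \<equiv> (\<lambda>b. \<lambda>f\<in>carrier (dual_coalgebra K B). f b)"
  shows "\<theta> \<in> algebra_hom K B (convolution_algebra K (dual_coalgebra K B) (base_algebra K))"
    and "bij_betw \<theta> (carrier B) (carrier (convolution_algebra K (dual_coalgebra K B) (base_algebra K)))"
proof -
  interpret B: assoc_algebra K B by fact
  let ?k = "base_algebra K" and ?D = "dual_coalgebra K B"
  let ?CA = "convolution_algebra K ?D ?k"
  have k: "assoc_algebra K ?k" by (rule assoc_algebra_base_algebra[OF B.field_axioms])
  note kV = assoc_algebra_vectorspace[OF k] and BV = assoc_algebra_vectorspace[OF B]
  interpret k: vectorspace K ?k by (rule kV)
  note cD = coalgebra_dual_coalgebra[OF B]
  interpret D: coalgebra K ?D by (rule cD)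
  note DV = D.vectorspace_axioms
  note CA = assoc_algebra_convolution_algebra[OF cD k]
  note eval = dual_coalgebra_eval[OF B]
  have \<theta>_mem: "\<theta> b \<in> carrier ?CA" if "b \<in> carrier B" for b
    using module_hom_restrict[OF eval[OF that] DV] by (simp add: \<theta>_def)
  have \<theta>_app: "\<theta> b f = f b" if "f \<in> carrier ?D" for b f using that by (simp add: \<theta>_def)
  have ev: "f b \<in> carrier K" if "f \<in> carrier ?D" "b \<in> carrier B" for f b
    using module_hom_mem[OF dual_coalgebra_hom[OF B that(1)] that(2)] by simp
  have "\<theta> \<in> module_hom K B ?CA"
    unfolding module_hom_hom_space_convolution \<theta>_def
    by (rule curry_linear[OF DV kV]) (use eval dual_coalgebra_hom[OF B] in blast)+
  moreover have "\<theta> (x \<otimes>\<^bsub>B\<^esub> y) = \<theta> x \<otimes>\<^bsub>?CA\<^esub> \<theta> y" if xy: "x \<in> carrier B" "y \<in> carrier B" for x y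
  proof -
    have "f (x \<otimes>\<^bsub>B\<^esub> y) = tensor_lift K ?k (\<lambda>g h. \<theta> x g \<otimes>\<^bsub>?k\<^esub> \<theta> y h) (comult ?D f)"
      if f: "f \<in> carrier ?D" for f
    proof -
      have "tensor_lift K ?k (\<lambda>g h. g x \<otimes>\<^bsub>K\<^esub> h y) (comult ?D f) =
          tensor_lift K ?k (\<lambda>g h. \<theta> x g \<otimes>\<^bsub>?k\<^esub> \<theta> y h) (comult ?D f)"
        by (rule tensor_lift_cong[OF DV DV kV bilinear_dual_eval[OF B xy] D.comult_mem[OF f]])
          (simp add: \<theta>_app del: dual_coalgebra_simps)
      then show ?thesis using dual_comult_eval[OF B f xy] by simp
    qed
    then show ?thesis
      by (simp add: \<theta>_def restrict_def fun_eq_iff del: dual_coalgebra_simps)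
  qed
  moreover have "\<theta> \<one>\<^bsub>B\<^esub> = \<one>\<^bsub>?CA\<^esub>"
    using ev by (simp add: \<theta>_def restrict_def fun_eq_iff del: dual_coalgebra_simps(1))
  ultimately show hom: "\<theta> \<in> algebra_hom K B ?CA" by (simp add: algebra_hom_def)
  obtain E c where E: "finite E" "E \<subseteq> carrier B"
    and c': "\<forall>e\<in>E. c e \<in> module_hom K B ?k"
    and sum': "\<forall>v\<in>carrier B. (\<Oplus>\<^bsub>B\<^esub>e\<in>E. c e v \<odot>\<^bsub>B\<^esub> e) = v"
    using fin_dim_coordinates[OF BV fin] by (elim exE conjE) (rule that; assumption)
  note c = bspec[OF c'] and sum = bspec[OF sum']
  have ce: "c e v \<in> carrier K" if "e \<in> E" "v \<in> carrier B" for e v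
    using module_hom_mem[OF c[OF that(1)] that(2)] by simp
  have zero: "ideal {\<zero>\<^bsub>B\<^esub>} B" by (rule B.zeroideal)
  \<comment> \<open>The coordinate functionals have common kernel zero.\<close>
  have codim: "vectorspace.fin_dim K (quotient_module B {\<zero>\<^bsub>B\<^esub>})"
  proof (rule functionals_fin_codim[OF BV ideal_submodule[OF B zero], of "c ` E"])
    fix v assume v: "v \<in> carrier B" "\<forall>\<phi>\<in>c ` E. \<phi> v = \<zero>\<^bsub>K\<^esub>"
    have "(\<Oplus>\<^bsub>B\<^esub>e\<in>E. c e v \<odot>\<^bsub>B\<^esub> e) = (\<Oplus>\<^bsub>B\<^esub>e\<in>E. \<zero>\<^bsub>B\<^esub>)"
      using v(2) E by (intro B.finsum_cong') auto
    then show "v \<in> {\<zero>\<^bsub>B\<^esub>}" using sum[OF v(1)] by simp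
  qed (use E c in auto)
  have dualI: "restrict f (carrier B) \<in> carrier ?D" if f: "f \<in> module_hom K B ?k" for f
    by (rule dual_coalgebraI[OF B module_hom_restrict[OF f BV] _ zero codim])
      (use module_hom_zero[OF BV kV f] in simp_all)
  define d where "d e = restrict (c e) (carrier B)" for e
  have d: "d e \<in> carrier ?D" if "e \<in> E" for e unfolding d_def by (rule dualI[OF c[OF that]])
  show "bij_betw \<theta> (carrier B) (carrier ?CA)"
    unfolding bij_betw_def
  proof
    show "inj_on \<theta> (carrier B)"
    proof (rule inj_onI)
      fix x y assume xy: "x \<in> carrier B" "y \<in> carrier B" "\<theta> x = \<theta> y"
      have "c e x = c e y" if e: "e \<in> E" for e
        using fun_cong[OF xy(3), of "d e"] xy(1,2) \<theta>_app[OF d[OF e]] by (simp add: d_def)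
      then have "(\<Oplus>\<^bsub>B\<^esub>e\<in>E. c e x \<odot>\<^bsub>B\<^esub> e) = (\<Oplus>\<^bsub>B\<^esub>e\<in>E. c e y \<odot>\<^bsub>B\<^esub> e)"
        using xy E ce by (intro B.finsum_cong') auto
      then show "x = y" using sum xy(1,2) by simp
    qed
    have "x \<in> \<theta> ` carrier B" if x: "x \<in> carrier ?CA" for x
    proof -
      have xl: "x \<in> module_hom K ?D ?k" and xe: "x \<in> extensional (carrier ?D)" using x by simp_all
      have xd: "x (d e) \<in> carrier K" if "e \<in> E" for e using module_hom_mem[OF xl d[OF that]] by simp
      \<comment> \<open>The preimage of \<open>x\<close> is read off the dual basis: its coefficient
        at \<open>e\<close> is the value of \<open>x\<close> at the coordinate functional
        \<open>d e\<close>.\<close>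
      define b where "b = (\<Oplus>\<^bsub>B\<^esub>e\<in>E. x (d e) \<odot>\<^bsub>B\<^esub> e)"
      have bm: "(\<lambda>e. x (d e) \<odot>\<^bsub>B\<^esub> e) \<in> E \<rightarrow> carrier B" using xd E by auto
      have b: "b \<in> carrier B" unfolding b_def by (rule B.finsum_closed[OF bm])
      have "\<theta> b f = x f" if f: "f \<in> carrier ?D" for f
      proof -
        note fl = dual_coalgebra_hom[OF B f]
        have fe: "f e \<in> carrier K" if "e \<in> E" for e using ev[OF f] that E(2) by blast
        have dm: "(\<lambda>e. f e \<odot>\<^bsub>?D\<^esub> d e) \<in> E \<rightarrow> carrier ?D"
          using D.smult_closed[OF fe d] by blast
        \<comment> \<open>Every functional is expanded in the dual basis with its values at
          \<open>E\<close> as coefficients. Applying the linear \<open>x\<close> to this expansion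
          gives the same sum as applying \<open>f\<close> to \<open>b\<close>.\<close>
        have "f = (\<Oplus>\<^bsub>?D\<^esub>e\<in>E. f e \<odot>\<^bsub>?D\<^esub> d e)"
        proof (rule dual_coalgebra_eqI[OF B f D.finsum_closed[OF dm]])
          fix v assume v: "v \<in> carrier B"
          have vm: "(\<lambda>e. c e v \<odot>\<^bsub>B\<^esub> e) \<in> E \<rightarrow> carrier B" using ce[OF _ v] E by auto
          have "f v = f (\<Oplus>\<^bsub>B\<^esub>e\<in>E. c e v \<odot>\<^bsub>B\<^esub> e)" by (simp only: sum[OF v])
          also have "\<dots> = (\<Oplus>\<^bsub>?k\<^esub>e\<in>E. f (c e v \<odot>\<^bsub>B\<^esub> e))"
            by (rule module_hom_finsum[OF BV kV fl vm])
          also have "\<dots> = (\<Oplus>\<^bsub>?k\<^esub>e\<in>E. (f e \<odot>\<^bsub>?D\<^esub> d e) v)"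
          proof (rule k.M.finsum_cong')
            fix e assume e: "e \<in> E"
            have "f (c e v \<odot>\<^bsub>B\<^esub> e) = c e v \<otimes>\<^bsub>K\<^esub> f e"
              using module_hom_smult[OF fl ce[OF e v]] e E by auto
            also have "\<dots> = f e \<otimes>\<^bsub>K\<^esub> c e v" using ce[OF e v] fe[OF e] by (rule B.R.m_comm)
            finally show "f (c e v \<odot>\<^bsub>B\<^esub> e) = (f e \<odot>\<^bsub>?D\<^esub> d e) v" using v by (simp add: d_def)
          qed (use v fe ce in \<open>auto simp: d_def\<close>)
          also have "\<dots> = (\<Oplus>\<^bsub>?D\<^esub>e\<in>E. f e \<odot>\<^bsub>?D\<^esub> d e) v"
            by (rule module_hom_finsum[OF DV kV eval[OF v] dm, symmetric])
          finally show "f v = (\<Oplus>\<^bsub>?D\<^esub>e\<in>E. f e \<odot>\<^bsub>?D\<^esub> d e) v" .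
        qed
        then have "x f = x (\<Oplus>\<^bsub>?D\<^esub>e\<in>E. f e \<odot>\<^bsub>?D\<^esub> d e)" by (rule arg_cong)
        also have "\<dots> = (\<Oplus>\<^bsub>?k\<^esub>e\<in>E. x (f e \<odot>\<^bsub>?D\<^esub> d e))" by (rule module_hom_finsum[OF DV kV xl dm])
        also have "\<dots> = (\<Oplus>\<^bsub>?k\<^esub>e\<in>E. f (x (d e) \<odot>\<^bsub>B\<^esub> e))"
        proof (rule k.M.finsum_cong')
          fix e assume e: "e \<in> E"
          have "x (f e \<odot>\<^bsub>?D\<^esub> d e) = f e \<otimes>\<^bsub>K\<^esub> x (d e)"
            using module_hom_smult[OF xl fe[OF e] d[OF e]] by simp
          also have "\<dots> = x (d e) \<otimes>\<^bsub>K\<^esub> f e" using fe[OF e] xd[OF e] by (rule B.R.m_comm)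
          finally show "x (f e \<odot>\<^bsub>?D\<^esub> d e) = f (x (d e) \<odot>\<^bsub>B\<^esub> e)"
            using module_hom_smult[OF fl xd[OF e]] e E by auto
        qed (use module_hom_mem[OF fl] bm in auto)
        also have "\<dots> = f b" unfolding b_def by (rule module_hom_finsum[OF BV kV fl bm, symmetric])
        finally show ?thesis by (simp add: \<theta>_app[OF f])
      qed
      then have "\<theta> b = x"
        using \<theta>_mem[OF b] xe by (intro extensionalityI[of _ "carrier ?D"]) simp_all
      with b show ?thesis by blast
    qed
    then show "\<theta> ` carrier B = carrier ?CA" using \<theta>_mem by blast
  qed
qed

lemma coalgebra_isomorphic_trans:
  assumes C: "coalgebra K C" and D: "coalgebra K D" and E: "coalgebra K E"
    and CD: "coalgebra_isomorphic K C D" and DE: "coalgebra_isomorphic K D E"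
  shows "coalgebra_isomorphic K C E"
proof -
  from CD obtain f where f: "f \<in> coalgebra_hom K C D" "bij_betw f (carrier C) (carrier D)"
    unfolding coalgebra_isomorphic_def by blast
  from DE obtain g where g: "g \<in> coalgebra_hom K D E" "bij_betw g (carrier D) (carrier E)"
    unfolding coalgebra_isomorphic_def by blast
  from coalgebra_hom_comp[OF C D E f(1) g(1)] bij_betw_trans[OF f(2) g(2)] show ?thesis
    unfolding coalgebra_isomorphic_def comp_def by blast
qed

text \<open>The second type at which \<open>P\<close>, \<open>Q\<close> and \<open>R\<close> are
  assumed universal is the type of the elements of \<open>dual_coalgebra K S\<close>. Each of them
  can therefore be compared with that coalgebra, which itself is universal for every type.\<close>

theorem corollary2p13:
  fixes K :: "('k, 'm) ring_scheme"
    and A :: "('k, 'a, 'ma) module_scheme"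
    and B :: "('k, 'b, 'mb) module_scheme"
    and P :: "('k, 'p) coalgebra"
    and \<pi> :: "'p \<Rightarrow> 'a \<Rightarrow> ('b \<Rightarrow> 'k) \<Rightarrow> 'k"
    and Q :: "('k, 'q) coalgebra"
    and \<kappa> :: "'q \<Rightarrow> ('k, 'a, 'b \<Rightarrow> 'k) sweedler \<Rightarrow> 'k"
  defines "S \<equiv> sweedler_product K A (dual_coalgebra K B)"
  assumes "field K" and "assoc_algebra K A" and "assoc_algebra K B"
    and P: "universal_measuring_coalgebra TYPE('p) K
               A (convolution_algebra K (dual_coalgebra K B) (base_algebra K)) P \<pi>"
            "universal_measuring_coalgebra TYPE(('k, 'a, 'b \<Rightarrow> 'k) sweedler \<Rightarrow> 'k) K
               A (convolution_algebra K (dual_coalgebra K B) (base_algebra K)) P \<pi>"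
    and Q: "universal_measuring_coalgebra TYPE('q) K S (base_algebra K) Q \<kappa>"
            "universal_measuring_coalgebra TYPE(('k, 'a, 'b \<Rightarrow> 'k) sweedler \<Rightarrow> 'k) K
               S (base_algebra K) Q \<kappa>"
  shows "coalgebra_isomorphic K P Q \<and>
    coalgebra_isomorphic K Q (dual_coalgebra K S) \<and>
    (vectorspace.fin_dim K B \<longrightarrow>
      (\<forall>(R :: ('k, 'r) coalgebra) \<rho>.
        universal_measuring_coalgebra TYPE('r) K A B R \<rho> \<and>
        universal_measuring_coalgebra TYPE(('k, 'a, 'b \<Rightarrow> 'k) sweedler \<Rightarrow> 'k) K A B R \<rho> \<longrightarrow>
        coalgebra_isomorphic K R Q))"
proof -
  note A = \<open>assoc_algebra K A\<close> and B = \<open>assoc_algebra K B\<close>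
  let ?C = "dual_coalgebra K B" and ?k = "base_algebra K"
  let ?CA = "convolution_algebra K ?C ?k" and ?D = "dual_coalgebra K S"
  have k: "assoc_algebra K ?k" by (rule assoc_algebra_base_algebra[OF \<open>field K\<close>])
  have C: "coalgebra K ?C" by (rule coalgebra_dual_coalgebra[OF B])
  have CA: "assoc_algebra K ?CA" by (rule assoc_algebra_convolution_algebra[OF C k])
  have S: "assoc_algebra K S" unfolding S_def by (rule assoc_algebra_sweedler_product[OF A C])
  have D: "coalgebra K ?D" by (rule coalgebra_dual_coalgebra[OF S])
  have cQ: "coalgebra K Q" using Q(1) by (simp add: universal_measuring_coalgebra_def)
  note DS = universal_measuring_dual[OF S]
  note DA = universal_measuring_sweedler_dual[OF A C, folded S_def]
  \<comment> \<open>Both directions come from the universal property with the roles exchanged, so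
    the inverse of a bijective coalgebra map never has to be shown to be one.\<close>
  have QD: "coalgebra_isomorphic K Q ?D" and DQ: "coalgebra_isomorphic K ?D Q"
    by (rule universal_measuring_isomorphic[OF k Q DS DS],
        rule universal_measuring_isomorphic[OF k DS DS Q(2,1)])
  \<comment> \<open>\<open>P\<close> and \<open>Q\<close> are universal for different algebras,
    \<open>A\<close> with [C,k] and \<open>S\<close> with the ground field. The dual coalgebra of
    \<open>S\<close> is universal for both, hence the detour through it.\<close>
  have "coalgebra_isomorphic K P Q"
    by (rule coalgebra_isomorphic_trans[OF _ D cQ universal_measuring_isomorphic[OF CA P DA DA] DQ])
      (use P(1) in \<open>simp add: universal_measuring_coalgebra_def\<close>)
  moreover have "coalgebra_isomorphic K R Q"
    if fin: "vectorspace.fin_dim K B"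
      and R: "universal_measuring_coalgebra TYPE('r) K A B R \<rho>"
        "universal_measuring_coalgebra TYPE(('k, 'a, 'b \<Rightarrow> 'k) sweedler \<Rightarrow> 'k) K A B R \<rho>"
    for R :: "('k, 'r) coalgebra" and \<rho>
  proof -
    \<comment> \<open>Evaluation identifies \<open>B\<close> with [C,k] for \<open>C\<close> the
      dual of \<open>B\<close>, which makes \<open>R\<close> universal for the same target as
      \<open>P\<close>; the rest repeats the argument for \<open>P\<close>.\<close>
    note transfer = universal_measuring_transfer[OF A B CA finite_dim_double_dual[OF B fin]]
    show ?thesis
      by (rule coalgebra_isomorphic_trans[OF _ D cQ
            universal_measuring_isomorphic[OF CA transfer[OF R(1)] transfer[OF R(2)] DA DA] DQ])
        (use R(1) in \<open>simp add: universal_measuring_coalgebra_def\<close>)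
  qed
  ultimately show ?thesis using QD by blast
qed

end
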